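(* Let $\Gamma=\mathbb F_r$ and let $\varepsilon_c=\varepsilon_c(r)$ be the constant defined below. If $0<\varepsilon<\varepsilon_c$, then the product self-joining $\mathrm{Is}_\varepsilon\times\mathrm{Is}_\varepsilon$ does not maximize the $f$-invariant among self-joinings of $\mathrm{Is}_\varepsilon$: there is $\lambda\in\mathcal J(\mathrm{Is}_\varepsilon,\mathrm{Is}_\varepsilon)$ with $f(\lambda)>f(\mathrm{Is}_\varepsilon\times\mathrm{Is}_\varepsilon)$.
   Context: $\Gamma=\mathbb F_r$ is the free group on $s_1,\dots,s_r$. For a finite set $V$ and $\sigma\in\mathrm{Hom}(\mathbb F_r,\mathrm{Sym}(V))$ (write $\sigma^\gamma=\sigma(\gamma)$), the graph of $\sigma$ is the multigraph with one edge $\{v,\sigma^{s_i}v\}$ for each $v\in V$, $i\in[r]$ (so $|V|r$ edges). For $\mathbf x\in\mathtt A^V$, $\Pi^\sigma_v\mathbf x=(\mathbf x(\sigma^\gamma v))_{\gamma\in\Gamma}$, $P^\sigma_{\mathbf x}=\frac1{|V|}\sum_v\delta_{\Pi^\sigma_v\mathbf x}$, $\Omega(\sigma,\mathcal O)=\{\mathbf x:P^\sigma_{\mathbf x}\in\mathcal O\}$. Let $\sigma_n\in\mathrm{Hom}(\mathbb F_r,\mathrm{Sym}([n]))$ be uniformly random (i.e. $\sigma_n^{s_1},\dots,\sigma_n^{s_r}$ independent uniform permutations). For a shift-invariant probability measure $\mu$ on $\mathtt A^\Gamma$ ($\mathtt A$ finite, shift $(\beta\mathbf x)(\gamma)=\mathbf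 x(\gamma\beta)$), the $f$-invariant is $f(\mu)=\inf_{\mathcal O\ni\mu}\limsup_{n}\frac1n\log\mathbb E|\Omega(\sigma_n,\mathcal O)|$ (infimum over weak* open neighborhoods). $\mathcal J(\mu,\mu)$ is the set of shift-invariant measures on $(\mathtt A\times\mathtt A)^\Gamma$ with both marginals $\mu$. For $\varepsilon\in(0,1/2]$, $\mathrm{Is}_\varepsilon$ is the free-boundary Ising measure: the law of the $\{-1,+1\}$-valued, $\Gamma$-indexed stationary Markov chain on the Cayley tree with uniform single-site marginal and transition matrix $\begin{pmatrix}1-\varepsilon&\varepsilon\\ \varepsilon&1-\varepsilon\end{pmatrix}$ across each edge. A bisection of a finite vertex set $V$ is a partition $V=V_1\sqcup V_2$ with $||V_1|-|V_2||\le1$; its cut size is the number of edges of the graph with endpoints in different parts; $\mathsf{mcut}(\sigma)$ is the minimum cut size over bisections of the graph of $\sigma$. The constant $\varepsilon_c=\varepsilon_c(r)$ is defined as the limit in probability of $\mathsf{mcut}(\sigma_n)/(rn)$ as $n\to\infty$ (its existence, and $\varepsilon_c=\frac12-\mathsf P_*\frac1{\sqrt{2r}}+o_r(r^{-1/2})$ with $\mathsf P_*\approx0.7632$ the Parisi ground-state energy constant of the Sherrington–Kirkpatrick model, is due to Dembo–Montanari–Sen). *)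

theory Defs
  imports "HOL-Probability.Probability" "HOL-Combinatorics.Permutations"
begin

text \<open>A letter (i, True) is the generator s_i, (i, False) is its inverse.\<close>
type_synonym gen = "nat \<times> bool"
type_synonym word = "gen list"

definition ginv :: "gen \<Rightarrow> gen" where
  "ginv g = (fst g, \<not> snd g)"

fun reduced :: "word \<Rightarrow> bool" where
  "reduced [] = True"
| "reduced [g] = True"
| "reduced (g # h # t) = (h \<noteq> ginv g \<and> reduced (h # t))"

definition FG :: "nat \<Rightarrow> word set" where
  "FG r = {w. reduced w \<and> (\<forall>g\<in>set w. fst g < r)}"

fun cons_red :: "gen \<Rightarrow> word \<Rightarrow> word" where
  "cons_red g [] = [g]"
| "cons_red g (h # t) = (if h = ginv g then t else g # h # t)"

definition gmult :: "word \<Rightarrow> word \<Rightarrow> word" where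
  "gmult xs ys = foldr cons_red xs ys"

definition CS :: "nat \<Rightarrow> (word \<Rightarrow> 'a) measure" where
  "CS r = PiM (FG r) (\<lambda>_. count_space UNIV)"

definition shift :: "nat \<Rightarrow> word \<Rightarrow> (word \<Rightarrow> 'a) \<Rightarrow> (word \<Rightarrow> 'a)" where
  "shift r \<beta> x = restrict (\<lambda>\<gamma>. x (gmult \<gamma> \<beta>)) (FG r)"

definition prob_measures :: "nat \<Rightarrow> (word \<Rightarrow> 'a) measure set" where
  "prob_measures r = {\<nu>. prob_space \<nu> \<and> sets \<nu> = sets (CS r)}"

definition shift_invariant :: "nat \<Rightarrow> (word \<Rightarrow> 'a) measure \<Rightarrow> bool" where
  "shift_invariant r \<mu> \<longleftrightarrow> \<mu> \<in> prob_measures r \<and>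
     (\<forall>\<beta>\<in>FG r. distr \<mu> (CS r) (shift r \<beta>) = \<mu>)"

definition perm_tuples :: "nat \<Rightarrow> nat \<Rightarrow> (nat \<Rightarrow> nat \<Rightarrow> nat) set" where
  "perm_tuples r n = PiE {..<r} (\<lambda>_. {p. p permutes {..<n}})"

fun act :: "(nat \<Rightarrow> nat \<Rightarrow> nat) \<Rightarrow> word \<Rightarrow> nat \<Rightarrow> nat" where
  "act s [] v = v"
| "act s (g # w) v = (if snd g then s (fst g) else inv (s (fst g))) (act s w v)"

definition proj :: "nat \<Rightarrow> (nat \<Rightarrow> nat \<Rightarrow> nat) \<Rightarrow> nat \<Rightarrow> (nat \<Rightarrow> 'a) \<Rightarrow> (word \<Rightarrow> 'a)" where
  "proj r s v x = restrict (\<lambda>\<gamma>. x (act s \<gamma> v)) (FG r)"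

definition emp :: "nat \<Rightarrow> nat \<Rightarrow> (nat \<Rightarrow> nat \<Rightarrow> nat) \<Rightarrow> (nat \<Rightarrow> 'a) \<Rightarrow> (word \<Rightarrow> 'a) measure" where
  "emp r n s x = distr (uniform_measure (count_space {..<n}) {..<n}) (CS r) (\<lambda>v. proj r s v x)"

definition cont_fun :: "nat \<Rightarrow> ((word \<Rightarrow> 'a) \<Rightarrow> real) \<Rightarrow> bool" where
  "cont_fun r g \<longleftrightarrow>
     continuous_map (product_topology (\<lambda>_. discrete_topology UNIV) (FG r)) euclideanreal g"

definition weak_open :: "nat \<Rightarrow> (word \<Rightarrow> 'a) measure set \<Rightarrow> bool" where
  "weak_open r U \<longleftrightarrow> U \<subseteq> prob_measures r \<and>
     (\<forall>\<nu>\<in>U. \<exists>G \<delta>. finite G \<and> (\<forall>g\<in>G. cont_fun r g) \<and> \<delta> > 0 \<and>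
        {\<nu>'\<in>prob_measures r. \<forall>g\<in>G. \<bar>integral\<^sup>L \<nu>' g - integral\<^sup>L \<nu> g\<bar> < \<delta>} \<subseteq> U)"

definition Omega :: "nat \<Rightarrow> nat \<Rightarrow> (nat \<Rightarrow> nat \<Rightarrow> nat) \<Rightarrow> (word \<Rightarrow> 'a) measure set
     \<Rightarrow> (nat \<Rightarrow> 'a) set" where
  "Omega r n s U = {x \<in> PiE {..<n} (\<lambda>_. UNIV). emp r n s x \<in> U}"

definition expected_count :: "nat \<Rightarrow> nat \<Rightarrow> (word \<Rightarrow> 'a) measure set \<Rightarrow> real" where
  "expected_count r n U =
     (\<Sum>s\<in>perm_tuples r n. real (card (Omega r n s U))) / real (card (perm_tuples r n))"

definition elog :: "real \<Rightarrow> ereal" where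
  "elog t = (if t \<le> 0 then -\<infinity> else ereal (ln t))"

definition f_inv :: "nat \<Rightarrow> (word \<Rightarrow> 'a::finite) measure \<Rightarrow> ereal" where
  "f_inv r \<mu> = (INF U\<in>{U. weak_open r U \<and> \<mu> \<in> U}.
      limsup (\<lambda>n. ereal (1 / real n) * elog (expected_count r n U)))"

definition marg1 :: "nat \<Rightarrow> (word \<Rightarrow> 'a \<times> 'b) \<Rightarrow> (word \<Rightarrow> 'a)" where
  "marg1 r z = restrict (\<lambda>\<gamma>. fst (z \<gamma>)) (FG r)"

definition marg2 :: "nat \<Rightarrow> (word \<Rightarrow> 'a \<times> 'b) \<Rightarrow> (word \<Rightarrow> 'b)" where
  "marg2 r z = restrict (\<lambda>\<gamma>. snd (z \<gamma>)) (FG r)"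

definition joinings :: "nat \<Rightarrow> (word \<Rightarrow> 'a) measure \<Rightarrow> (word \<Rightarrow> 'a) measure
     \<Rightarrow> (word \<Rightarrow> 'a \<times> 'a) measure set" where
  "joinings r \<mu> \<nu> = {J. shift_invariant r J \<and>
      distr J (CS r) (marg1 r) = \<mu> \<and> distr J (CS r) (marg2 r) = \<nu>}"

definition prod_join :: "nat \<Rightarrow> (word \<Rightarrow> 'a) measure \<Rightarrow> (word \<Rightarrow> 'b) measure
     \<Rightarrow> (word \<Rightarrow> 'a \<times> 'b) measure" where
  "prod_join r \<mu> \<nu> = distr (\<mu> \<Otimes>\<^sub>M \<nu>) (CS r) (\<lambda>(x, y). restrict (\<lambda>\<gamma>. (x \<gamma>, y \<gamma>)) (FG r))"

text \<open>Spins: True = +1, False = -1. The Cayley tree has edges {w, g # w}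
  (left multiplication by a generator, compatible with the right shift).\<close>
definition ball :: "nat \<Rightarrow> nat \<Rightarrow> word set" where
  "ball r k = {w \<in> FG r. length w \<le> k}"

definition Ising_cyl :: "real \<Rightarrow> (word \<Rightarrow> bool) \<Rightarrow> word set \<Rightarrow> real" where
  "Ising_cyl \<epsilon> \<xi> B = 1/2 * (\<Prod>w\<in>B - {[]}. if \<xi> w = \<xi> (tl w) then 1 - \<epsilon> else \<epsilon>)"

definition Ising :: "nat \<Rightarrow> real \<Rightarrow> (word \<Rightarrow> bool) measure" where
  "Ising r \<epsilon> = (THE \<mu>. \<mu> \<in> prob_measures r \<and>
     (\<forall>k \<xi>. measure \<mu> {x \<in> space (CS r). \<forall>\<gamma>\<in>ball r k. x \<gamma> = \<xi> \<gamma>}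
              = Ising_cyl \<epsilon> \<xi> (ball r k)))"

definition bisections :: "nat \<Rightarrow> nat set set" where
  "bisections n = {V1. V1 \<subseteq> {..<n} \<and> \<bar>int (card V1) - int (n - card V1)\<bar> \<le> 1}"

definition cut_size :: "nat \<Rightarrow> nat \<Rightarrow> (nat \<Rightarrow> nat \<Rightarrow> nat) \<Rightarrow> nat set \<Rightarrow> nat" where
  "cut_size r n s V1 = card {(v, i). v < n \<and> i < r \<and> (v \<in> V1) \<noteq> (s i v \<in> V1)}"

definition mcut :: "nat \<Rightarrow> nat \<Rightarrow> (nat \<Rightarrow> nat \<Rightarrow> nat) \<Rightarrow> nat" where
  "mcut r n s = Min (cut_size r n s ` bisections n)"

definition eps_c_limit :: "nat \<Rightarrow> real \<Rightarrow> bool" where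
  "eps_c_limit r c \<longleftrightarrow> (\<forall>\<delta>>0.
     (\<lambda>n. real (card {s \<in> perm_tuples r n.
            \<bar>real (mcut r n s) / (real r * real n) - c\<bar> > \<delta>}) / real (card (perm_tuples r n)))
     \<longlonglongrightarrow> 0)"

end

theory Submission
  imports Defs "HOL-Complex_Analysis.Great_Picard" "HOL-Combinatorics.Multiset_Permutations" "HOL-Real_Asymp.Real_Asymp"
begin

text \<open>
  Let F be the exponential growth rate of the expected number of balanced labelings of a random
  homomorphism in which every generator cuts a fraction \<open>\<epsilon>\<close> of its edges. A first moment
  computation on edge statistics shows that the product self-joining has f-invariant at most 2F.
  In the planted model almost all of those labelings look locally like the Ising chain, so they
  still number \<open>e\<^sup>n\<^sup>F\<close> in expectation when this is demanded as well. Each of them is a bisection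
  of cut density \<open>\<epsilon>\<close>, below the typical minimum, so by concentration of measure on products of
  symmetric groups they exist only with exponentially small probability. By Cauchy--Schwarz the
  expected number of pairs of them exceeds \<open>e\<^sup>2\<^sup>n\<^sup>F\<close> by an exponential factor. The pigeonhole
  principle and compactness produce a self-joining that accounts for this excess.
\<close>

section \<open>Measures on configurations\<close>

text \<open>The sign of F plays no part. When F > 0 the expected number of labelings is large
  although typically there are none, so the expectation is carried by a rare event on which
  labelings come in great numbers; the excess of pairs is exactly the price of that rarity. The two
  bounds are asymmetric. As f is an infimum over neighbourhoods, one neighbourhood described by
  single-edge statistics bounds the product joining from above. The lower bound must hold in every
  neighbourhood of the new measure, and its marginals must be Ising exactly, not only on edges.
  Hence the good labelings match the Ising chain on the k-ball within 1/(k+1), and k is sent to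
  infinity only after the number of vertices. For this the exponential gain must not depend on k; it
  does not, since it comes from the minimal cut alone. Counting is done on 2N vertices with exactly
  balanced labelings, where the number of cut edges of one kind determines the whole edge table of a
  generator. A limsup may be tested along even numbers.\<close>

definition fdev :: "nat \<Rightarrow> word set \<Rightarrow> (word \<Rightarrow> 'a) set \<Rightarrow> (word \<Rightarrow> 'a) set" where
  "fdev r B T = {x \<in> space (CS r). restrict x B \<in> T}"

lemma space_CS: "space (CS r) = PiE (FG r) (\<lambda>_. UNIV)"
  by (simp add: CS_def space_PiM)

lemma fdev_eq_prod_emb: "fdev r B T = prod_emb (FG r) (\<lambda>_. count_space UNIV) B T"
  by (auto simp: fdev_def prod_emb_def space_CS)

lemma sets_PiM_finite_alphabet:
  fixes B :: "'i set"
  assumes "finite B"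
  shows "sets (PiM B (\<lambda>_. count_space (UNIV :: 'a::finite set))) = Pow (PiE B (\<lambda>_. UNIV))"
  using assms by (subst count_space_PiM_finite) (auto simp: uncountable_infinite)

lemma fdev_sets:
  fixes T :: "(word \<Rightarrow> 'a::finite) set"
  assumes "finite B" "B \<subseteq> FG r"
  shows "fdev r B T \<in> sets (CS r)"
proof -
  have "fdev r B T = prod_emb (FG r) (\<lambda>_. count_space UNIV) B (T \<inter> PiE B (\<lambda>_. UNIV))"
    using assms(2) by (auto simp: fdev_def prod_emb_def space_CS)
  moreover have "\<dots> \<in> sets (CS r)"
    unfolding CS_def using assms by (intro measurable_prod_emb)
      (auto simp: sets_PiM_finite_alphabet)
  ultimately show ?thesis by simp
qed

text \<open>An event on a window is also an event on every larger window, so any finite window may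
  be enlarged to a ball.\<close>

lemma fdev_mono_base:
  assumes "B \<subseteq> B'"
  shows "fdev r B T = fdev r B' {y. restrict y B \<in> T}"
  using assms by (simp add: fdev_def Int_absorb1)

lemma openin_fdev:
  fixes T :: "(word \<Rightarrow> 'a) set"
  assumes "finite B" "B \<subseteq> FG r"
  shows "openin (product_topology (\<lambda>_. discrete_topology UNIV) (FG r)) (fdev r B T)"
  unfolding openin_product_topology_alt
proof
  fix x assume x: "x \<in> fdev r B T"
  let ?V = "\<lambda>i. if i \<in> B then {x i} else UNIV"
  have "finite {i \<in> FG r. ?V i \<noteq> topspace (discrete_topology UNIV)}"
    by (rule finite_subset[OF _ assms(1)]) auto
  moreover have "Pi\<^sub>E (FG r) ?V \<subseteq> fdev r B T"
  proof
    fix y assume y: "y \<in> Pi\<^sub>E (FG r) ?V"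
    have "y i = x i" if "i \<in> B" for i
      using PiE_mem[OF y, of i] that assms(2) by auto
    then have "restrict y B = restrict x B"
      by (auto simp: restrict_def)
    with x y show "y \<in> fdev r B T" by (auto simp: fdev_def space_CS PiE_iff)
  qed
  moreover have "x \<in> Pi\<^sub>E (FG r) ?V" using x by (auto simp: fdev_def space_CS PiE_iff)
  ultimately show "\<exists>U. finite {i \<in> FG r. U i \<noteq> topspace (discrete_topology UNIV)} \<and>
      (\<forall>i\<in>FG r. openin (discrete_topology UNIV) (U i)) \<and> x \<in> Pi\<^sub>E (FG r) U \<and>
      Pi\<^sub>E (FG r) U \<subseteq> fdev r B T"
    by (intro exI[of _ ?V]) auto
qed

lemma finite_ball: "finite (ball r k)"
proof -
  have "ball r k \<subseteq> {w. set w \<subseteq> {..<r} \<times> UNIV \<and> length w \<le> k}"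
    by (auto simp: ball_def FG_def)
  then show ?thesis
    by (rule finite_subset) (rule finite_lists_length_le, simp)
qed

lemma ball_subset_FG: "ball r k \<subseteq> FG r"
  by (auto simp: ball_def)

lemma ball_mono: "j \<le> k \<Longrightarrow> ball r j \<subseteq> ball r k"
  by (auto simp: ball_def)

lemma finite_subset_ball:
  assumes "finite B" "B \<subseteq> FG r"
  obtains k where "B \<subseteq> ball r k"
proof
  show "B \<subseteq> ball r (Max (length ` B))"
    using assms by (auto simp: ball_def)
qed

text \<open>Over a finite alphabet an event on a finite window is a finite disjoint union of
  cylinders, so cylinder probabilities carry all the information.\<close>

lemma measure_fdev_eq_sum:
  fixes \<nu> :: "(word \<Rightarrow> 'a::finite) measure"
  assumes "\<nu> \<in> prob_measures r" "finite B" "B \<subseteq> FG r"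
  shows "measure \<nu> (fdev r B T) = (\<Sum>\<xi>\<in>T \<inter> PiE B (\<lambda>_. UNIV). measure \<nu> (fdev r B {\<xi>}))"
proof -
  interpret prob_space \<nu> using assms by (simp add: prob_measures_def)
  have s: "sets \<nu> = sets (CS r)" using assms by (simp add: prob_measures_def)
  have "fdev r B T = (\<Union>\<xi>\<in>T \<inter> PiE B (\<lambda>_. UNIV). fdev r B {\<xi>})"
    using assms(3) by (auto simp: fdev_def space_CS)
  moreover have "measure \<nu> (\<Union>\<xi>\<in>T \<inter> PiE B (\<lambda>_. UNIV). fdev r B {\<xi>})
      = (\<Sum>\<xi>\<in>T \<inter> PiE B (\<lambda>_. UNIV). measure \<nu> (fdev r B {\<xi>}))"
    using assms by (intro finite_measure_finite_Union)
      (auto simp: s fdev_sets disjoint_family_on_def intro!: finite_Int finite_PiE, auto simp: fdev_def)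
  ultimately show ?thesis by simp
qed

text \<open>Finite-window rectangles are an intersection-stable generator, and every finite window
  lies in a ball.\<close>

lemma prob_measures_eqI:
  fixes \<nu> \<nu>' :: "(word \<Rightarrow> 'a::finite) measure"
  assumes "\<nu> \<in> prob_measures r" "\<nu>' \<in> prob_measures r"
    and eq: "\<And>k \<xi>. \<xi> \<in> PiE (ball r k) (\<lambda>_. UNIV) \<Longrightarrow>
      measure \<nu> (fdev r (ball r k) {\<xi>}) = measure \<nu>' (fdev r (ball r k) {\<xi>})"
  shows "\<nu> = \<nu>'"
proof (rule measure_eqI_PiM_infinite)
  interpret a: prob_space \<nu> using assms by (simp add: prob_measures_def)
  interpret b: prob_space \<nu>' using assms by (simp add: prob_measures_def)
  show "sets \<nu> = sets (PiM (FG r) (\<lambda>_. count_space UNIV))"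
    "sets \<nu>' = sets (PiM (FG r) (\<lambda>_. count_space UNIV))"
    using assms by (auto simp: prob_measures_def CS_def)
  show "finite_measure \<nu>" by unfold_locales
  fix A :: "word \<Rightarrow> 'a set" and J assume J: "finite J" "J \<subseteq> FG r"
  obtain k where k: "J \<subseteq> ball r k" using finite_subset_ball J by blast
  have "measure \<nu> (fdev r J (PiE J A)) = measure \<nu>' (fdev r J (PiE J A))"
    unfolding fdev_mono_base[OF k]
      measure_fdev_eq_sum[OF assms(1) finite_ball ball_subset_FG, where T = "{y. restrict y J \<in> PiE J A}"]
      measure_fdev_eq_sum[OF assms(2) finite_ball ball_subset_FG, where T = "{y. restrict y J \<in> PiE J A}"]
    using eq by (intro sum.cong) auto
  then show "emeasure \<nu> (prod_emb (FG r) (\<lambda>_. count_space UNIV) J (Pi\<^sub>E J A))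
      = emeasure \<nu>' (prod_emb (FG r) (\<lambda>_. count_space UNIV) J (Pi\<^sub>E J A))"
    by (simp add: fdev_eq_prod_emb a.emeasure_eq_measure b.emeasure_eq_measure)
qed

text \<open>Kolmogorov extension of the limiting probabilities \<open>p\<close>: consistency is
  inherited from each \<open>\<nu> k\<close>, and countable additivity comes from compactness of the
  configuration space over a finite alphabet.\<close>

lemma exists_measure_of_fdev_limits:
  fixes \<nu> :: "nat \<Rightarrow> (word \<Rightarrow> 'a::finite) measure"
  assumes \<nu>: "\<And>k. \<nu> k \<in> prob_measures r"
    and conv: "\<And>B T. finite B \<Longrightarrow> B \<subseteq> FG r \<Longrightarrow> convergent (\<lambda>k. measure (\<nu> k) (fdev r B T))"
  obtains \<mu> where "\<mu> \<in> prob_measures r"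
    "\<And>B T. finite B \<Longrightarrow> B \<subseteq> FG r \<Longrightarrow> (\<lambda>k. measure (\<nu> k) (fdev r B T)) \<longlonglongrightarrow> measure \<mu> (fdev r B T)"
proof -
  let ?M = "\<lambda>_ :: word. count_space (UNIV :: 'a set)"
  let ?U = "\<lambda>B. PiE B (\<lambda>_ :: word. UNIV :: 'a set)"
  have finU: "finite (?U B)" if "finite B" for B using that by (simp add: finite_PiE)
  define p where "p B T = Topological_Spaces.lim (\<lambda>k. measure (\<nu> k) (fdev r B T))" for B and T :: "(word \<Rightarrow> 'a) set"
  have p: "(\<lambda>k. measure (\<nu> k) (fdev r B T)) \<longlonglongrightarrow> p B T" if "finite B" "B \<subseteq> FG r" for B T
    using conv[OF that] by (simp add: p_def convergent_LIMSEQ_iff)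
  have p_nonneg: "p B T \<ge> 0" if "finite B" "B \<subseteq> FG r" for B T
    using p[OF that] by (rule LIMSEQ_le_const) auto
  have p_sum: "p B T = (\<Sum>\<xi>\<in>T \<inter> ?U B. p B {\<xi>})" if "finite B" "B \<subseteq> FG r" for B T
  proof -
    have "(\<lambda>k. measure (\<nu> k) (fdev r B T)) \<longlonglongrightarrow> (\<Sum>\<xi>\<in>T \<inter> ?U B. p B {\<xi>})"
      unfolding measure_fdev_eq_sum[OF \<nu> that, where T = T] by (intro tendsto_sum p that)
    with p[OF that] show ?thesis by (rule LIMSEQ_unique)
  qed
  have p_Int: "p B (T \<inter> ?U B) = p B T" if "finite B" "B \<subseteq> FG r" for B T
    unfolding p_sum[OF that, of T] p_sum[OF that, of "T \<inter> ?U B"] by (simp add: Int_assoc)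
  have p_UNIV: "p B UNIV = 1" if "finite B" "B \<subseteq> FG r" for B
  proof -
    have "measure (\<nu> k) (fdev r B UNIV) = 1" for k
    proof -
      interpret prob_space "\<nu> k" using \<nu>[of k] by (simp add: prob_measures_def)
      have "space (\<nu> k) = space (CS r)" using \<nu>[of k] by (auto simp: prob_measures_def dest: sets_eq_imp_space_eq)
      then show ?thesis using prob_space by (simp add: fdev_def)
    qed
    then show ?thesis by (simp add: p_def)
  qed
  define P where "P J = point_measure (?U J) (\<lambda>\<xi>. ennreal (p J {\<xi>}))" for J
  have setsP: "sets (P J) = sets (PiM J ?M)" if "finite J" for J
    using that by (simp add: P_def sets_point_measure sets_PiM_finite_alphabet)
  have P_eq: "emeasure (P J) X = ennreal (p J X)" if "finite J" "J \<subseteq> FG r" "X \<subseteq> ?U J" for J X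
    using that by (simp add: P_def emeasure_point_measure_finite finU p_sum[of J X] p_nonneg
        sum_ennreal Int_absorb2)
  have spP: "space (P J) = ?U J" for J by (simp add: P_def space_point_measure)
  interpret P: projective_family "FG r" P ?M
  proof (rule projective_family.intro)
    fix J H assume J: "J \<subseteq> H" "finite H" "H \<subseteq> FG r"
    then have J': "finite J" "J \<subseteq> FG r" by (auto intro: finite_subset)
    have meas: "(\<lambda>f. restrict f J) \<in> measurable (P H) (PiM J ?M)"
      by (intro measurableI) (use J J' in \<open>auto simp: P_def space_point_measure sets_point_measure space_PiM\<close>)
    show "P J = distr (P H) (PiM J ?M) (\<lambda>f. restrict f J)"
    proof (rule measure_eqI_finite)
      show "sets (P J) = Pow (?U J)" "sets (distr (P H) (PiM J ?M) (\<lambda>f. restrict f J)) = Pow (?U J)"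
        using J' by (simp_all add: P_def sets_point_measure sets_PiM_finite_alphabet)
      show "finite (?U J)" using J' by (simp add: finU)
      fix a assume a: "a \<in> ?U J"
      have "emeasure (distr (P H) (PiM J ?M) (\<lambda>f. restrict f J)) {a}
          = emeasure (P H) ({y. restrict y J \<in> {a}} \<inter> ?U H)"
        using a J' meas by (subst emeasure_distr)
          (auto simp: sets_PiM_finite_alphabet spP intro!: arg_cong[where f = "emeasure (P H)"])
      also have "\<dots> = ennreal (p H ({y. restrict y J \<in> {a}} \<inter> ?U H))"
        using J by (intro P_eq) auto
      also have "p H ({y. restrict y J \<in> {a}} \<inter> ?U H) = p H {y. restrict y J \<in> {a}}"
        using J by (intro p_Int) auto
      also have "\<dots> = p J {a}"
        by (simp add: p_def fdev_mono_base[OF J(1), of r "{a}"])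
      also have "ennreal (p J {a}) = emeasure (P J) {a}"
        using a J' by (simp add: P_eq)
      finally show "emeasure (P J) {a} = emeasure (distr (P H) (PiM J ?M) (\<lambda>f. restrict f J)) {a}" ..
    qed
  next
    fix J assume J: "finite J" "J \<subseteq> FG r"
    show "prob_space (P J)"
    proof (rule prob_spaceI)
      have "p J (?U J) = p J UNIV" using p_Int[OF J, of UNIV] by simp
      then show "emeasure (P J) (space (P J)) = 1"
        using J by (simp add: spP P_eq p_UNIV)
    qed
  qed
  \<comment> \<open>Continuity at the empty set: finite-window events are clopen in a compact space,
    so a decreasing sequence of nonempty ones has a common point. Positive mass in the limit makes
    each of them nonempty.\<close>
  have lim_emb: "emeasure P.lim (prod_emb (FG r) ?M J X) = emeasure (P J) X"
    if J: "finite J" "J \<subseteq> FG r" "X \<in> sets (PiM J ?M)" for J X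
  proof (rule P.emeasure_lim[OF J])
    fix K and X :: "nat \<Rightarrow> (word \<Rightarrow> 'a) set"
    assume K: "\<And>i. K i \<subseteq> FG r" "\<And>i. finite (K i)" "\<And>i. X i \<in> sets (PiM (K i) ?M)"
      and dec: "decseq (\<lambda>i. prod_emb (FG r) ?M (K i) (X i))"
      and pos: "0 < (INF i. emeasure (P (K i)) (X i))"
    let ?T = "product_topology (\<lambda>_ :: word. discrete_topology (UNIV :: 'a set)) (FG r)"
    have compact: "compact_space ?T"
      by (simp add: compact_space_product_topology compact_space_discrete_topology)
    show "(\<Inter>i. prod_emb (FG r) ?M (K i) (X i)) \<noteq> {}"
    proof (rule compact_space_imp_nest[OF compact _ _ dec])
      fix n
      have op: "openin ?T (prod_emb (FG r) ?M (K n) Y)" for Y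
        using openin_fdev[OF K(2)[of n] K(1)[of n]] by (simp add: fdev_eq_prod_emb)
      have "topspace ?T - prod_emb (FG r) ?M (K n) (X n) = prod_emb (FG r) ?M (K n) (- X n)"
        by (auto simp: prod_emb_def)
      then show "closedin ?T (prod_emb (FG r) ?M (K n) (X n))"
        using op[of "- X n"] by (simp add: closedin_def prod_emb_def)
      have "X n \<noteq> {}"
      proof
        assume "X n = {}"
        then have "emeasure (P (K n)) (X n) = 0" by simp
        moreover have "(INF i. emeasure (P (K i)) (X i)) \<le> emeasure (P (K n)) (X n)"
          by (rule INF_lower) simp
        ultimately show False using pos by simp
      qed
      then obtain y where y: "y \<in> X n" by auto
      have yU: "y \<in> ?U (K n)" using y K(2,3)[of n] by (auto simp: sets_PiM_finite_alphabet)
      \<comment> \<open>Any extension of the pattern \<open>y\<close> to the whole group would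
        serve; \<open>undefined\<close> is a filler letter.\<close>
      define z where "z = restrict (\<lambda>i. if i \<in> K n then y i else undefined) (FG r)"
      have "restrict z (K n) = y"
        using yU K(1)[of n] by (auto simp: z_def restrict_def PiE_iff extensional_def fun_eq_iff)
      then have "z \<in> prod_emb (FG r) ?M (K n) (X n)"
        using y by (auto simp: prod_emb_def z_def)
      then show "prod_emb (FG r) ?M (K n) (X n) \<noteq> {}" by auto
    qed
  qed
  have empty: "finite {}" "{} \<subseteq> FG r" by auto
  have prob: "prob_space P.lim"
  proof (rule prob_spaceI)
    have "emeasure P.lim (prod_emb (FG r) ?M {} (?U {})) = emeasure (P {}) (?U {})"
      by (rule lim_emb) (auto simp: sets_PiM_finite_alphabet)
    also have "\<dots> = 1"
      using prob_space.emeasure_space_1[OF P.prob_space_P[OF empty]] by (simp add: spP)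
    also have "prod_emb (FG r) ?M {} (?U {}) = space P.lim"
      by (auto simp: prod_emb_def space_PiM)
    finally show "emeasure P.lim (space P.lim) = 1" .
  qed
  show ?thesis
  proof (rule that)
    show "P.lim \<in> prob_measures r" using prob by (simp add: prob_measures_def CS_def)
    fix B :: "word set" and T :: "(word \<Rightarrow> 'a) set" assume B: "finite B" "B \<subseteq> FG r"
    interpret L: prob_space P.lim by (rule prob)
    have "fdev r B T = prod_emb (FG r) ?M B (T \<inter> ?U B)"
      using B by (auto simp: fdev_def prod_emb_def space_CS)
    then have "emeasure P.lim (fdev r B T) = ennreal (p B (T \<inter> ?U B))"
      using B by (simp add: lim_emb P_eq sets_PiM_finite_alphabet)
    also have "p B (T \<inter> ?U B) = p B T" using B by (rule p_Int)
    finally have "measure P.lim (fdev r B T) = p B T"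
      using p_nonneg[OF B] by (simp add: measure_def)
    then show "(\<lambda>k. measure (\<nu> k) (fdev r B T)) \<longlonglongrightarrow> measure P.lim (fdev r B T)"
      using p[OF B] by simp
  qed
qed

lemma prob_measures_sequentially_compact:
  fixes \<nu> :: "nat \<Rightarrow> (word \<Rightarrow> 'a::finite) measure"
  assumes \<nu>: "\<And>k. \<nu> k \<in> prob_measures r"
  obtains \<phi> \<mu> where "strict_mono \<phi>" "\<mu> \<in> prob_measures r"
    "\<And>B T. finite B \<Longrightarrow> B \<subseteq> FG r \<Longrightarrow>
      (\<lambda>k. measure (\<nu> (\<phi> k)) (fdev r B T)) \<longlonglongrightarrow> measure \<mu> (fdev r B T)"
proof -
  \<comment> \<open>Cylinders are coded by lists of (word, letter) pairs because these form a
    countable type, so a single diagonal extraction makes all cylinder probabilities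
    converge.\<close>
  define f where "f k l = measure (\<nu> k) {x \<in> space (CS r). \<forall>(\<gamma>, a)\<in>set l. x \<gamma> = a}"
    for k and l :: "(word \<times> 'a) list"
  have "norm (f k l) \<le> 1" for k l
    using \<nu>[of k] by (auto simp: f_def prob_measures_def intro!: prob_space.prob_le_1)
  then obtain \<phi> where \<phi>: "strict_mono \<phi>" "\<And>l. \<exists>L. (\<lambda>k. f (\<phi> k) l) \<longlonglongrightarrow> L"
    using function_convergent_subsequence[of UNIV f 1] by (metis UNIV_I uncountable_def countableI_type)
  have conv: "convergent (\<lambda>k. measure (\<nu> (\<phi> k)) (fdev r B T))" if B: "finite B" "B \<subseteq> FG r" for B T
  proof -
    have "convergent (\<lambda>k. measure (\<nu> (\<phi> k)) (fdev r B {\<xi>}))" if \<xi>: "\<xi> \<in> PiE B (\<lambda>_. UNIV)" for \<xi>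
    proof -
      obtain bs where bs: "set bs = B" using B finite_list by blast
      have "measure (\<nu> (\<phi> k)) (fdev r B {\<xi>}) = f (\<phi> k) (map (\<lambda>\<gamma>. (\<gamma>, \<xi> \<gamma>)) bs)" for k
        unfolding f_def fdev_def using \<xi> bs
        by (auto intro!: arg_cong[where f = "measure (\<nu> (\<phi> k))"] simp: PiE_iff extensional_def restrict_def fun_eq_iff)
      with \<phi>(2) show ?thesis by (simp add: convergent_def)
    qed
    then show ?thesis
      unfolding measure_fdev_eq_sum[OF \<nu> B, where T = T] by (intro convergent_sum) auto
  qed
  show ?thesis
  proof (rule exists_measure_of_fdev_limits[of "\<lambda>k. \<nu> (\<phi> k)", OF \<nu> conv])
    fix \<mu> assume "\<mu> \<in> prob_measures r"
      "\<And>B T. finite B \<Longrightarrow> B \<subseteq> FG r \<Longrightarrow>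
        (\<lambda>k. measure (\<nu> (\<phi> k)) (fdev r B T)) \<longlonglongrightarrow> measure \<mu> (fdev r B T)"
    then show thesis by (rule that[OF \<phi>(1)])
  qed
qed

section \<open>Weak neighbourhoods\<close>

text \<open>The truncation \<open>restrict x B\<close> is again a configuration, with the letter
  \<open>undefined\<close> off \<open>B\<close>. It is the canonical representative of the pattern
  of \<open>x\<close> on \<open>B\<close>, at which continuous functions can be evaluated.\<close>

lemma restrict_in_space_CS: "B \<subseteq> FG r \<Longrightarrow> x \<in> space (CS r) \<Longrightarrow> restrict x B \<in> space (CS r)"
  by (auto simp: space_CS PiE_iff extensional_def restrict_def)

text \<open>Uniform continuity on a compact space: around each point \<open>g\<close> is nearly
  constant on a cylinder, finitely many of these cylinders cover, and the largest of their radii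
  works everywhere.\<close>

lemma cont_fun_uniform:
  fixes g :: "(word \<Rightarrow> 'a::finite) \<Rightarrow> real"
  assumes "cont_fun r g" "e > 0"
  obtains k where "\<And>x y. x \<in> space (CS r) \<Longrightarrow> y \<in> space (CS r) \<Longrightarrow>
    restrict x (ball r k) = restrict y (ball r k) \<Longrightarrow> \<bar>g x - g y\<bar> < e"
proof -
  let ?T = "product_topology (\<lambda>_ :: word. discrete_topology (UNIV :: 'a set)) (FG r)"
  let ?S = "space (CS r) :: (word \<Rightarrow> 'a) set"
  have compact: "compact_space ?T"
    by (simp add: compact_space_product_topology compact_space_discrete_topology)
  have top: "topspace ?T = ?S" by (simp add: space_CS)
  have cont: "continuous_map ?T euclideanreal g" using assms by (simp add: cont_fun_def)
  have ex: "\<exists>k. \<forall>y\<in>?S. restrict y (ball r k) = restrict x (ball r k) \<longrightarrow> \<bar>g y - g x\<bar> < e / 2"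
    if x: "x \<in> ?S" for x
  proof -
    have "openin ?T {y \<in> topspace ?T. g y \<in> {g x - e/2 <..< g x + e/2}}"
      using cont by (rule openin_continuous_map_preimage) auto
    moreover have "x \<in> {y \<in> topspace ?T. g y \<in> {g x - e/2 <..< g x + e/2}}"
      using x assms(2) top by auto
    ultimately obtain U where U: "finite {i \<in> FG r. U i \<noteq> topspace (discrete_topology UNIV)}"
      "x \<in> Pi\<^sub>E (FG r) U" "Pi\<^sub>E (FG r) U \<subseteq> {y \<in> topspace ?T. g y \<in> {g x - e/2 <..< g x + e/2}}"
      unfolding openin_product_topology_alt by blast
    obtain k where k: "{i \<in> FG r. U i \<noteq> UNIV} \<subseteq> ball r k"
      using finite_subset_ball[of "{i \<in> FG r. U i \<noteq> UNIV}" r] U(1) by auto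
    have "\<bar>g y - g x\<bar> < e / 2" if y: "y \<in> ?S" "restrict y (ball r k) = restrict x (ball r k)" for y
    proof -
      have "y i = x i" if "i \<in> ball r k" for i
        using y(2) that by (metis restrict_apply')
      then have "y \<in> Pi\<^sub>E (FG r) U"
        using y(1) U(2) k by (auto simp: space_CS PiE_iff)
      then have "g y \<in> {g x - e/2 <..< g x + e/2}" using U(3) by blast
      then show ?thesis unfolding greaterThanLessThan_iff by linarith
    qed
    then show ?thesis by blast
  qed
  then obtain K where K: "\<And>x y. x \<in> ?S \<Longrightarrow> y \<in> ?S \<Longrightarrow>
      restrict y (ball r (K x)) = restrict x (ball r (K x)) \<Longrightarrow> \<bar>g y - g x\<bar> < e / 2"
    by metis
  let ?O = "\<lambda>x. fdev r (ball r (K x)) {restrict x (ball r (K x))}"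
  have "(\<forall>U\<in>?O ` ?S. openin ?T U)"
    by (auto intro!: openin_fdev finite_ball ball_subset_FG)
  moreover have "\<Union>(?O ` ?S) = topspace ?T"
    unfolding top by (auto simp: fdev_def)
  ultimately have "\<exists>F. finite F \<and> F \<subseteq> ?O ` ?S \<and> \<Union>F = topspace ?T"
    using compact[unfolded compact_space, rule_format, of "?O ` ?S"] by simp
  then obtain F where F: "finite F" "F \<subseteq> ?O ` ?S" "\<Union>F = topspace ?T" by (elim exE conjE)
  from finite_subset_image[OF F(1,2)] obtain X where X: "finite X" "X \<subseteq> ?S" "F = ?O ` X"
    by (elim exE conjE bexE)
  define k where "k = Max (insert 0 (K ` X))"
  have kX: "K x \<le> k" if "x \<in> X" for x using X(1) that by (simp add: k_def)
  show ?thesis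
  proof
    fix x y assume xy: "x \<in> ?S" "y \<in> ?S" "restrict x (ball r k) = restrict y (ball r k)"
    have "x \<in> \<Union>(?O ` X)" using F(3) X(3) xy(1) top by simp
    then obtain z where z: "z \<in> X" "x \<in> ?O z" by (elim UN_E)
    have "restrict x (ball r (K z)) = restrict y (ball r (K z))"
    proof
      fix i show "restrict x (ball r (K z)) i = restrict y (ball r (K z)) i"
        using fun_cong[OF xy(3), of i] ball_mono[OF kX[OF z(1)], of r] by (auto simp: restrict_def split: if_splits)
    qed
    moreover have "restrict x (ball r (K z)) = restrict z (ball r (K z))" "z \<in> ?S"
      using z X(2) by (auto simp: fdev_def)
    ultimately have "\<bar>g x - g z\<bar> < e/2" "\<bar>g y - g z\<bar> < e/2"
      using K[of z x] K[of z y] xy(1,2) by simp_all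
    then show "\<bar>g x - g y\<bar> < e" by linarith
  qed
qed

lemma measurable_of_restrict:
  fixes g :: "(word \<Rightarrow> 'a::finite) \<Rightarrow> real"
  assumes "finite B" "B \<subseteq> FG r"
  shows "(\<lambda>x. g (restrict x B)) \<in> borel_measurable (CS r)"
proof (rule measurable_compose[of "\<lambda>x. restrict x B" _ "PiM B (\<lambda>_. count_space UNIV)" g])
  show "(\<lambda>x. restrict x B) \<in> measurable (CS r) (PiM B (\<lambda>_. count_space UNIV))"
    unfolding CS_def using assms by (intro measurable_restrict_subset)
  show "g \<in> borel_measurable (PiM B (\<lambda>_. count_space UNIV))"
    using assms by (subst count_space_PiM_finite) (auto simp: uncountable_infinite)
qed

text \<open>A continuous function is the pointwise limit of its values at truncated configurations,
  and each of those depends on finitely many coordinates.\<close>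

lemma cont_fun_measurable:
  fixes g :: "(word \<Rightarrow> 'a::finite) \<Rightarrow> real"
  assumes "cont_fun r g"
  shows "g \<in> borel_measurable (CS r)"
proof (rule borel_measurable_LIMSEQ_metric)
  show "(\<lambda>x. g (restrict x (ball r i))) \<in> borel_measurable (CS r)" for i
    by (intro measurable_of_restrict finite_ball ball_subset_FG)
  fix x :: "word \<Rightarrow> 'a" assume x: "x \<in> space (CS r)"
  show "(\<lambda>i. g (restrict x (ball r i))) \<longlonglongrightarrow> g x"
  proof (rule LIMSEQ_I)
    fix e :: real assume "e > 0"
    then obtain k where k: "\<And>x y. x \<in> space (CS r) \<Longrightarrow> y \<in> space (CS r) \<Longrightarrow>
      restrict x (ball r k) = restrict y (ball r k) \<Longrightarrow> \<bar>g x - g y\<bar> < e"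
      using cont_fun_uniform[OF assms] by blast
    have "\<bar>g (restrict x (ball r i)) - g x\<bar> < e" if "i \<ge> k" for i
      using x ball_mono[OF that, of r]
      by (intro k) (auto simp: restrict_in_space_CS ball_subset_FG Int_absorb1)
    then show "\<exists>no. \<forall>n\<ge>no. norm (g (restrict x (ball r n)) - g x) < e" by auto
  qed
qed

lemma integral_of_restrict:
  fixes g :: "(word \<Rightarrow> 'a::finite) \<Rightarrow> real"
  assumes "\<nu> \<in> prob_measures r" "finite B" "B \<subseteq> FG r"
  shows "integrable \<nu> (\<lambda>x. g (restrict x B))"
    and "integral\<^sup>L \<nu> (\<lambda>x. g (restrict x B)) = (\<Sum>\<xi>\<in>PiE B (\<lambda>_. UNIV). g \<xi> * measure \<nu> (fdev r B {\<xi>}))"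
proof -
  interpret prob_space \<nu> using assms by (simp add: prob_measures_def)
  have s: "sets \<nu> = sets (CS r)" using assms by (simp add: prob_measures_def)
  then have sp: "space \<nu> = space (CS r)" by (rule sets_eq_imp_space_eq)
  let ?h = "\<lambda>x. \<Sum>\<xi>\<in>PiE B (\<lambda>_. UNIV). g \<xi> * indicator (fdev r B {\<xi>}) x"
  have eq: "g (restrict x B) = ?h x" if "x \<in> space \<nu>" for x
  proof -
    have "?h x = (\<Sum>\<xi>\<in>PiE B (\<lambda>_. UNIV). if \<xi> = restrict x B then g \<xi> else 0)"
      using that by (intro sum.cong) (auto simp: fdev_def sp)
    also have "\<dots> = g (restrict x B)"
      using assms(2) by (subst sum.delta) (auto intro: finite_PiE)
    finally show ?thesis by simp
  qed
  have int: "integrable \<nu> (\<lambda>x. g \<xi> * indicator (fdev r B {\<xi>}) x)" for \<xi>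
    using assms by (intro integrable_mult_right integrable_real_indicator)
      (auto simp: s fdev_sets emeasure_eq_measure)
  have "integrable \<nu> ?h" by (intro Bochner_Integration.integrable_sum int)
  then show "integrable \<nu> (\<lambda>x. g (restrict x B))"
    by (rule Bochner_Integration.integrable_cong[THEN iffD2, OF refl, rotated]) (rule eq)
  have "integral\<^sup>L \<nu> (\<lambda>x. g (restrict x B)) = integral\<^sup>L \<nu> ?h"
    by (rule Bochner_Integration.integral_cong[OF refl eq])
  also have "\<dots> = (\<Sum>\<xi>\<in>PiE B (\<lambda>_. UNIV). integral\<^sup>L \<nu> (\<lambda>x. g \<xi> * indicator (fdev r B {\<xi>}) x))"
    by (intro Bochner_Integration.integral_sum int)
  also have "\<dots> = (\<Sum>\<xi>\<in>PiE B (\<lambda>_. UNIV). g \<xi> * measure \<nu> (fdev r B {\<xi>}))"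
    by (intro sum.cong refl) (auto simp: fdev_def sp intro!: arg_cong[where f = "measure \<nu>"])
  finally show "integral\<^sup>L \<nu> (\<lambda>x. g (restrict x B)) = (\<Sum>\<xi>\<in>PiE B (\<lambda>_. UNIV). g \<xi> * measure \<nu> (fdev r B {\<xi>}))" .
qed

text \<open>Quantifying over all \<open>T\<close> makes this a total variation distance between the
  laws on the \<open>k\<close>-ball. Together with the next lemmas, these sets form a neighbourhood
  base of the weak topology.\<close>

definition fdev_close :: "nat \<Rightarrow> nat \<Rightarrow> real \<Rightarrow> (word \<Rightarrow> 'a) measure \<Rightarrow> (word \<Rightarrow> 'a) measure \<Rightarrow> bool" where
  "fdev_close r k \<delta> \<nu> \<nu>' \<longleftrightarrow>
     (\<forall>T. \<bar>measure \<nu> (fdev r (ball r k) T) - measure \<nu>' (fdev r (ball r k) T)\<bar> < \<delta>)"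

lemma fdev_close_mono:
  assumes "fdev_close r k \<delta> \<nu> \<nu>'" "j \<le> k" "\<delta> \<le> \<delta>'"
  shows "fdev_close r j \<delta>' \<nu> \<nu>'"
  unfolding fdev_close_def fdev_mono_base[OF ball_mono[OF assms(2)]]
  using assms(1,3) unfolding fdev_close_def by (meson order_less_le_trans)

text \<open>Truncation to a ball changes each of the two integrals by at most e/4, and the truncated
  integrals are finite sums over cylinders, which closeness controls up to another e/4.\<close>

lemma integral_fdev_close:
  fixes g :: "(word \<Rightarrow> 'a::finite) \<Rightarrow> real"
  assumes g: "cont_fun r g" and "e > 0"
  obtains k \<delta> where "\<delta> > 0" "\<And>\<nu> \<nu>'. \<nu> \<in> prob_measures r \<Longrightarrow> \<nu>' \<in> prob_measures r \<Longrightarrow>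
    fdev_close r k \<delta> \<nu> \<nu>' \<Longrightarrow> \<bar>integral\<^sup>L \<nu> g - integral\<^sup>L \<nu>' g\<bar> < e"
proof -
  obtain k where k: "\<And>x y. x \<in> space (CS r) \<Longrightarrow> y \<in> space (CS r) \<Longrightarrow>
      restrict x (ball r k) = restrict y (ball r k) \<Longrightarrow> \<bar>g x - g y\<bar> < e / 4"
    using cont_fun_uniform[OF g, of "e/4"] assms(2) by auto
  let ?B = "ball r k" and ?U = "PiE (ball r k) (\<lambda>_. UNIV :: 'a set)"
  let ?g = "\<lambda>x. g (restrict x ?B)"
  \<comment> \<open>A bound for the sum of |g| over the patterns on the ball; the extra 1 keeps it
    positive for the division below.\<close>
  define C where "C = (\<Sum>\<xi>\<in>?U. \<bar>g \<xi>\<bar>) + 1"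
  have C: "C > 0" by (simp add: C_def add_nonneg_pos sum_nonneg)
  have approx: "\<bar>integral\<^sup>L \<nu> g - integral\<^sup>L \<nu> ?g\<bar> \<le> e / 4" if \<nu>: "\<nu> \<in> prob_measures r" for \<nu>
  proof -
    interpret prob_space \<nu> using \<nu> by (simp add: prob_measures_def)
    have s: "sets \<nu> = sets (CS r)" using \<nu> by (simp add: prob_measures_def)
    then have sp: "space \<nu> = space (CS r)" by (rule sets_eq_imp_space_eq)
    have m: "g \<in> borel_measurable \<nu>" using cont_fun_measurable[OF g] by (simp add: s cong: measurable_cong_sets)
    have i1: "integrable \<nu> ?g" by (rule integral_of_restrict(1)[OF \<nu> finite_ball ball_subset_FG])
    have d: "\<bar>g x - ?g x\<bar> \<le> e / 4" if "x \<in> space \<nu>" for x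
      using that sp by (intro less_imp_le k) (auto simp: restrict_in_space_CS ball_subset_FG)
    have i2: "integrable \<nu> (\<lambda>x. g x - ?g x)"
      using m i1 d by (intro integrable_const_bound[where B = "e/4"]) (auto intro!: AE_I2)
    have i3: "integrable \<nu> g" using Bochner_Integration.integrable_add[OF i2 i1] by simp
    have "\<bar>integral\<^sup>L \<nu> g - integral\<^sup>L \<nu> ?g\<bar> = \<bar>integral\<^sup>L \<nu> (\<lambda>x. g x - ?g x)\<bar>"
      using i3 i1 by simp
    also have "\<dots> \<le> integral\<^sup>L \<nu> (\<lambda>x. \<bar>g x - ?g x\<bar>)" by (rule integral_abs_bound)
    also have "\<dots> \<le> integral\<^sup>L \<nu> (\<lambda>x. e / 4)"
      using i2 d by (intro integral_mono) auto
    also have "\<dots> = e / 4" using prob_space by simp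
    finally show ?thesis .
  qed
  show ?thesis
  proof (rule that[of "e / (4 * C)" k])
    show "e / (4 * C) > 0" using C assms(2) by simp
    fix \<nu> \<nu>' :: "(word \<Rightarrow> 'a) measure"
    assume \<nu>: "\<nu> \<in> prob_measures r" and \<nu>': "\<nu>' \<in> prob_measures r"
      and close: "fdev_close r k (e / (4 * C)) \<nu> \<nu>'"
    have "\<bar>integral\<^sup>L \<nu> ?g - integral\<^sup>L \<nu>' ?g\<bar>
        = \<bar>\<Sum>\<xi>\<in>?U. g \<xi> * (measure \<nu> (fdev r ?B {\<xi>}) - measure \<nu>' (fdev r ?B {\<xi>}))\<bar>"
      by (simp add: integral_of_restrict[OF \<nu> finite_ball ball_subset_FG]
          integral_of_restrict[OF \<nu>' finite_ball ball_subset_FG] sum_subtractf right_diff_distrib)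
    also have "\<dots> \<le> (\<Sum>\<xi>\<in>?U. \<bar>g \<xi> * (measure \<nu> (fdev r ?B {\<xi>}) - measure \<nu>' (fdev r ?B {\<xi>}))\<bar>)"
      by (rule sum_abs)
    also have "\<dots> \<le> (\<Sum>\<xi>\<in>?U. \<bar>g \<xi>\<bar> * (e / (4 * C)))"
      unfolding abs_mult using close
      by (intro sum_mono mult_left_mono) (simp_all add: fdev_close_def less_imp_le)
    also have "\<dots> = (C - 1) * (e / (4 * C))" by (subst sum_distrib_right[symmetric]) (simp add: C_def)
    also have "\<dots> \<le> e / 4" using C assms(2) by (simp add: field_simps)
    finally show "\<bar>integral\<^sup>L \<nu> g - integral\<^sup>L \<nu>' g\<bar> < e"
      using approx[OF \<nu>] approx[OF \<nu>'] assms(2) by linarith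
  qed
qed

text \<open>Lower bounds on \<open>f_inv\<close> concern arbitrary open sets, and this reduces them
  to closeness on one ball.\<close>

lemma weak_open_fdev_close:
  fixes U :: "(word \<Rightarrow> 'a::finite) measure set"
  assumes "weak_open r U" "\<mu> \<in> U"
  obtains k \<delta> where "\<delta> > 0" "\<And>\<nu>. \<nu> \<in> prob_measures r \<Longrightarrow> fdev_close r k \<delta> \<nu> \<mu> \<Longrightarrow> \<nu> \<in> U"
proof -
  have \<mu>: "\<mu> \<in> prob_measures r" using assms by (auto simp: weak_open_def)
  from assms have "\<exists>G e. finite G \<and> (\<forall>g\<in>G. cont_fun r g) \<and> e > 0 \<and>
      {\<nu>\<in>prob_measures r. \<forall>g\<in>G. \<bar>integral\<^sup>L \<nu> g - integral\<^sup>L \<mu> g\<bar> < e} \<subseteq> U"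
    by (simp add: weak_open_def)
  then obtain G e where G': "finite G \<and> (\<forall>g\<in>G. cont_fun r g) \<and> e > 0 \<and>
      {\<nu>\<in>prob_measures r. \<forall>g\<in>G. \<bar>integral\<^sup>L \<nu> g - integral\<^sup>L \<mu> g\<bar> < e} \<subseteq> U"
    by (elim exE)
  then have G: "finite G" "\<And>g. g \<in> G \<Longrightarrow> cont_fun r g" "e > 0"
    "\<And>\<nu>. \<nu> \<in> prob_measures r \<Longrightarrow> \<forall>g\<in>G. \<bar>integral\<^sup>L \<nu> g - integral\<^sup>L \<mu> g\<bar> < e \<Longrightarrow> \<nu> \<in> U"
    by auto
  have "\<exists>k \<delta>. \<delta> > 0 \<and> (\<forall>\<nu>\<in>prob_measures r. fdev_close r k \<delta> \<nu> \<mu> \<longrightarrow> \<bar>integral\<^sup>L \<nu> g - integral\<^sup>L \<mu> g\<bar> < e)"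
    if "g \<in> G" for g
    using integral_fdev_close[OF G(2)[OF that] G(3)] \<mu> by metis
  then obtain K D where KD: "\<And>g. g \<in> G \<Longrightarrow> D g > 0"
    "\<And>g \<nu>. g \<in> G \<Longrightarrow> \<nu> \<in> prob_measures r \<Longrightarrow> fdev_close r (K g) (D g) \<nu> \<mu> \<Longrightarrow>
      \<bar>integral\<^sup>L \<nu> g - integral\<^sup>L \<mu> g\<bar> < e"
    by metis
  show ?thesis
  proof (rule that[of "Min (insert 1 (D ` G))" "Max (insert 0 (K ` G))"])
    show "Min (insert 1 (D ` G)) > 0" using G(1) KD(1) by auto
    fix \<nu> assume \<nu>: "\<nu> \<in> prob_measures r"
      and c: "fdev_close r (Max (insert 0 (K ` G))) (Min (insert 1 (D ` G))) \<nu> \<mu>"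
    have "\<bar>integral\<^sup>L \<nu> g - integral\<^sup>L \<mu> g\<bar> < e" if "g \<in> G" for g
    proof (rule KD(2)[OF that \<nu>], rule fdev_close_mono[OF c])
      show "K g \<le> Max (insert 0 (K ` G))" using G(1) that by simp
      show "Min (insert 1 (D ` G)) \<le> D g" using G(1) that by simp
    qed
    then show "\<nu> \<in> U" using G(4)[OF \<nu>] by blast
  qed
qed

lemma cont_fun_indicator_fdev:
  fixes T :: "(word \<Rightarrow> 'a) set"
  assumes "finite B" "B \<subseteq> FG r"
  shows "cont_fun r (indicator (fdev r B T))"
  unfolding cont_fun_def continuous_map_def
proof (intro conjI allI impI)
  let ?T = "product_topology (\<lambda>_ :: word. discrete_topology (UNIV :: 'a set)) (FG r)"
  show "indicator (fdev r B T) \<in> topspace ?T \<rightarrow> topspace euclideanreal" by simp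
  fix V :: "real set"
  have "{x \<in> topspace ?T. indicator (fdev r B T) x \<in> V} = fdev r B {y. indicator T y \<in> V}"
    by (auto simp: fdev_def space_CS indicator_def)
  then show "openin ?T {x \<in> topspace ?T. indicator (fdev r B T) x \<in> V}"
    using openin_fdev[OF assms] by simp
qed

text \<open>The converse direction: events on finite windows have continuous indicators, so
  conditions on their probabilities are open. It supplies the explicit neighbourhood for the upper
  bound.\<close>

lemma weak_open_fdev_family:
  fixes T :: "'i \<Rightarrow> (word \<Rightarrow> 'a::finite) set"
  assumes "finite I" "\<And>i. i \<in> I \<Longrightarrow> finite (B i)" "\<And>i. i \<in> I \<Longrightarrow> B i \<subseteq> FG r"
  shows "weak_open r {\<nu> \<in> prob_measures r. \<forall>i\<in>I. \<bar>measure \<nu> (fdev r (B i) (T i)) - c i\<bar> < \<delta>}"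
  unfolding weak_open_def
proof (intro conjI ballI)
  fix \<nu> assume "\<nu> \<in> {\<nu> \<in> prob_measures r. \<forall>i\<in>I. \<bar>measure \<nu> (fdev r (B i) (T i)) - c i\<bar> < \<delta>}"
  then have \<nu>: "\<nu> \<in> prob_measures r" "\<And>i. i \<in> I \<Longrightarrow> \<bar>measure \<nu> (fdev r (B i) (T i)) - c i\<bar> < \<delta>" by auto
  let ?g = "\<lambda>i. indicator (fdev r (B i) (T i)) :: (word \<Rightarrow> 'a) \<Rightarrow> real"
  \<comment> \<open>The smallest margin left at \<open>\<nu>\<close>; the inserted 1 covers the
    empty family.\<close>
  define e where "e = Min (insert 1 ((\<lambda>i. \<delta> - \<bar>measure \<nu> (fdev r (B i) (T i)) - c i\<bar>) ` I))"
  have int: "integral\<^sup>L \<nu>' (?g i) = measure \<nu>' (fdev r (B i) (T i))" if "\<nu>' \<in> prob_measures r" for \<nu>' i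
  proof -
    have "space \<nu>' = space (CS r)" using that by (auto simp: prob_measures_def dest: sets_eq_imp_space_eq)
    then have "fdev r (B i) (T i) \<inter> space \<nu>' = fdev r (B i) (T i)" by (auto simp: fdev_def)
    then show ?thesis by simp
  qed
  have e: "e > 0" using assms(1) \<nu>(2) by (auto simp: e_def)
  have e': "e \<le> \<delta> - \<bar>measure \<nu> (fdev r (B i) (T i)) - c i\<bar>" if "i \<in> I" for i
    using assms(1) that by (simp add: e_def)
  show "\<exists>G \<delta>'. finite G \<and> (\<forall>g\<in>G. cont_fun r g) \<and> \<delta>' > 0 \<and>
      {\<nu>' \<in> prob_measures r. \<forall>g\<in>G. \<bar>integral\<^sup>L \<nu>' g - integral\<^sup>L \<nu> g\<bar> < \<delta>'}
      \<subseteq> {\<nu> \<in> prob_measures r. \<forall>i\<in>I. \<bar>measure \<nu> (fdev r (B i) (T i)) - c i\<bar> < \<delta>}"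
  proof (intro exI[of _ "?g ` I"] exI[of _ e] conjI)
    show "finite (?g ` I)" using assms(1) by simp
    show "\<forall>g\<in>?g ` I. cont_fun r g" using assms(2,3) by (auto intro!: cont_fun_indicator_fdev)
    show "e > 0" by (rule e)
    show "{\<nu>' \<in> prob_measures r. \<forall>g\<in>?g ` I. \<bar>integral\<^sup>L \<nu>' g - integral\<^sup>L \<nu> g\<bar> < e}
      \<subseteq> {\<nu> \<in> prob_measures r. \<forall>i\<in>I. \<bar>measure \<nu> (fdev r (B i) (T i)) - c i\<bar> < \<delta>}"
    proof (intro subsetI CollectI conjI ballI)
      fix \<nu>' assume \<nu>': "\<nu>' \<in> {\<nu>' \<in> prob_measures r. \<forall>g\<in>?g ` I. \<bar>integral\<^sup>L \<nu>' g - integral\<^sup>L \<nu> g\<bar> < e}"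
      then show "\<nu>' \<in> prob_measures r" by simp
      fix i assume i: "i \<in> I"
      have "\<bar>integral\<^sup>L \<nu>' (?g i) - integral\<^sup>L \<nu> (?g i)\<bar> < e" using \<nu>' i by blast
      then have "\<bar>measure \<nu>' (fdev r (B i) (T i)) - measure \<nu> (fdev r (B i) (T i))\<bar> < e"
        using \<nu>' \<nu>(1) by (simp only: int mem_Collect_eq)
      then show "\<bar>measure \<nu>' (fdev r (B i) (T i)) - c i\<bar> < \<delta>" using e'[OF i] by linarith
    qed
  qed
qed auto

section \<open>Empirical measures and the Ising chain\<close>

lemma cons_red_reduced: "reduced w \<Longrightarrow> reduced (cons_red g w)"
proof (cases w)
  case (Cons h t)
  assume "reduced w"
  with Cons show ?thesis by (cases t) (auto simp: ginv_def)
qed simp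

lemma set_cons_red: "set (cons_red g w) \<subseteq> insert g (set w)"
  by (cases w) auto

lemma gmult_in_FG:
  assumes "\<gamma> \<in> FG r" "\<beta> \<in> FG r"
  shows "gmult \<gamma> \<beta> \<in> FG r"
proof -
  have "\<forall>g\<in>set xs. fst g < r \<Longrightarrow> reduced (gmult xs \<beta>) \<and> (\<forall>g\<in>set (gmult xs \<beta>). fst g < r)" for xs
  proof (induction xs)
    case Nil then show ?case using assms(2) by (simp add: gmult_def FG_def)
  next
    case (Cons g xs)
    then show ?case using set_cons_red[of g "gmult xs \<beta>"] cons_red_reduced[of "gmult xs \<beta>" g]
      by (auto simp: gmult_def)
  qed
  then show ?thesis using assms(1) by (auto simp: FG_def)
qed

lemma perm_tuples_permutes: "s \<in> perm_tuples r n \<Longrightarrow> i < r \<Longrightarrow> s i permutes {..<n}"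
  by (auto simp: perm_tuples_def)

lemma act_in:
  assumes s: "s \<in> perm_tuples r n" and w: "\<forall>g\<in>set w. fst g < r" and v: "v < n"
  shows "act s w v < n"
  using w
proof (induction w)
  case (Cons g w)
  then have p: "s (fst g) permutes {..<n}" and a: "act s w v < n" using perm_tuples_permutes[OF s] by auto
  show ?case using permutes_in_image[OF p] permutes_in_image[OF permutes_inv[OF p]] a by auto
qed (simp add: v)

lemma act_cons_red:
  assumes s: "s \<in> perm_tuples r n" and g: "fst g < r"
  shows "act s (cons_red g w) v = act s (g # w) v"
proof (cases w)
  case (Cons h t)
  have p: "s (fst g) permutes {..<n}" using perm_tuples_permutes[OF s g] .
  show ?thesis
    using Cons permutes_inverses[OF p] by (auto simp: ginv_def)
qed simp

text \<open>Free reduction is invisible to the action, because a cancelled pair of letters acts by a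
  permutation and its inverse. Thus \<open>act\<close> is a left action of the free group.\<close>

lemma act_gmult:
  assumes s: "s \<in> perm_tuples r n" and "\<forall>g\<in>set \<gamma>. fst g < r"
  shows "act s (gmult \<gamma> \<beta>) v = act s \<gamma> (act s \<beta> v)"
  using assms(2)
proof (induction \<gamma>)
  case (Cons g \<gamma>)
  have "act s (gmult (g # \<gamma>) \<beta>) v = act s (cons_red g (gmult \<gamma> \<beta>)) v" by (simp add: gmult_def)
  also have "\<dots> = act s (g # gmult \<gamma> \<beta>) v" using Cons by (intro act_cons_red[OF s]) auto
  finally show ?case using Cons by simp
qed (simp add: gmult_def)

lemma act_bij:
  assumes s: "s \<in> perm_tuples r n" and w: "\<forall>g\<in>set w. fst g < r"
  shows "bij_betw (act s w) {..<n} {..<n}"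
  using w
proof (induction w)
  case Nil
  show ?case by (auto simp: bij_betw_def inj_on_def)
next
  case (Cons g w)
  have p: "s (fst g) permutes {..<n}" using Cons perm_tuples_permutes[OF s] by auto
  have eq: "act s (g # w) = (if snd g then s (fst g) else inv (s (fst g))) \<circ> act s w" by auto
  have "bij_betw (if snd g then s (fst g) else inv (s (fst g))) {..<n} {..<n}"
    using permutes_imp_bij[OF p] permutes_imp_bij[OF permutes_inv[OF p]] by simp
  moreover have "bij_betw (act s w) {..<n} {..<n}" using Cons by simp
  ultimately show ?case unfolding eq by (rule bij_betw_trans[rotated])
qed

section \<open>Empirical measures and their limits\<close>

lemma proj_in_space: "proj r s v x \<in> space (CS r)"
  by (simp add: proj_def space_CS)

lemma emp_prob_measures: "n > 0 \<Longrightarrow> emp r n s x \<in> prob_measures r"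
proof -
  assume "n > 0"
  then interpret prob_space "uniform_measure (count_space {..<n}) {..<n}"
    by (intro prob_space_uniform_measure) (auto simp: emeasure_count_space)
  show ?thesis
    unfolding prob_measures_def emp_def
    by (auto intro!: prob_space_distr measurableI simp: proj_in_space)
qed

lemma measure_emp:
  fixes T :: "(word \<Rightarrow> 'a::finite) set"
  assumes "n > 0" "finite B" "B \<subseteq> FG r"
  shows "measure (emp r n s x) (fdev r B T) = card {v. v < n \<and> restrict (\<lambda>\<gamma>. x (act s \<gamma> v)) B \<in> T} / n"
proof -
  have eq: "(\<lambda>v. proj r s v x) -` fdev r B T \<inter> {..<n} = {v. v < n \<and> restrict (\<lambda>\<gamma>. x (act s \<gamma> v)) B \<in> T}"
    using assms(3) by (auto simp: fdev_def proj_in_space) (auto simp: proj_def Int_absorb1)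
  have "measure (emp r n s x) (fdev r B T)
      = measure (uniform_measure (count_space {..<n}) {..<n}) ((\<lambda>v. proj r s v x) -` fdev r B T \<inter> {..<n})"
    unfolding emp_def using fdev_sets[OF assms(2,3), of T]
    by (subst measure_distr) (auto intro!: measurableI simp: proj_in_space)
  also have "\<dots> = card {v. v < n \<and> restrict (\<lambda>\<gamma>. x (act s \<gamma> v)) B \<in> T} / n"
    unfolding eq using assms(1)
    by (subst measure_uniform_measure) (auto simp: emeasure_count_space measure_count_space intro!: arg_cong[where f = card])
  finally show ?thesis .
qed

text \<open>One form for three maps: the shift (\<tau> a right multiplication, \<open>h\<close> the
  identity) and the two marginals (\<tau> the identity, \<open>h\<close> a projection of
  letters).\<close>

lemma measurable_coordinatewise:
  assumes "\<And>\<gamma>. \<gamma> \<in> FG r \<Longrightarrow> \<tau> \<gamma> \<in> FG r"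
  shows "(\<lambda>x. restrict (\<lambda>\<gamma>. h (x (\<tau> \<gamma>))) (FG r)) \<in> measurable (CS r) (CS r)"
  unfolding CS_def
proof (rule measurable_restrict)
  fix \<gamma> assume "\<gamma> \<in> FG r"
  then have "(\<lambda>x. x (\<tau> \<gamma>)) \<in> measurable (PiM (FG r) (\<lambda>_. count_space UNIV)) (count_space UNIV)"
    using assms by (intro measurable_component_singleton)
  then show "(\<lambda>x. h (x (\<tau> \<gamma>))) \<in> measurable (PiM (FG r) (\<lambda>_. count_space UNIV)) (count_space UNIV)"
    by (rule measurable_compose) simp
qed

lemma measure_distr_coordinatewise:
  fixes \<nu> :: "(word \<Rightarrow> 'a::finite) measure" and T :: "(word \<Rightarrow> 'b::finite) set"
  assumes \<nu>: "\<nu> \<in> prob_measures r" and \<tau>: "\<And>\<gamma>. \<gamma> \<in> FG r \<Longrightarrow> \<tau> \<gamma> \<in> FG r"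
    and B: "finite B" "B \<subseteq> FG r"
  shows "measure (distr \<nu> (CS r) (\<lambda>x. restrict (\<lambda>\<gamma>. h (x (\<tau> \<gamma>))) (FG r))) (fdev r B T)
    = measure \<nu> (fdev r (\<tau> ` B) {y. restrict (\<lambda>\<gamma>. h (y (\<tau> \<gamma>))) B \<in> T})"
proof -
  have s: "sets \<nu> = sets (CS r)" using \<nu> by (simp add: prob_measures_def)
  then have sp: "space \<nu> = space (CS r)" by (rule sets_eq_imp_space_eq)
  have m: "(\<lambda>x. restrict (\<lambda>\<gamma>. h (x (\<tau> \<gamma>))) (FG r)) \<in> measurable \<nu> (CS r)"
    using measurable_coordinatewise[where r = r and h = h and \<tau> = \<tau>, OF \<tau>] by (simp add: measurable_cong_sets[OF s refl])
  have eq: "restrict (\<lambda>\<gamma>. h (restrict x (\<tau> ` B) (\<tau> \<gamma>))) B = restrict (\<lambda>\<gamma>. h (x (\<tau> \<gamma>))) B" for x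
    by (auto simp: restrict_def)
  have "(\<lambda>x. restrict (\<lambda>\<gamma>. h (x (\<tau> \<gamma>))) (FG r)) -` fdev r B T \<inter> space \<nu>
      = fdev r (\<tau> ` B) {y. restrict (\<lambda>\<gamma>. h (y (\<tau> \<gamma>))) B \<in> T}"
    unfolding fdev_def sp vimage_def Int_iff mem_Collect_eq eq restrict_restrict Int_absorb1[OF B(2)]
    by (auto simp: space_CS)
  then show ?thesis
    using m fdev_sets[OF B, of T] by (subst measure_distr) auto
qed

lemma distr_prob_measures:
  assumes "\<nu> \<in> prob_measures r" "f \<in> measurable (CS r) (CS r)"
  shows "distr \<nu> (CS r) f \<in> prob_measures r"
proof -
  have s: "sets \<nu> = sets (CS r)" using assms by (simp add: prob_measures_def)
  interpret prob_space \<nu> using assms by (simp add: prob_measures_def)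
  have "f \<in> measurable \<nu> (CS r)" using assms(2) by (simp add: measurable_cong_sets[OF s refl])
  then show ?thesis by (simp add: prob_measures_def prob_space_distr)
qed

lemma shift_eq: "shift r \<beta> = (\<lambda>x. restrict (\<lambda>\<gamma>. id (x (gmult \<gamma> \<beta>))) (FG r))"
  by (simp add: shift_def fun_eq_iff)

lemma marg1_eq: "marg1 r = (\<lambda>x. restrict (\<lambda>\<gamma>. fst (x (id \<gamma>))) (FG r))"
  by (simp add: marg1_def fun_eq_iff)

lemma marg2_eq: "marg2 r = (\<lambda>x. restrict (\<lambda>\<gamma>. snd (x (id \<gamma>))) (FG r))"
  by (simp add: marg2_def fun_eq_iff)

text \<open>The permutation \<open>act s \<beta>\<close> carries the vertices that see the shifted
  pattern onto those that see the original one. Empirical measures are therefore exactly, not only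
  asymptotically, shift-invariant.\<close>

lemma emp_shift_fdev:
  fixes x :: "nat \<Rightarrow> 'a::finite"
  assumes s: "s \<in> perm_tuples r n" and n: "n > 0" and \<beta>: "\<beta> \<in> FG r" and B: "finite B" "B \<subseteq> FG r"
  shows "measure (emp r n s x) (fdev r ((\<lambda>\<gamma>. gmult \<gamma> \<beta>) ` B) {y. restrict (\<lambda>\<gamma>. id (y (gmult \<gamma> \<beta>))) B \<in> T})
    = measure (emp r n s x) (fdev r B T)"
proof -
  have FG': "\<forall>g\<in>set w. fst g < r" if "w \<in> FG r" for w using that by (simp add: FG_def)
  have BF: "(\<lambda>\<gamma>. gmult \<gamma> \<beta>) ` B \<subseteq> FG r" using B \<beta> by (auto intro: gmult_in_FG)
  have bij: "bij_betw (act s \<beta>) {..<n} {..<n}" by (rule act_bij[OF s FG'[OF \<beta>]])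
  let ?R = "{v. v < n \<and> restrict (\<lambda>\<gamma>. x (act s \<gamma> v)) B \<in> T}"
  let ?L = "{v. v < n \<and> restrict (\<lambda>\<gamma>. x (act s \<gamma> v)) ((\<lambda>\<gamma>. gmult \<gamma> \<beta>) ` B)
      \<in> {y. restrict (\<lambda>\<gamma>. id (y (gmult \<gamma> \<beta>))) B \<in> T}}"
  have L: "?L = {v. v < n \<and> act s \<beta> v \<in> ?R}"
  proof -
    have "restrict (\<lambda>\<gamma>. id (restrict (\<lambda>\<gamma>. x (act s \<gamma> v)) ((\<lambda>\<gamma>. gmult \<gamma> \<beta>) ` B) (gmult \<gamma> \<beta>))) B
        = restrict (\<lambda>\<gamma>. x (act s \<gamma> (act s \<beta> v))) B" for v
      using B FG' by (auto simp: restrict_def fun_eq_iff act_gmult[OF s] subset_eq)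
    then show ?thesis using bij by (auto simp: bij_betw_def)
  qed
  have "bij_betw (act s \<beta>) ?L ?R"
    unfolding L using bij by (auto simp: bij_betw_def inj_on_def)
  then have "card ?L = card ?R" by (rule bij_betw_same_card)
  then show ?thesis
    using measure_emp[OF n finite_imageI[OF B(1)] BF, of s x] measure_emp[OF n B, of s x T] by simp
qed

lemma shift_invariant_emp_limit:
  fixes \<mu> :: "(word \<Rightarrow> 'a::finite) measure"
  assumes \<mu>: "\<mu> \<in> prob_measures r"
    and s: "\<And>k. s k \<in> perm_tuples r (n k)" "\<And>k. n k > 0"
    and lim: "\<And>B T. finite B \<Longrightarrow> B \<subseteq> FG r \<Longrightarrow>
      (\<lambda>k. measure (emp r (n k) (s k) (x k)) (fdev r B T)) \<longlonglongrightarrow> measure \<mu> (fdev r B T)"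
  shows "shift_invariant r \<mu>"
  unfolding shift_invariant_def
proof (intro conjI ballI)
  show "\<mu> \<in> prob_measures r" by (rule \<mu>)
  fix \<beta> assume \<beta>: "\<beta> \<in> FG r"
  have g: "\<gamma> \<in> FG r \<Longrightarrow> gmult \<gamma> \<beta> \<in> FG r" for \<gamma> using \<beta> by (rule gmult_in_FG[rotated])
  show "distr \<mu> (CS r) (shift r \<beta>) = \<mu>"
  proof (rule prob_measures_eqI[OF _ \<mu>])
    show "distr \<mu> (CS r) (shift r \<beta>) \<in> prob_measures r"
      unfolding shift_eq by (intro distr_prob_measures \<mu> measurable_coordinatewise g)
    fix k and \<xi> :: "word \<Rightarrow> 'a"
    let ?B = "ball r k"
    have eq: "measure (distr \<mu> (CS r) (shift r \<beta>)) (fdev r ?B {\<xi>})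
      = measure \<mu> (fdev r ((\<lambda>\<gamma>. gmult \<gamma> \<beta>) ` ?B) {y. restrict (\<lambda>\<gamma>. id (y (gmult \<gamma> \<beta>))) ?B \<in> {\<xi>}})"
      unfolding shift_eq by (rule measure_distr_coordinatewise[OF \<mu> g finite_ball ball_subset_FG])
    have "(\<lambda>j. measure (emp r (n j) (s j) (x j)) (fdev r ?B {\<xi>})) \<longlonglongrightarrow> \<dots>"
      unfolding emp_shift_fdev[OF s \<beta> finite_ball ball_subset_FG, symmetric]
      using finite_ball ball_subset_FG[THEN subsetD] g by (intro lim) auto
    with lim[OF finite_ball ball_subset_FG, of k "{\<xi>}"]
    show "measure (distr \<mu> (CS r) (shift r \<beta>)) (fdev r ?B {\<xi>}) = measure \<mu> (fdev r ?B {\<xi>})"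
      unfolding eq by (rule LIMSEQ_unique[rotated])
  qed
qed

section \<open>The Ising chain and its probabilities on subtrees\<close>

definition tl_closed :: "word set \<Rightarrow> bool" where
  "tl_closed B \<longleftrightarrow> [] \<in> B \<and> (\<forall>w\<in>B. tl w \<in> B)"

lemma reduced_tl: "reduced w \<Longrightarrow> reduced (tl w)"
proof (cases w)
  case (Cons g t)
  assume "reduced w"
  with Cons show ?thesis by (cases t) auto
qed simp

lemma FG_tl: "w \<in> FG r \<Longrightarrow> tl w \<in> FG r"
  by (cases w) (auto simp: FG_def dest: reduced_tl)

lemma tl_closed_ball: "tl_closed (ball r k)"
  unfolding tl_closed_def
proof (intro conjI ballI)
  show "[] \<in> ball r k" by (simp add: ball_def FG_def)
  fix w assume "w \<in> ball r k" then show "tl w \<in> ball r k"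
    by (auto simp: ball_def FG_tl)
qed

text \<open>
  The Ising chain is the image under parity of independent flips: a fair coin at the root and an
  \<open>\<epsilon>\<close>-coin on each edge (\<open>tl w\<close>, w).
\<close>
fun parity :: "(word \<Rightarrow> bool) \<Rightarrow> word \<Rightarrow> bool" where
  "parity f [] = f []"
| "parity f (g # w) = (f (g # w) \<noteq> parity f w)"

lemma exists_Ising:
  assumes "0 \<le> \<epsilon>" "\<epsilon> \<le> 1"
  obtains \<mu> where "\<mu> \<in> prob_measures r"
    "\<And>B \<xi>. finite B \<Longrightarrow> B \<subseteq> FG r \<Longrightarrow> tl_closed B \<Longrightarrow>
      measure \<mu> {x \<in> space (CS r). \<forall>\<gamma>\<in>B. x \<gamma> = \<xi> \<gamma>} = Ising_cyl \<epsilon> \<xi> B"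
proof -
  define flip where "flip w = measure_pmf (bernoulli_pmf (if w = [] then 1/2 else \<epsilon>))" for w :: word
  let ?P = "PiM (FG r) flip"
  have pf: "prob_space (flip w)" for w by (simp add: flip_def prob_space_measure_pmf)
  have sf: "sets (flip w) = UNIV" for w by (simp add: flip_def)
  have sP: "sets ?P = sets (CS r)"
    unfolding CS_def by (intro sets_PiM_cong) (auto simp: flip_def)
  interpret P: prob_space ?P by (intro prob_space_PiM pf)
  let ?f = "\<lambda>y. restrict (parity y) (FG r)"
  have par: "(\<lambda>y. parity y w) \<in> measurable (CS r) (count_space UNIV)" if "w \<in> FG r" for w
    using that
  proof (induction w)
    case Nil
    then show ?case unfolding CS_def by simp
  next
    case (Cons g w)
    then have "(\<lambda>y. parity y w) \<in> measurable (CS r) (count_space UNIV)" using FG_tl[of "g # w" r] by simp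
    moreover have "(\<lambda>y. y (g # w)) \<in> measurable (CS r) (count_space UNIV)"
      unfolding CS_def using Cons by (intro measurable_component_singleton)
    ultimately have "(\<lambda>y. (\<not> y (g # w)) = parity y w) \<in> measurable (CS r) (count_space UNIV)"
      by measurable
    moreover have "(\<lambda>y. parity y (g # w)) = (\<lambda>y. (\<not> y (g # w)) = parity y w)" by auto
    ultimately show ?case by simp
  qed
  have mf: "?f \<in> measurable (CS r) (CS r)"
    by (subst (2) CS_def) (intro measurable_restrict par)
  then have mfP: "?f \<in> measurable ?P (CS r)" by (simp add: measurable_cong_sets[OF sP refl])
  let ?\<mu> = "distr ?P (CS r) ?f"
  show ?thesis
  proof (rule that[of ?\<mu>])
    show "?\<mu> \<in> prob_measures r" using mfP by (simp add: prob_measures_def P.prob_space_distr)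
    fix B and \<xi> :: "word \<Rightarrow> bool" assume B: "finite B" "B \<subseteq> FG r" "tl_closed B"
    let ?C = "{x \<in> space (CS r). \<forall>\<gamma>\<in>B. x \<gamma> = \<xi> \<gamma>}"
    \<comment> \<open>The flips that produce the pattern: the root coin shows the root spin, and the
      coin at a nonempty word records whether its spin differs from that of its parent
      \<open>tl w\<close>. On a set closed under parents, pattern and flips determine each
      other.\<close>
    let ?a = "\<lambda>w. if w = [] then {\<xi> []} else {\<xi> w \<noteq> \<xi> (tl w)}"
    have C: "?C = fdev r B {restrict \<xi> B}"
      by (auto simp: fdev_def restrict_def fun_eq_iff)
    have iff: "(\<forall>\<gamma>\<in>B. parity y \<gamma> = \<xi> \<gamma>) \<longleftrightarrow> (\<forall>\<gamma>\<in>B. y \<gamma> \<in> ?a \<gamma>)" for y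
    proof
      assume l: "\<forall>\<gamma>\<in>B. parity y \<gamma> = \<xi> \<gamma>"
      show "\<forall>\<gamma>\<in>B. y \<gamma> \<in> ?a \<gamma>"
      proof
        fix \<gamma> assume "\<gamma> \<in> B"
        then have "parity y \<gamma> = \<xi> \<gamma>" "parity y (tl \<gamma>) = \<xi> (tl \<gamma>)" using l B(3) by (auto simp: tl_closed_def)
        then show "y \<gamma> \<in> ?a \<gamma>" by (cases \<gamma>) auto
      qed
    next
      assume r: "\<forall>\<gamma>\<in>B. y \<gamma> \<in> ?a \<gamma>"
      have "\<gamma> \<in> B \<Longrightarrow> parity y \<gamma> = \<xi> \<gamma>" for \<gamma>
      proof (induction \<gamma>)
        case Nil then show ?case using r by fastforce
      next
        case (Cons g \<gamma>)
        then have "\<gamma> \<in> B" using B(3) by (force simp: tl_closed_def)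
        moreover have "y (g # \<gamma>) = (\<xi> (g # \<gamma>) \<noteq> \<xi> \<gamma>)" using r Cons by fastforce
        ultimately show ?case using Cons.IH by (cases "\<xi> (g # \<gamma>)"; cases "\<xi> \<gamma>") simp_all
      qed
      then show "\<forall>\<gamma>\<in>B. parity y \<gamma> = \<xi> \<gamma>" by simp
    qed
    have sp: "space ?P = space (CS r)" using sP by (rule sets_eq_imp_space_eq)
    have "?f -` ?C \<inter> space ?P = {y \<in> space (CS r). \<forall>\<gamma>\<in>B. y \<gamma> \<in> ?a \<gamma>}"
      using B(2) unfolding sp by (auto simp: space_CS subset_eq iff[symmetric])
    also have "\<dots> = prod_emb (FG r) flip B (PiE B ?a)"
    proof -
      have "restrict y B \<in> PiE B A \<longleftrightarrow> (\<forall>\<gamma>\<in>B. y \<gamma> \<in> A \<gamma>)"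
        for y and A :: "word \<Rightarrow> bool set" by (auto simp: PiE_iff)
      moreover have "PiE (FG r) (\<lambda>i. space (flip i)) = space (CS r)" by (simp add: space_CS flip_def)
      ultimately show ?thesis
        unfolding prod_emb_def vimage_def by (intro set_eqI) (simp only: Int_iff mem_Collect_eq conj_commute)
    qed
    finally have vi: "?f -` ?C \<inter> space ?P = prod_emb (FG r) flip B (PiE B ?a)" .
    have "emeasure ?\<mu> ?C = emeasure ?P (prod_emb (FG r) flip B (PiE B ?a))"
      unfolding vi[symmetric] using mfP B by (subst emeasure_distr) (auto simp: C fdev_sets)
    also have "\<dots> = (\<Prod>w\<in>B. emeasure (flip w) (?a w))"
      by (rule emeasure_PiM_emb) (use B pf sf in auto)
    also have "\<dots> = (\<Prod>w\<in>B. ennreal (if w = [] then 1/2 else if \<xi> w = \<xi> (tl w) then 1 - \<epsilon> else \<epsilon>))"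
    proof (rule prod.cong[OF refl])
      fix w
      show "emeasure (flip w) (?a w) = ennreal (if w = [] then 1/2 else if \<xi> w = \<xi> (tl w) then 1 - \<epsilon> else \<epsilon>)"
        using assms by (cases "\<xi> w"; cases "\<xi> (tl w)") (auto simp: flip_def emeasure_pmf_single)
    qed
    also have "\<dots> = ennreal (\<Prod>w\<in>B. if w = [] then 1/2 else if \<xi> w = \<xi> (tl w) then 1 - \<epsilon> else \<epsilon>)"
      using assms by (intro prod_ennreal) auto
    also have "(\<Prod>w\<in>B. if w = [] then 1/2 else if \<xi> w = \<xi> (tl w) then 1 - \<epsilon> else \<epsilon>) = Ising_cyl \<epsilon> \<xi> B"
    proof -
      have "[] \<in> B" using B(3) by (simp add: tl_closed_def)
      then show ?thesis
        unfolding Ising_cyl_def using B(1) by (subst prod.remove[of B "[]"]) (auto intro!: prod.cong)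
    qed
    finally have e: "emeasure ?\<mu> ?C = ennreal (Ising_cyl \<epsilon> \<xi> B)" .
    have "0 \<le> Ising_cyl \<epsilon> \<xi> B"
      unfolding Ising_cyl_def using assms by (intro mult_nonneg_nonneg prod_nonneg) auto
    then show "measure ?\<mu> ?C = Ising_cyl \<epsilon> \<xi> B"
      by (simp only: measure_def e enn2real_ennreal)
  qed
qed

lemma fdev_singleton: "fdev r B {restrict \<xi> B} = {x \<in> space (CS r). \<forall>\<gamma>\<in>B. x \<gamma> = \<xi> \<gamma>}"
  by (auto simp: fdev_def restrict_def fun_eq_iff)

text \<open>\<open>Ising\<close> is a definite description, so the uniqueness half has to be
  supplied before anything can be said about it; cylinders over balls determine a measure.\<close>

lemma Ising_eqI:
  assumes \<epsilon>: "0 \<le> \<epsilon>" "\<epsilon> \<le> 1" and \<mu>: "\<mu> \<in> prob_measures r"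
    and cyl: "\<And>k \<xi>. measure \<mu> (fdev r (ball r k) {restrict \<xi> (ball r k)}) = Ising_cyl \<epsilon> \<xi> (ball r k)"
  shows "\<mu> = Ising r \<epsilon>"
  unfolding Ising_def
proof (rule the_equality[symmetric])
  show "\<mu> \<in> prob_measures r \<and> (\<forall>k \<xi>. measure \<mu> {x \<in> space (CS r). \<forall>\<gamma>\<in>ball r k. x \<gamma> = \<xi> \<gamma>}
      = Ising_cyl \<epsilon> \<xi> (ball r k))"
    using \<mu> cyl by (simp add: fdev_singleton)
  fix \<nu> :: "(word \<Rightarrow> bool) measure"
  assume \<nu>: "\<nu> \<in> prob_measures r \<and> (\<forall>k \<xi>. measure \<nu> {x \<in> space (CS r). \<forall>\<gamma>\<in>ball r k. x \<gamma> = \<xi> \<gamma>}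
      = Ising_cyl \<epsilon> \<xi> (ball r k))"
  show "\<nu> = \<mu>"
  proof (rule prob_measures_eqI)
    show "\<nu> \<in> prob_measures r" "\<mu> \<in> prob_measures r" using \<nu> \<mu> by auto
    fix k and \<xi> :: "word \<Rightarrow> bool" assume "\<xi> \<in> PiE (ball r k) (\<lambda>_. UNIV)"
    then have "fdev r (ball r k) {\<xi>} = {x \<in> space (CS r). \<forall>\<gamma>\<in>ball r k. x \<gamma> = \<xi> \<gamma>}"
      "measure \<mu> (fdev r (ball r k) {\<xi>}) = Ising_cyl \<epsilon> \<xi> (ball r k)"
      using fdev_singleton[of r "ball r k" \<xi>] cyl[of k \<xi>] by (simp_all only: PiE_restrict)
    then show "measure \<nu> (fdev r (ball r k) {\<xi>}) = measure \<mu> (fdev r (ball r k) {\<xi>})"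
      using \<nu> by simp
  qed
qed

text \<open>Existence meets uniqueness: the measure built from coin flips is \<open>Ising\<close>.
  The cylinder formula thereby extends from balls to all finite subtrees containing the root, in
  particular to a single edge.\<close>

lemma
  assumes \<epsilon>: "0 \<le> \<epsilon>" "\<epsilon> \<le> 1"
  shows Ising_prob_measures: "Ising r \<epsilon> \<in> prob_measures r"
    and measure_Ising: "\<And>B \<xi>. finite B \<Longrightarrow> B \<subseteq> FG r \<Longrightarrow> tl_closed B \<Longrightarrow>
      measure (Ising r \<epsilon>) (fdev r B {restrict \<xi> B}) = Ising_cyl \<epsilon> \<xi> B"
proof -
  obtain \<mu> where \<mu>: "\<mu> \<in> prob_measures r" "\<And>B \<xi>. finite B \<Longrightarrow> B \<subseteq> FG r \<Longrightarrow> tl_closed B \<Longrightarrow>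
      measure \<mu> (fdev r B {restrict \<xi> B}) = Ising_cyl \<epsilon> \<xi> B"
  proof (rule exists_Ising[OF \<epsilon>, where r = r], goal_cases)
    case (1 \<mu>)
    show ?case by (rule 1(1)[unfolded fdev_singleton]) (fact 1)+
  qed
  have "\<mu> = Ising r \<epsilon>"
    by (intro Ising_eqI \<epsilon> \<mu> finite_ball ball_subset_FG tl_closed_ball)
  with \<mu> show "Ising r \<epsilon> \<in> prob_measures r" "\<And>B \<xi>. finite B \<Longrightarrow> B \<subseteq> FG r \<Longrightarrow> tl_closed B \<Longrightarrow>
      measure (Ising r \<epsilon>) (fdev r B {restrict \<xi> B}) = Ising_cyl \<epsilon> \<xi> B" by auto
qed

section \<open>Concentration of the minimal bisection\<close>

definition avg :: "'a set \<Rightarrow> ('a \<Rightarrow> real) \<Rightarrow> real" where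
  "avg A f = (\<Sum>x\<in>A. f x) / card A"

lemma avg_mono: "(\<And>x. x \<in> A \<Longrightarrow> f x \<le> g x) \<Longrightarrow> avg A f \<le> avg A g"
  by (simp add: avg_def divide_right_mono sum_mono)

lemma avg_const: "finite A \<Longrightarrow> A \<noteq> {} \<Longrightarrow> avg A (\<lambda>_. c) = c"
  by (simp add: avg_def)

lemma avg_cmult: "avg A (\<lambda>x. c * f x) = c * avg A f"
  by (simp add: avg_def sum_distrib_left)

lemma avg_add: "avg A (\<lambda>x. f x + g x) = avg A f + avg A g"
  by (simp add: avg_def sum.distrib add_divide_distrib)

lemma avg_diff: "avg A (\<lambda>x. f x - g x) = avg A f - avg A g"
  by (simp add: avg_def sum_subtractf diff_divide_distrib)

lemma avg_cong: "(\<And>x. x \<in> A \<Longrightarrow> f x = g x) \<Longrightarrow> avg A f = avg A g"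
  by (simp add: avg_def)

lemma avg_deviation:
  assumes A: "finite A" "A \<noteq> {}" and f: "\<And>x. x \<in> A \<Longrightarrow> \<bar>f x - a\<bar> \<le> c"
  shows "\<bar>avg A f - a\<bar> \<le> c"
proof -
  have "\<bar>avg A (\<lambda>x. f x - a)\<bar> \<le> avg A (\<lambda>x. \<bar>f x - a\<bar>)"
    by (simp add: avg_def divide_right_mono)
  also have "\<dots> \<le> avg A (\<lambda>_. c)" using f by (rule avg_mono)
  finally show ?thesis using A by (simp add: avg_diff avg_const)
qed

lemma exp_le_quadratic:
  fixes y :: real
  assumes "\<bar>y\<bar> \<le> 1"
  shows "exp y \<le> 1 + y + y\<^sup>2"
proof (cases "y \<ge> 0")
  case True
  then show ?thesis using assms by (intro exp_bound) auto
next
  case False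
  define z where "z = - y"
  have z: "0 \<le> z" "z \<le> 1" using False assms by (auto simp: z_def)
  have "1 + z + z\<^sup>2 / 2 \<le> exp z" using exp_lower_Taylor_quadratic[OF z(1)] by simp
  \<comment> \<open>So 1 - z + z^2 dominates exp (- z): its product with a lower bound of exp z is
    already at least 1.\<close>
  moreover have "1 \<le> (1 - z + z\<^sup>2) * (1 + z + z\<^sup>2 / 2)"
  proof -
    have "(1 - z + z\<^sup>2) * (1 + z + z\<^sup>2 / 2) = 1 + z\<^sup>2 * (1 + z + z\<^sup>2) / 2"
      by (simp add: field_simps power2_eq_square)
    then show ?thesis using z by simp
  qed
  moreover have "(1 - z + z\<^sup>2) * (1 + z + z\<^sup>2 / 2) \<le> (1 - z + z\<^sup>2) * exp z"
    using z calculation(1) by (intro mult_left_mono) auto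
  ultimately have "1 \<le> (1 - z + z\<^sup>2) * exp z" by linarith
  then have "exp (- z) \<le> 1 - z + z\<^sup>2" by (simp add: exp_minus field_simps)
  then show ?thesis by (simp add: z_def)
qed

text \<open>The estimate for one martingale increment: after centring, the linear term of the
  quadratic bound on exp averages to zero.\<close>

lemma avg_exp_bound:
  assumes A: "finite A" "A \<noteq> {}" and c: "c \<le> 1" and f: "\<And>x. x \<in> A \<Longrightarrow> \<bar>f x - avg A f\<bar> \<le> c"
  shows "avg A (\<lambda>x. exp (f x)) \<le> exp (avg A f + c\<^sup>2)"
proof -
  let ?y = "\<lambda>x. f x - avg A f"
  have "avg A (\<lambda>x. exp (f x)) = exp (avg A f) * avg A (\<lambda>x. exp (?y x))"
    unfolding avg_cmult[symmetric] by (simp add: exp_diff)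
  also have "avg A (\<lambda>x. exp (?y x)) \<le> avg A (\<lambda>x. (1 + c\<^sup>2) + ?y x)"
  proof (rule avg_mono)
    fix x assume x: "x \<in> A"
    have "(?y x)\<^sup>2 \<le> c\<^sup>2" using power_mono[OF f[OF x], of 2] by simp
    moreover have "exp (?y x) \<le> 1 + ?y x + (?y x)\<^sup>2" using f[OF x] c by (intro exp_le_quadratic) linarith
    ultimately show "exp (?y x) \<le> (1 + c\<^sup>2) + ?y x" by linarith
  qed
  also have "\<dots> = 1 + c\<^sup>2" using A by (simp add: avg_add avg_diff avg_const)
  also have "\<dots> \<le> exp (c\<^sup>2)" by (rule exp_ge_add_one_self)
  finally show ?thesis by (simp add: exp_add)
qed

lemma permutes_nonempty: "{p. p permutes S} \<noteq> {}"
  using permutes_id by blast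

text \<open>A uniform permutation of \<open>insert a S\<close> is obtained by choosing the image
  \<open>b\<close> of \<open>a\<close> uniformly and composing the transposition of \<open>a\<close>
  and \<open>b\<close> with a uniform permutation of \<open>S\<close>. This is one revealing step of
  the martingale.\<close>

lemma avg_permutes_insert:
  assumes "finite S" "a \<notin> S"
  shows "avg {p. p permutes insert a S} f
    = avg (insert a S) (\<lambda>b. avg {p. p permutes S} (\<lambda>q. f (Transposition.transpose a b \<circ> q)))"
proof -
  have "card {p. p permutes insert a S} = card (insert a S) * card {p. p permutes S}"
    using assms by (simp add: card_permutations[OF refl])
  then show ?thesis
    unfolding avg_def sum_over_permutations_insert[OF assms] by (simp add: sum_divide_distrib mult.commute)
qed

text \<open>The martingale method on the symmetric group: the images of the points are revealed one
  by one, and each contributes a factor exp ((2c)^2) to the moment generating function.\<close>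

lemma permutes_avg_exp_bound:
  fixes c :: real
  assumes "finite S"
    and "\<And>p a b. p permutes S \<Longrightarrow> a \<in> S \<Longrightarrow> b \<in> S \<Longrightarrow> \<bar>f (Transposition.transpose a b \<circ> p) - f p\<bar> \<le> c"
    and c: "2 * c \<le> 1"
  shows "avg {p. p permutes S} (\<lambda>p. exp (f p)) \<le> exp (avg {p. p permutes S} f + card S * (2 * c)\<^sup>2)"
  using assms(1,2)
proof (induction S arbitrary: f rule: finite_induct)
  case empty
  then show ?case by (simp add: avg_def)
next
  case (insert a S f)
  let ?P = "{p. p permutes S}"
  have P: "finite ?P" "?P \<noteq> {}" using insert.hyps permutes_nonempty by (auto intro: finite_permutations)
  define g where "g b = avg ?P (\<lambda>q. f (Transposition.transpose a b \<circ> q))" for b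
  have sub: "p permutes insert a S" if "p permutes S" for p using that by (rule permutes_subset) auto
  have inner: "avg ?P (\<lambda>q. exp (f (Transposition.transpose a b \<circ> q))) \<le> exp (g b + card S * (2 * c)\<^sup>2)"
    if b: "b \<in> insert a S" for b
    unfolding g_def
  proof (rule insert.IH)
    fix p a' b' assume p: "p permutes S" "a' \<in> S" "b' \<in> S"
    \<comment> \<open>Moving one transposition past another conjugates it. Hence a transposition
      applied inside is a transposition applied outside, and the Lipschitz hypothesis survives
      conditioning on \<open>b\<close>.\<close>
    have "Transposition.transpose a b \<circ> (Transposition.transpose a' b' \<circ> p)
        = Transposition.transpose (Transposition.transpose a b a') (Transposition.transpose a b b') \<circ> (Transposition.transpose a b \<circ> p)"
    proof -
      have "Transposition.transpose a b \<circ> Transposition.transpose a' b' = Transposition.transpose (Transposition.transpose a b a') (Transposition.transpose a b b') \<circ> Transposition.transpose a b"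
        by (auto simp: fun_eq_iff Transposition.transpose_def)
      then show ?thesis by (simp only: o_assoc)
    qed
    moreover have "Transposition.transpose a b \<circ> p permutes insert a S"
      using b p(1) sub by (intro permutes_compose permutes_swap_id) auto
    moreover have "Transposition.transpose a b a' \<in> insert a S" "Transposition.transpose a b b' \<in> insert a S"
      using b p by (auto simp: Transposition.transpose_def)
    ultimately show "\<bar>f (Transposition.transpose a b \<circ> (Transposition.transpose a' b' \<circ> p)) - f (Transposition.transpose a b \<circ> p)\<bar> \<le> c"
      using insert.prems by metis
  qed
  \<comment> \<open>All conditional means are compared with that of b = a, where the transposition
    is trivial. They lie within \<open>c\<close> of it, as does their average, so they are within
    \<open>2 * c\<close> of the average.\<close>
  have dev: "\<bar>g b - avg ?P f\<bar> \<le> c" if b: "b \<in> insert a S" for b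
  proof -
    have "\<bar>avg ?P (\<lambda>q. f (Transposition.transpose a b \<circ> q) - f q) - 0\<bar> \<le> c"
    proof (rule avg_deviation[OF P])
      fix q assume "q \<in> ?P"
      then have "\<bar>f (Transposition.transpose a b \<circ> q) - f q\<bar> \<le> c"
        using b by (intro insert.prems sub) auto
      then show "\<bar>f (Transposition.transpose a b \<circ> q) - f q - 0\<bar> \<le> c" by (simp only: diff_0_right)
    qed
    then show ?thesis by (simp add: g_def avg_diff)
  qed
  let ?I = "insert a S"
  have I: "finite ?I" "?I \<noteq> {}" using insert.hyps by auto
  have mean: "\<bar>avg ?I g - avg ?P f\<bar> \<le> c" using dev by (rule avg_deviation[OF I])
  have dev': "\<bar>g b - avg ?I g\<bar> \<le> 2 * c" if b: "b \<in> ?I" for b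
    using dev[OF b] mean by linarith
  have "avg {p. p permutes ?I} (\<lambda>p. exp (f p)) \<le> avg ?I (\<lambda>b. exp (card S * (2 * c)\<^sup>2) * exp (g b))"
    unfolding avg_permutes_insert[OF insert.hyps]
    using inner by (intro avg_mono) (simp add: exp_add[symmetric] add.commute)
  also have "\<dots> \<le> exp (card S * (2 * c)\<^sup>2) * exp (avg ?I g + (2 * c)\<^sup>2)"
    unfolding avg_cmult using avg_exp_bound[OF I c dev'] by (intro mult_left_mono) auto
  also have "avg ?I g = avg {p. p permutes ?I} f"
    unfolding avg_permutes_insert[OF insert.hyps] g_def ..
  finally show ?case using insert.hyps by (simp add: exp_add[symmetric] algebra_simps)
qed

lemma avg_PiE_insert:
  assumes "finite I" "i \<notin> I"
  shows "avg (PiE (insert i I) A) f = avg (A i) (\<lambda>p. avg (PiE I A) (\<lambda>s. f (s(i := p))))"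
proof -
  have "(\<Sum>s\<in>PiE (insert i I) A. f s) = (\<Sum>(p, s)\<in>A i \<times> PiE I A. f (s(i := p)))"
    unfolding PiE_insert_eq using inj_combinator[OF assms(2), of A]
    by (subst sum.reindex) (auto simp: case_prod_unfold o_def intro!: sum.cong)
  also have "\<dots> = (\<Sum>p\<in>A i. \<Sum>s\<in>PiE I A. f (s(i := p)))"
    by (rule sum.cartesian_product[symmetric])
  finally show ?thesis
    using assms by (simp add: avg_def card_PiE sum_divide_distrib[symmetric])
qed

text \<open>Tensorization. \<open>R\<close> is the relation of elementary moves in a coordinate;
  averaging out the other coordinates preserves the Lipschitz bound along \<open>R\<close>, so the
  one-coordinate estimate applies to the conditional mean and the exponents add up.\<close>

lemma PiE_avg_exp_bound:
  fixes A :: "'i \<Rightarrow> 'p set" and R :: "'i \<Rightarrow> 'p \<Rightarrow> 'p \<Rightarrow> bool"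
    and c K :: real
  assumes "finite I"
    and A: "\<And>i. i \<in> I \<Longrightarrow> finite (A i)" "\<And>i. i \<in> I \<Longrightarrow> A i \<noteq> {}"
    and R: "\<And>i p q. i \<in> I \<Longrightarrow> R i p q \<Longrightarrow> p \<in> A i \<Longrightarrow> q \<in> A i"
    and one: "\<And>i g. i \<in> I \<Longrightarrow> (\<And>p q. p \<in> A i \<Longrightarrow> R i p q \<Longrightarrow> \<bar>g q - g p\<bar> \<le> c) \<Longrightarrow>
      avg (A i) (\<lambda>p. exp (g p)) \<le> exp (avg (A i) g + K)"
    and f: "\<And>s i q. s \<in> PiE I A \<Longrightarrow> i \<in> I \<Longrightarrow> R i (s i) q \<Longrightarrow> \<bar>f (s(i := q)) - f s\<bar> \<le> c"
  shows "avg (PiE I A) (\<lambda>s. exp (f s)) \<le> exp (avg (PiE I A) f + card I * K)"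
  using assms
proof (induction I arbitrary: f rule: finite_induct)
  case empty
  then show ?case by (simp add: avg_def)
next
  case (insert i I f)
  have fin: "finite (PiE I A)" "PiE I A \<noteq> {}"
    using insert.hyps insert.prems(1,2) by (auto simp: PiE_eq_empty_iff intro!: finite_PiE)
  define g where "g p = avg (PiE I A) (\<lambda>s. f (s(i := p)))" for p
  have up: "s(i := p) \<in> PiE (insert i I) A" if "s \<in> PiE I A" "p \<in> A i" for s p
    using that by (auto simp: PiE_iff extensional_def)
  have inner: "avg (PiE I A) (\<lambda>s. exp (f (s(i := p)))) \<le> exp (g p + card I * K)" if p: "p \<in> A i" for p
    unfolding g_def
  proof (rule insert.IH)
    fix s j q assume s: "s \<in> PiE I A" "j \<in> I" "R j (s j) q"
    then have ji: "j \<noteq> i" using insert.hyps by auto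
    have "\<bar>f (s(i := p, j := q)) - f (s(i := p))\<bar> \<le> c"
      using s ji by (intro insert.prems(5)[OF up[OF s(1) p]]) auto
    then show "\<bar>f (s(j := q, i := p)) - f (s(i := p))\<bar> \<le> c"
      unfolding fun_upd_twist[OF ji] .
  qed (use insert.prems in blast)+
  have dev: "\<bar>g q - g p\<bar> \<le> c" if p: "p \<in> A i" "R i p q" for p q
  proof -
    have "\<bar>avg (PiE I A) (\<lambda>s. f (s(i := q)) - f (s(i := p))) - 0\<bar> \<le> c"
    proof (rule avg_deviation[OF fin])
      fix s assume s: "s \<in> PiE I A"
      have "q \<in> A i" using insert.prems(3) p by blast
      have "\<bar>f ((s(i := p))(i := q)) - f (s(i := p))\<bar> \<le> c"
        using p by (intro insert.prems(5)[OF up[OF s p(1)]]) auto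
      then show "\<bar>f (s(i := q)) - f (s(i := p)) - 0\<bar> \<le> c" by simp
    qed
    then show ?thesis by (simp add: g_def avg_diff)
  qed
  have "avg (PiE (insert i I) A) (\<lambda>s. exp (f s)) \<le> avg (A i) (\<lambda>p. exp (card I * K) * exp (g p))"
    unfolding avg_PiE_insert[OF insert.hyps]
    using inner by (intro avg_mono) (simp add: exp_add[symmetric] add.commute)
  also have "\<dots> \<le> exp (card I * K) * exp (avg (A i) g + K)"
    unfolding avg_cmult using insert.prems(4)[of i g] dev by (intro mult_left_mono) auto
  also have "avg (A i) g = avg (PiE (insert i I) A) f"
    unfolding avg_PiE_insert[OF insert.hyps] g_def ..
  finally show ?case using insert.hyps by (simp add: exp_add[symmetric] algebra_simps)
qed

lemma finite_perm_tuples: "finite (perm_tuples r n)"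
  unfolding perm_tuples_def by (intro finite_PiE finite_permutations) auto

lemma perm_tuples_nonempty: "perm_tuples r n \<noteq> {}"
  unfolding perm_tuples_def using permutes_nonempty by (auto simp: PiE_eq_empty_iff)

lemma perm_tuples_avg_exp_bound:
  fixes c :: real
  assumes f: "\<And>s i a b. s \<in> perm_tuples r n \<Longrightarrow> i < r \<Longrightarrow> a < n \<Longrightarrow> b < n \<Longrightarrow>
      \<bar>f (s(i := Transposition.transpose a b \<circ> s i)) - f s\<bar> \<le> c"
    and c: "2 * c \<le> 1"
  shows "avg (perm_tuples r n) (\<lambda>s. exp (f s)) \<le> exp (avg (perm_tuples r n) f + r * n * (2 * c)\<^sup>2)"
proof -
  let ?R = "\<lambda>(i::nat) (p :: nat \<Rightarrow> nat) (q :: nat \<Rightarrow> nat). \<exists>a<n. \<exists>b<n. q = Transposition.transpose a b \<circ> p"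
  have "avg (PiE {..<r} (\<lambda>_. {p. p permutes {..<n}})) (\<lambda>s. exp (f s))
    \<le> exp (avg (PiE {..<r} (\<lambda>_. {p. p permutes {..<n}})) f + card {..<r} * (n * (2 * c)\<^sup>2))"
  proof (rule PiE_avg_exp_bound[where R = ?R and c = c])
    fix i g assume "i \<in> {..<r}" and g: "\<And>p q. p \<in> {p. p permutes {..<n}} \<Longrightarrow> ?R i p q \<Longrightarrow> \<bar>g q - g p\<bar> \<le> c"
    show "avg {p. p permutes {..<n}} (\<lambda>p. exp (g p)) \<le> exp (avg {p. p permutes {..<n}} g + n * (2 * c)\<^sup>2)"
      using permutes_avg_exp_bound[of "{..<n}" g c] g c by auto
  next
    fix i and p q :: "nat \<Rightarrow> nat" assume "?R i p q" "p \<in> {p. p permutes {..<n}}"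
    then show "q \<in> {p. p permutes {..<n}}"
      by (auto intro!: permutes_compose permutes_swap_id)
  next
    fix s i q assume "s \<in> PiE {..<r} (\<lambda>_. {p. p permutes {..<n}})" "i \<in> {..<r}" "?R i (s i) q"
    then show "\<bar>f (s(i := q)) - f s\<bar> \<le> c" using f by (auto simp: perm_tuples_def)
  qed (use permutes_nonempty[of "{..<n}"] in \<open>auto simp: finite_permutations\<close>)
  then show ?thesis by (simp add: perm_tuples_def mult.assoc)
qed

section \<open>Lipschitz bound and lower tail of the minimal bisection\<close>

lemma finite_bisections: "finite (bisections n)"
  by (rule finite_subset[of _ "Pow {..<n}"]) (auto simp: bisections_def)

lemma bisections_nonempty: "bisections n \<noteq> {}"
proof -
  have "{..<n div 2} \<in> bisections n" by (auto simp: bisections_def)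
  then show ?thesis by auto
qed

lemma finite_cut: "finite {(v, i). v < (n :: nat) \<and> i < (r :: nat) \<and> Q v i}"
  by (rule finite_subset[of _ "{..<n} \<times> {..<r}"]) auto

text \<open>Only the two edges of generator \<open>i\<close> that end in \<open>a\<close> and in
  \<open>b\<close> are rerouted; this is the constant 2.\<close>

lemma cut_size_transpose:
  assumes s: "s \<in> perm_tuples r n" and i: "i < r" and ab: "a < n" "b < n"
  shows "cut_size r n (s(i := Transposition.transpose a b \<circ> s i)) V \<le> cut_size r n s V + 2"
proof -
  have p: "s i permutes {..<n}" using perm_tuples_permutes[OF s i] .
  let ?E = "{(v, j). v < n \<and> j < r \<and> (v \<in> V) \<noteq> (s j v \<in> V)}"
  let ?a = "(inv (s i) a, i)" and ?b = "(inv (s i) b, i)"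
  have "{(v, j). v < n \<and> j < r \<and> (v \<in> V) \<noteq> ((s(i := Transposition.transpose a b \<circ> s i)) j v \<in> V)}
      \<subseteq> ?E \<union> {?a, ?b}"
  proof (rule subsetI)
    fix e assume "e \<in> {(v, j). v < n \<and> j < r \<and>
      (v \<in> V) \<noteq> ((s(i := Transposition.transpose a b \<circ> s i)) j v \<in> V)}"
    then obtain v j where e: "e = (v, j)"
      and v: "v < n" "j < r" "(v \<in> V) \<noteq> ((s(i := Transposition.transpose a b \<circ> s i)) j v \<in> V)"
      by auto
    show "e \<in> ?E \<union> {?a, ?b}"
    proof (cases "j = i \<and> (s i v = a \<or> s i v = b)")
      case True
      then have "v = inv (s i) a \<or> v = inv (s i) b" using permutes_inverses(2)[OF p] by metis
      with True e show ?thesis by auto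
    next
      case False
      then show ?thesis using v e by (auto simp: Transposition.transpose_def split: if_splits)
    qed
  qed
  then have "cut_size r n (s(i := Transposition.transpose a b \<circ> s i)) V \<le> card (?E \<union> {?a, ?b})"
    unfolding cut_size_def by (intro card_mono) (auto simp: finite_cut)
  also have "\<dots> \<le> card ?E + card {?a, ?b}" by (rule card_Un_le)
  also have "card {?a, ?b} \<le> 2" by (simp add: card_insert_le_m1)
  finally show ?thesis by (simp add: cut_size_def)
qed

lemma mcut_transpose_le:
  assumes s: "s \<in> perm_tuples r n" and i: "i < r" and ab: "a < n" "b < n"
  shows "mcut r n (s(i := Transposition.transpose a b \<circ> s i)) \<le> mcut r n s + 2"
proof -
  have "mcut r n s \<in> cut_size r n s ` bisections n"
    unfolding mcut_def using finite_bisections bisections_nonempty by (intro Min_in) auto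
  then obtain V where V: "V \<in> bisections n" "mcut r n s = cut_size r n s V" by auto
  have "mcut r n (s(i := Transposition.transpose a b \<circ> s i)) \<le> cut_size r n (s(i := Transposition.transpose a b \<circ> s i)) V"
    unfolding mcut_def using finite_bisections V by (intro Min_le) auto
  also have "\<dots> \<le> mcut r n s + 2" using cut_size_transpose[OF assms] V by simp
  finally show ?thesis .
qed

text \<open>The same transposition applied again restores \<open>s\<close>, so the one-sided bound
  holds in both directions.\<close>

lemma mcut_transpose:
  assumes s: "s \<in> perm_tuples r n" and i: "i < r" and ab: "a < n" "b < n"
  shows "\<bar>real (mcut r n (s(i := Transposition.transpose a b \<circ> s i))) - real (mcut r n s)\<bar> \<le> 2"
proof -
  let ?t = "s(i := Transposition.transpose a b \<circ> s i)"
  have "Transposition.transpose a b \<circ> s i permutes {..<n}"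
    using perm_tuples_permutes[OF s i] ab by (intro permutes_compose permutes_swap_id) auto
  then have t: "?t \<in> perm_tuples r n" using s i by (auto simp: perm_tuples_def PiE_iff extensional_def)
  have "?t(i := Transposition.transpose a b \<circ> ?t i) = s" by (simp add: o_assoc)
  then have "mcut r n s \<le> mcut r n ?t + 2" using mcut_transpose_le[OF t i ab] by simp
  with mcut_transpose_le[OF assms] show ?thesis by linarith
qed

lemma mcut_lower_tail:
  fixes \<delta> a :: real
  assumes mean: "avg (perm_tuples r n) (\<lambda>s. real (mcut r n s)) \<ge> (a + \<delta>) * (r * n)"
    and \<delta>: "0 \<le> \<delta>" "\<delta> \<le> 8"
  shows "card {s \<in> perm_tuples r n. mcut r n s \<le> a * (r * n)} / card (perm_tuples r n)
    \<le> exp (- (\<delta>\<^sup>2 / 64) * (r * n))"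
proof -
  let ?P = "perm_tuples r n" and ?rn = "real r * real n"
  \<comment> \<open>The minimizer of 16 t^2 - t \<delta>, the exponent per edge. The 16 arises
    because \<open>- t * mcut\<close> is Lipschitz with constant 2t and the moment bound squares
    twice that. The bound \<delta> \<le> 8 keeps 4t at most 1.\<close>
  define t where "t = \<delta> / 32"
  have t: "t \<ge> 0" "t \<le> 1/4" using \<delta> by (auto simp: t_def)
  have mgf: "avg ?P (\<lambda>s. exp (- t * mcut r n s)) \<le> exp (avg ?P (\<lambda>s. - t * mcut r n s) + ?rn * (2 * (2 * t))\<^sup>2)"
  proof (rule perm_tuples_avg_exp_bound[where f = "\<lambda>s. - t * mcut r n s" and c = "2 * t"])
    fix s i a b assume h: "s \<in> ?P" "i < r" "a < n" "b < n"
    let ?d = "real (mcut r n (s(i := Transposition.transpose a b \<circ> s i))) - real (mcut r n s)"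
    have "- t * mcut r n (s(i := Transposition.transpose a b \<circ> s i)) - - t * mcut r n s = - (t * ?d)"
      by (simp add: algebra_simps)
    moreover have "t * \<bar>?d\<bar> \<le> t * 2" using mcut_transpose[OF h] t by (intro mult_left_mono)
    ultimately show "\<bar>- t * mcut r n (s(i := Transposition.transpose a b \<circ> s i)) - - t * mcut r n s\<bar> \<le> 2 * t"
      using t by (simp add: abs_mult)
  qed (use t in auto)
  let ?A = "{s \<in> ?P. mcut r n s \<le> a * (r * n)}"
  have "card ?A / card ?P = avg ?P (\<lambda>s. if s \<in> ?A then 1 else 0)"
    by (simp add: avg_def sum.If_cases finite_perm_tuples Int_def)
  also have "\<dots> \<le> avg ?P (\<lambda>s. exp (t * a * ?rn) * exp (- t * mcut r n s))"
  proof (rule avg_mono)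
    fix s
    show "(if s \<in> ?A then 1 else 0) \<le> exp (t * a * ?rn) * exp (- t * mcut r n s)"
      using t by (auto simp: exp_add[symmetric] mult.assoc right_diff_distrib[symmetric] intro!: mult_nonneg_nonneg)
  qed
  also have "\<dots> = exp (t * a * ?rn) * avg ?P (\<lambda>s. exp (- t * mcut r n s))" by (rule avg_cmult)
  also have "\<dots> \<le> exp (t * a * ?rn) * exp (avg ?P (\<lambda>s. - t * mcut r n s) + ?rn * (2 * (2 * t))\<^sup>2)"
    using mgf by (intro mult_left_mono) auto
  also have "\<dots> \<le> exp (- (\<delta>\<^sup>2 / 64) * ?rn)"
  proof -
    have "avg ?P (\<lambda>s. - t * mcut r n s) = - t * avg ?P (\<lambda>s. mcut r n s)" by (rule avg_cmult)
    also have "\<dots> \<le> - t * ((a + \<delta>) * ?rn)" using mean t by (simp add: mult_left_mono)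
    finally have "t * a * ?rn + (avg ?P (\<lambda>s. - t * mcut r n s) + ?rn * (2 * (2 * t))\<^sup>2)
        \<le> ?rn * (16 * t\<^sup>2 - t * \<delta>)" by (simp add: algebra_simps power2_eq_square)
    also have "16 * t\<^sup>2 - t * \<delta> = - (\<delta>\<^sup>2 / 64)" by (simp add: t_def power2_eq_square)
    finally show ?thesis by (simp add: exp_add[symmetric] mult.commute)
  qed
  finally show ?thesis by simp
qed

text \<open>Convergence in probability bounds the mean from below because \<open>mcut\<close> is
  nonnegative: the exceptional tuples may be counted as zero. The mean is needed since concentration
  is around the mean, whereas the limit constant only describes typical values.\<close>

lemma eps_c_limit_mean:
  fixes a c :: real
  assumes lim: "eps_c_limit r c" and r: "r \<ge> 1" and a: "0 \<le> a" "a < c"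
  shows "\<forall>\<^sub>F n in sequentially. avg (perm_tuples r n) (\<lambda>s. real (mcut r n s)) \<ge> a * (r * n)"
proof -
  \<comment> \<open>Half the gap is spent on the deviation of typical tuples, the other half on the
    exceptional ones, whose fraction falls below \<delta> / (c - \<delta>).\<close>
  define \<delta> where "\<delta> = (c - a) / 2"
  have \<delta>: "\<delta> > 0" using a by (simp add: \<delta>_def)
  let ?B = "\<lambda>n. {s \<in> perm_tuples r n. \<bar>real (mcut r n s) / (real r * real n) - c\<bar> > \<delta>}"
  have "(\<lambda>n. card (?B n) / card (perm_tuples r n)) \<longlonglongrightarrow> 0"
    using lim \<delta> by (simp add: eps_c_limit_def)
  moreover have "\<delta> / (c - \<delta>) > 0" using \<delta> a by (simp add: \<delta>_def field_simps)
  ultimately have "\<forall>\<^sub>F n in sequentially. card (?B n) / card (perm_tuples r n) < \<delta> / (c - \<delta>)"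
    by (rule order_tendstoD)
  then show ?thesis using eventually_gt_at_top[of 0]
  proof eventually_elim
    case (elim n)
    let ?P = "perm_tuples r n"
    have rn: "real r * real n > 0" using elim r by simp
    have "avg ?P (\<lambda>s. (c - \<delta>) * (r * n) * (1 - (if s \<in> ?B n then 1 else 0))) \<le> avg ?P (\<lambda>s. real (mcut r n s))"
    proof (rule avg_mono)
      fix s assume s: "s \<in> ?P"
      show "(c - \<delta>) * (r * n) * (1 - (if s \<in> ?B n then 1 else 0)) \<le> real (mcut r n s)"
      proof (cases "s \<in> ?B n")
        case False
        then have "\<bar>mcut r n s / (real r * real n) - c\<bar> \<le> \<delta>" using s by simp
        from abs_le_D2[OF this] have "c - \<delta> \<le> mcut r n s / (real r * real n)" by simp
        then have "(c - \<delta>) * (real r * real n) \<le> mcut r n s" using rn by (simp add: pos_le_divide_eq)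
        then show ?thesis using False by simp
      qed simp
    qed
    moreover have "avg ?P (\<lambda>s. (c - \<delta>) * (r * n) * (1 - (if s \<in> ?B n then 1 else 0)))
        = (c - \<delta>) * (r * n) * (1 - card (?B n) / card ?P)"
      unfolding avg_cmult using finite_perm_tuples perm_tuples_nonempty
      by (simp add: avg_diff avg_const) (simp add: avg_def sum.If_cases finite_perm_tuples Int_def)
    moreover have "(c - \<delta>) * (r * n) * (1 - card (?B n) / card ?P) \<ge> a * (r * n)"
    proof -
      have "c - \<delta> > 0" using a \<delta> by (simp add: \<delta>_def field_simps)
      then have "(c - \<delta>) * (card (?B n) / card ?P) \<le> \<delta>"
        using elim(1) by (simp add: pos_less_divide_eq mult.commute less_imp_le)
      moreover have "(c - \<delta>) * (1 - q) = c - \<delta> - (c - \<delta>) * q" for q by (simp add: algebra_simps)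
      moreover have "c - \<delta> - \<delta> = a" by (simp add: \<delta>_def)
      ultimately have "(c - \<delta>) * (1 - card (?B n) / card ?P) \<ge> a" by (smt (verit))
      then have "(c - \<delta>) * (1 - card (?B n) / card ?P) * (r * n) \<ge> a * (r * n)" by (intro mult_right_mono) auto
      then show ?thesis by (simp add: mult_ac)
    qed
    ultimately show ?case by linarith
  qed
qed

lemma mcut_exponential_lower_tail:
  fixes a c :: real
  assumes lim: "eps_c_limit r c" and r: "r \<ge> 1" and a: "0 \<le> a" "a < c"
  obtains C :: real where "C > 0" "\<forall>\<^sub>F n in sequentially.
    card {s \<in> perm_tuples r n. mcut r n s \<le> a * (r * n)} / card (perm_tuples r n) \<le> exp (- C * n)"
proof -
  \<comment> \<open>With this choice a + \<delta> is still below \<open>c\<close>, so it bounds the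
    mean eventually; the cap 8 is the range of the tail estimate.\<close>
  define \<delta> where "\<delta> = min 8 ((c - a) / 2)"
  have \<delta>: "0 < \<delta>" "\<delta> \<le> 8" "a + \<delta> < c" "0 \<le> a + \<delta>" using a by (auto simp: \<delta>_def min_def field_simps)
  show ?thesis
  proof (rule that[of "\<delta>\<^sup>2 / 64 * r"])
    show "\<delta>\<^sup>2 / 64 * r > 0" using \<delta> r by simp
    show "\<forall>\<^sub>F n in sequentially. card {s \<in> perm_tuples r n. mcut r n s \<le> a * (r * n)} / card (perm_tuples r n)
        \<le> exp (- (\<delta>\<^sup>2 / 64 * r) * n)"
      using eps_c_limit_mean[OF lim r \<delta>(4,3)]
    proof eventually_elim
      case (elim n)
      from mcut_lower_tail[OF this[unfolded of_nat_mult] less_imp_le[OF \<delta>(1)] \<delta>(2)] show ?case by (simp add: mult_ac)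
    qed
  qed
qed

text \<open>Without generators the normalized cut is a division by zero, hence constantly 0, and so
  is its limit. A positive limit constant therefore forces at least one generator.\<close>

lemma eps_c_limit_zero:
  assumes "eps_c_limit 0 c"
  shows "c = 0"
proof (rule ccontr)
  assume "c \<noteq> 0"
  then have "\<bar>c\<bar> / 2 > 0" by simp
  then have "(\<lambda>n. real (card {s \<in> perm_tuples 0 n. \<bar>real (mcut 0 n s) / (real 0 * real n) - c\<bar> > \<bar>c\<bar> / 2})
      / real (card (perm_tuples 0 n))) \<longlonglongrightarrow> 0"
    using assms unfolding eps_c_limit_def by blast
  moreover have "\<bar>c\<bar> / 2 < \<bar>c\<bar>" using \<open>c \<noteq> 0\<close> by simp
  ultimately show False
    using finite_perm_tuples perm_tuples_nonempty by (simp add: LIMSEQ_const_iff card_gt_0_iff)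
qed

section \<open>Local statistics of planted labelings\<close>

definition step :: "(nat \<Rightarrow> nat \<Rightarrow> nat) \<Rightarrow> gen \<Rightarrow> nat \<Rightarrow> nat" where
  "step s g = (if snd g then s (fst g) else inv (s (fst g)))"

lemma act_Cons_step: "act s (g # w) v = step s g (act s w v)"
  by (simp add: step_def)

text \<open>The side of the composition depends on the sign of the letter so that in both cases the
  step along \<open>g\<close> is precomposed with the transposition: the \<open>g\<close>-neighbours
  of \<open>u\<close> and \<open>u'\<close> are exchanged.\<close>

definition swap :: "gen \<Rightarrow> nat \<Rightarrow> nat \<Rightarrow> (nat \<Rightarrow> nat \<Rightarrow> nat) \<Rightarrow> nat \<Rightarrow> nat \<Rightarrow> nat" where
  "swap g u u' s = s(fst g := if snd g then s (fst g) \<circ> Transposition.transpose u u'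
                                 else Transposition.transpose u u' \<circ> s (fst g))"

lemma step_permutes: "s \<in> perm_tuples r n \<Longrightarrow> fst g < r \<Longrightarrow> step s g permutes {..<n}"
  by (auto simp: step_def intro: perm_tuples_permutes permutes_inv)

lemma inv_transpose: "inv (Transposition.transpose a b) = Transposition.transpose a b"
  by (rule inv_unique_comp) (auto simp: fun_eq_iff)

lemma swap_perm_tuples:
  assumes s: "s \<in> perm_tuples r n" and g: "fst g < r" and u: "u < n" "u' < n"
  shows "swap g u u' s \<in> perm_tuples r n"
proof -
  have "Transposition.transpose u u' permutes {..<n}" using u by (intro permutes_swap_id) auto
  then have "(if snd g then s (fst g) \<circ> Transposition.transpose u u'
      else Transposition.transpose u u' \<circ> s (fst g)) permutes {..<n}"
    using perm_tuples_permutes[OF s g] by (auto intro: permutes_compose)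
  then show ?thesis using s g by (auto simp: swap_def perm_tuples_def PiE_iff extensional_def)
qed

lemma swap_swap: "swap g u u' (swap g u u' s) = s"
proof -
  have "Transposition.transpose u u' \<circ> Transposition.transpose u u' = id" by (simp add: fun_eq_iff)
  then show ?thesis by (auto simp: swap_def fun_eq_iff)
qed

lemma step_swap:
  assumes s: "s \<in> perm_tuples r n" and g: "fst g < r"
  shows "step (swap g u u' s) g = step s g \<circ> Transposition.transpose u u'"
    and "step (swap g u u' s) (ginv g) = Transposition.transpose u u' \<circ> step s (ginv g)"
    and "fst h \<noteq> fst g \<Longrightarrow> step (swap g u u' s) h = step s h"
proof -
  have b: "bij (s (fst g))" using perm_tuples_permutes[OF s g] by (rule permutes_bij)
  have t: "bij (Transposition.transpose u u')" by simp
  show "step (swap g u u' s) g = step s g \<circ> Transposition.transpose u u'"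
    using b t by (simp add: step_def swap_def o_inv_distrib inv_transpose)
  show "step (swap g u u' s) (ginv g) = Transposition.transpose u u' \<circ> step s (ginv g)"
    using b t by (simp add: step_def swap_def ginv_def o_inv_distrib inv_transpose)
  show "fst h \<noteq> fst g \<Longrightarrow> step (swap g u u' s) h = step s h"
    by (simp add: step_def swap_def)
qed

text \<open>
  Two roots (the components of v) are explored simultaneously, since the variance of the local
  statistics needs pairs of vertices. An index (j, w) is the word w read from the root chosen by j.
\<close>
definition pt :: "(nat \<Rightarrow> nat \<Rightarrow> nat) \<Rightarrow> nat \<times> nat \<Rightarrow> bool \<times> word \<Rightarrow> nat" where
  "pt s v b = act s (snd b) (if fst b then snd v else fst v)"

text \<open>Closed under parents, hence a union of at most two subtrees at the roots. A root may be
  missing, in which case nothing with its index occurs.\<close>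

definition forest :: "nat \<Rightarrow> (bool \<times> word) set \<Rightarrow> bool" where
  "forest r B \<longleftrightarrow> finite B \<and> (\<forall>(j, w)\<in>B. w \<in> FG r \<and> (w \<noteq> [] \<longrightarrow> (j, tl w) \<in> B))"

text \<open>Injectivity asks that the explored vertices be distinct, across both roots as well; only
  then are the unexplored edges free to be rerouted.\<close>

definition good :: "(nat \<Rightarrow> bool) \<Rightarrow> (bool \<times> word) set \<Rightarrow> (bool \<times> word \<Rightarrow> bool)
    \<Rightarrow> (nat \<Rightarrow> nat \<Rightarrow> nat) \<Rightarrow> nat \<times> nat \<Rightarrow> bool" where
  "good x B \<xi> s v \<longleftrightarrow> inj_on (pt s v) B \<and> (\<forall>b\<in>B. x (pt s v b) = \<xi> b)"

lemma pt_Cons: "pt s v (j, g # w) = step s g (pt s v (j, w))"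
  unfolding pt_def by (simp only: snd_conv fst_conv act_Cons_step)

lemma FG_Cons: "g # w \<in> FG r \<Longrightarrow> fst g < r \<and> w \<in> FG r \<and> (\<forall>w'. w \<noteq> ginv g # w')"
  by (cases w) (auto simp: FG_def)

lemma pt_less:
  assumes "s \<in> perm_tuples r n" "snd b \<in> FG r" "fst v < n" "snd v < n"
  shows "pt s v b < n"
  unfolding pt_def using assms by (intro act_in[OF assms(1)]) (auto simp: FG_def)

text \<open>Only the \<open>g\<close>-edges leaving \<open>u\<close> and \<open>u'\<close> change.
  No explored edge leaves \<open>u\<close> along \<open>g\<close>, since the word
  \<open>g # w\<close> is not explored and explored vertices are distinct; none enters
  \<open>u\<close> along \<open>ginv g\<close>, since \<open>g # w\<close> is reduced. The vertex
  \<open>u'\<close> is either \<open>u\<close> itself or unexplored.\<close>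

lemma pt_swap:
  assumes s: "s \<in> perm_tuples r n" and B: "forest r B" and inj: "inj_on (pt s v) B"
    and w: "(j, w) \<in> B" "(j, g # w) \<notin> B" "g # w \<in> FG r"
    and u': "u' = pt s v (j, w) \<or> u' \<notin> pt s v ` B"
    and b: "b \<in> B"
  shows "pt (swap g (pt s v (j, w)) u' s) v b = pt s v b"
  using b
proof (induction "snd b" arbitrary: b)
  case Nil
  then show ?case by (simp add: pt_def)
next
  case (Cons h w')
  let ?u = "pt s v (j, w)"
  obtain j' where b: "b = (j', h # w')" using Cons.hyps by (metis prod.collapse)
  have b': "(j', w') \<in> B" using B b Cons.prems by (force simp: forest_def)
  have hr: "fst h < r" using B b Cons.prems by (force simp: forest_def FG_def)
  have gr: "fst g < r" using w(3) by (auto simp: FG_def)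
  have IH: "pt (swap g ?u u' s) v (j', w') = pt s v (j', w')"
    using Cons.hyps(1)[of "(j', w')"] b' by simp
  have eq: "pt (swap g ?u u' s) v b = step (swap g ?u u' s) h (pt s v (j', w'))"
    unfolding b pt_Cons IH ..
  consider "h = g" | "h = ginv g" | "fst h \<noteq> fst g"
    by (cases h; cases g) (auto simp: ginv_def)
  then show ?case
  proof cases
    case 1
    have "pt s v (j', w') \<noteq> ?u"
      using inj_onD[OF inj _ b' w(1)] w(2) Cons.prems b 1 by auto
    moreover have "pt s v (j', w') \<noteq> u'" using u' b' calculation by auto
    ultimately show ?thesis
      unfolding eq unfolding b pt_Cons 1 step_swap(1)[OF s gr] by (simp add: Transposition.transpose_def)
  next
    case 2
    have "pt s v b \<noteq> ?u"
      using inj_onD[OF inj _ Cons.prems w(1)] FG_Cons[OF w(3)] b 2 by auto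
    moreover have "pt s v b \<noteq> u'" using u' Cons.prems calculation by auto
    ultimately show ?thesis
      unfolding eq unfolding b pt_Cons 2 step_swap(2)[OF s gr] by (simp add: Transposition.transpose_def)
  next
    case 3
    then show ?thesis unfolding eq unfolding b pt_Cons by (simp add: step_swap(3)[OF s gr])
  qed
qed

lemma card_permutes_inv:
  assumes p: "p permutes {..<n :: nat}"
  shows "card {v. v < n \<and> Q v (p v)} = card {u. u < n \<and> Q (inv p u) u}"
proof -
  have "p ` {v. v < n \<and> Q v (p v)} = {u. u < n \<and> Q (inv p u) u}"
  proof (intro subset_antisym subsetI)
    fix u assume "u \<in> p ` {v. v < n \<and> Q v (p v)}"
    then obtain v where "v < n" "Q v (p v)" "u = p v" by blast
    then show "u \<in> {u. u < n \<and> Q (inv p u) u}"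
      using permutes_inverses(2)[OF p, of v] permutes_in_image[OF p, of v] by simp
  next
    fix u assume "u \<in> {u. u < n \<and> Q (inv p u) u}"
    moreover have "p (inv p u) = u" by (rule permutes_inverses(1)[OF p])
    moreover have "inv p u < n \<longleftrightarrow> u < n" using permutes_in_image[OF permutes_inv[OF p], of u] by simp
    ultimately show "u \<in> p ` {v. v < n \<and> Q v (p v)}" by (intro image_eqI[of _ _ "inv p u"]) simp_all
  qed
  moreover have "card (p ` {v. v < n \<and> Q v (p v)}) = card {v. v < n \<and> Q v (p v)}"
    by (rule card_image, rule inj_on_subset[OF permutes_inj[OF p]], simp)
  ultimately show ?thesis by simp
qed

text \<open>The planted model: the labeling \<open>x\<close> is fixed, and the generators range over
  the set \<open>S\<close> of those that have exactly \<open>m\<close> edges from the class True to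
  the class False, for each generator separately.\<close>

locale planted =
  fixes r N m :: nat and x :: "nat \<Rightarrow> bool"
  assumes N: "N > 0" and m: "m \<le> N" and balanced: "card {v. v < 2 * N \<and> x v} = N"
begin

definition S :: "(nat \<Rightarrow> nat \<Rightarrow> nat) set" where
  "S = {s \<in> perm_tuples r (2 * N). \<forall>i<r. card {v. v < 2 * N \<and> x v \<and> \<not> x (s i v)} = m}"

lemma finite_S: "finite S"
proof -
  have "finite (perm_tuples r (2 * N))"
    unfolding perm_tuples_def by (intro finite_PiE finite_permutations) auto
  then show ?thesis by (simp add: S_def)
qed

lemma S_perm_tuples: "s \<in> S \<Longrightarrow> s \<in> perm_tuples r (2 * N)"
  by (simp add: S_def)

lemma card_class: "card {v. v < 2 * N \<and> x v = a} = N"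
proof (cases a)
  case False
  have "card ({..<2 * N} - {v. v < 2 * N \<and> x v}) = 2 * N - N"
    by (subst card_Diff_subset) (auto simp: balanced)
  moreover have "{..<2 * N} - {v. v < 2 * N \<and> x v} = {v. v < 2 * N \<and> x v = a}" using False by auto
  ultimately show ?thesis by simp
qed (simp add: balanced)

text \<open>A 2 x 2 table whose row and column sums all equal \<open>N\<close> has one degree of
  freedom, so the single count \<open>m\<close> fixes all four entries.\<close>

lemma card_perm_class:
  assumes p: "p permutes {..<2 * N}" and k: "card {v. v < 2 * N \<and> x v \<and> \<not> x (p v)} = m"
  shows "card {v. v < 2 * N \<and> x v = a \<and> x (p v) = b} = (if a = b then N - m else m)"
proof -
  let ?c = "\<lambda>a b. card {v. v < 2 * N \<and> x v = a \<and> x (p v) = b}"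
  have row: "?c a True + ?c a False = N" for a
  proof -
    have "?c a True + ?c a False = card ({v. v < 2 * N \<and> x v = a \<and> x (p v) = True}
        \<union> {v. v < 2 * N \<and> x v = a \<and> x (p v) = False})"
      by (subst card_Un_disjoint) auto
    also have "\<dots> = card {v. v < 2 * N \<and> x v = a}" by (rule arg_cong[where f = card]) auto
    finally show ?thesis by (simp only: card_class)
  qed
  have col: "?c True b + ?c False b = N" for b
  proof -
    have "?c True b + ?c False b = card ({v. v < 2 * N \<and> x v = True \<and> x (p v) = b}
        \<union> {v. v < 2 * N \<and> x v = False \<and> x (p v) = b})"
      by (subst card_Un_disjoint) auto
    also have "\<dots> = card {v. v < 2 * N \<and> x (p v) = b}" by (rule arg_cong[where f = card]) auto
    also have "\<dots> = card {v. v < 2 * N \<and> x v = b}"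
      using card_permutes_inv[OF p, of "\<lambda>v u. x u = b"] .
    finally show ?thesis by (simp only: card_class)
  qed
  have tf: "?c True False = m" using k by simp
  define c where "c a b = ?c a b" for a b
  have "c True False = m" "c True True + c True False = N" "c False True + c False False = N"
    "c True True + c False True = N" "c True False + c False False = N"
    unfolding c_def by (rule tf row col)+
  then have "c a b = (if a = b then N - m else m)" using m by (cases a; cases b) auto
  then show ?thesis by (simp only: c_def)
qed

text \<open>The edge table is symmetric, so a generator and its inverse have the same one and the
  chain is the same in every direction of the tree.\<close>

lemma card_step_class:
  assumes s: "s \<in> S" and g: "fst g < r"
  shows "card {v. v < 2 * N \<and> x v = a \<and> x (step s g v) = b} = (if a = b then N - m else m)"
proof -
  have p: "s (fst g) permutes {..<2 * N}" using perm_tuples_permutes[OF S_perm_tuples[OF s] g] .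
  have k: "card {v. v < 2 * N \<and> x v \<and> \<not> x (s (fst g) v)} = m" using s g by (simp add: S_def)
  show ?thesis
  proof (cases "snd g")
    case True
    then show ?thesis using card_perm_class[OF p k] by (simp add: step_def)
  next
    case False
    let ?p = "s (fst g)"
    have "card {v. v < 2 * N \<and> x v = b \<and> x (?p v) = a} = card {v. v < 2 * N \<and> x (inv ?p v) = b \<and> x v = a}"
      using card_permutes_inv[OF p, of "\<lambda>v u. x v = b \<and> x u = a"] .
    moreover have "{v. v < 2 * N \<and> x (inv ?p v) = b \<and> x v = a} = {v. v < 2 * N \<and> x v = a \<and> x (inv ?p v) = b}"
      by (simp only: conj_commute)
    ultimately have "card {v. v < 2 * N \<and> x v = a \<and> x (inv ?p v) = b} = card {v. v < 2 * N \<and> x v = b \<and> x (?p v) = a}"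
      by (simp only:)
    then show ?thesis using False card_perm_class[OF p k, of b a] by (simp add: step_def eq_commute)
  qed
qed

lemma swap_in_S:
  assumes s: "s \<in> S" and g: "fst g < r" and u: "u < 2 * N" "u' < 2 * N" "x u = x u'"
  shows "swap g u u' s \<in> S"
  unfolding S_def
proof (intro CollectI conjI allI impI)
  have sp: "s \<in> perm_tuples r (2 * N)" using s by (rule S_perm_tuples)
  show "swap g u u' s \<in> perm_tuples r (2 * N)" by (rule swap_perm_tuples[OF sp g u(1,2)])
  fix i assume i: "i < r"
  let ?t = "Transposition.transpose u u'"
  have t: "x (?t v) = x v" for v using u(3) by (auto simp: Transposition.transpose_def)
  have tn: "?t v < 2 * N \<longleftrightarrow> v < 2 * N" for v using u by (auto simp: Transposition.transpose_def)
  have k: "card {v. v < 2 * N \<and> x v \<and> \<not> x (s i v)} = m" using s i by (simp add: S_def)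
  show "card {v. v < 2 * N \<and> x v \<and> \<not> x (swap g u u' s i v)} = m"
  proof (cases "i = fst g \<and> snd g")
    case True
    have "bij_betw ?t {v. v < 2 * N \<and> x v \<and> \<not> x (s i (?t v))} {v. v < 2 * N \<and> x v \<and> \<not> x (s i v)}"
      by (rule bij_betw_byWitness[where f' = ?t]) (auto simp: t tn)
    from bij_betw_same_card[OF this] have "card {v. v < 2 * N \<and> x v \<and> \<not> x (s i (?t v))} = m"
      using k by (rule trans)
    then show ?thesis using True by (simp add: swap_def)
  next
    case False
    then have "x (swap g u u' s i v) = x (s i v)" for v by (simp add: swap_def t)
    then show ?thesis using k by simp
  qed
qed

text \<open>
  The map \<open>(s, u') \<mapsto> (swap g u u' s, u')\<close>, where u is the vertex reached along w, is an involution
  that preserves the explored part and replaces the g-neighbour of u by that of \<open>u'\<close>. Averaging over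
  \<open>u'\<close> in the class of u turns the spin of the next vertex into a deterministic count.
\<close>
lemma extension_count:
  fixes \<xi> :: "bool \<times> word \<Rightarrow> bool"
  assumes B: "forest r B" and w: "(j, w) \<in> B" "(j, g # w) \<notin> B" "g # w \<in> FG r"
    and v: "fst v < 2 * N" "snd v < 2 * N"
  defines "A \<equiv> {s \<in> S. good x B \<xi> s v}"
    and "A' \<equiv> {s \<in> S. good x (insert (j, g # w) B) \<xi> s v}"
    and "K \<equiv> if \<xi> (j, w) = \<xi> (j, g # w) then N - m else m"
  shows "\<bar>real (card A') * N - real (card A) * K\<bar> \<le> 2 * card B * card A"
proof -
  let ?n = "2 * N" and ?im = "\<lambda>s. pt s v ` B"
  have gr: "fst g < r" using w(3) by (auto simp: FG_def)
  have finB: "finite B" and BF: "b \<in> B \<Longrightarrow> snd b \<in> FG r" for b using B by (auto simp: forest_def)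
  define u where "u s = pt s v (j, w)" for s
  define E where "E s u' \<longleftrightarrow> step s g u' \<notin> ?im s \<and> x (step s g u') = \<xi> (j, g # w)" for s u'
  \<comment> \<open>The admissible partners: the class of \<open>u s\<close> without the explored
    vertices, but with \<open>u s\<close> itself. Exchanging with any of them stays inside
    \<open>A\<close>, and their number is \<open>N\<close> up to \<open>card B\<close>.\<close>
  define C where "C s = {u'. u' < ?n \<and> x u' = x (u s) \<and> (u' = u s \<or> u' \<notin> ?im s)}" for s
  define \<Theta> where "\<Theta> z = (swap g (u (fst z)) (snd z) (fst z), snd z)" for z
  have A: "s \<in> S" "s \<in> perm_tuples r ?n" "inj_on (pt s v) B" "x (u s) = \<xi> (j, w)" "u s < ?n"
    if "s \<in> A" for s
  proof -
    show 1: "s \<in> S" "inj_on (pt s v) B" "x (u s) = \<xi> (j, w)"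
      using that w(1) by (auto simp: A_def good_def u_def)
    show 2: "s \<in> perm_tuples r ?n" using 1(1) by (rule S_perm_tuples)
    show "u s < ?n" unfolding u_def using BF[OF w(1)] v by (intro pt_less[OF 2])
  qed
  have finA: "finite A" using finite_S by (simp add: A_def)
  have finC: "finite (C s)" for s by (simp add: C_def)
  have A'_eq: "A' = {s \<in> A. E s (u s)}"
    unfolding A'_def A_def good_def E_def u_def pt_Cons[symmetric]
    using w(2) by (auto simp: inj_on_insert)
  have pt_eq: "pt (swap g (u s) u' s) v b = pt s v b" if "s \<in> A" "u' \<in> C s" "b \<in> B" for s u' b
    unfolding u_def using that A[OF that(1)]
    by (intro pt_swap[OF _ B _ w]) (auto simp: C_def u_def)
  have swapA: "swap g (u s) u' s \<in> A" if h: "s \<in> A" "u' \<in> C s" for s u'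
  proof -
    have "swap g (u s) u' s \<in> S" using A[OF h(1)] h(2) gr by (intro swap_in_S) (auto simp: C_def)
    moreover have "good x B \<xi> (swap g (u s) u' s) v"
      using h(1) pt_eq[OF h] unfolding A_def good_def by (auto simp: inj_on_def)
    ultimately show ?thesis by (simp add: A_def)
  qed
  have u_swap: "u (swap g (u s) u' s) = u s" if h: "s \<in> A" "u' \<in> C s" for s u'
    using pt_eq[OF h w(1)] by (simp add: u_def)
  have im_swap: "?im (swap g (u s) u' s) = ?im s" if h: "s \<in> A" "u' \<in> C s" for s u'
    using pt_eq[OF h] by (intro image_cong) auto
  have C_swap: "C (swap g (u s) u' s) = C s" if h: "s \<in> A" "u' \<in> C s" for s u'
    unfolding C_def u_swap[OF h] im_swap[OF h] ..
  have E_swap: "E (swap g (u s) u' s) (u s) \<longleftrightarrow> E s u'" "E (swap g (u s) u' s) u' \<longleftrightarrow> E s (u s)"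
    if h: "s \<in> A" "u' \<in> C s" for s u'
    unfolding E_def im_swap[OF h] step_swap(1)[OF A(2)[OF h(1)] gr] by simp_all
  let ?XE = "Sigma A' C" and ?XF = "Sigma A (\<lambda>s. {u' \<in> C s. E s u'})"
  have "bij_betw \<Theta> ?XF ?XE"
  proof (rule bij_betw_byWitness[where f' = \<Theta>])
    show "\<forall>z\<in>?XF. \<Theta> (\<Theta> z) = z"
      by (auto simp: \<Theta>_def u_swap swap_swap)
    show "\<forall>z\<in>?XE. \<Theta> (\<Theta> z) = z"
      by (auto simp: \<Theta>_def u_swap swap_swap A'_eq)
    show "\<Theta> ` ?XF \<subseteq> ?XE"
      by (auto simp: \<Theta>_def A'_eq swapA u_swap C_swap E_swap)
    show "\<Theta> ` ?XE \<subseteq> ?XF"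
      by (auto simp: \<Theta>_def A'_eq swapA u_swap C_swap E_swap)
  qed
  then have "card ?XF = card ?XE" by (rule bij_betw_same_card)
  then have eq: "(\<Sum>s\<in>A. card {u' \<in> C s. E s u'}) = (\<Sum>s\<in>A'. card (C s))"
    using finA finC by (simp add: card_SigmaI A'_eq)
  have Cle: "card (C s) \<le> N" if "s \<in> A" for s
  proof -
    have "card (C s) \<le> card {u'. u' < ?n \<and> x u' = x (u s)}" by (intro card_mono) (auto simp: C_def)
    then show ?thesis by (simp add: card_class)
  qed
  have Cge: "real (card (C s)) \<ge> real N - card B" if "s \<in> A" for s
  proof -
    have "card {u'. u' < ?n \<and> x u' = x (u s)} - card (?im s) \<le> card ({u'. u' < ?n \<and> x u' = x (u s)} - ?im s)"
      using finB by (intro diff_card_le_card_Diff) auto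
    also have "\<dots> \<le> card (C s)" by (intro card_mono finC) (auto simp: C_def)
    finally show ?thesis
      using card_image_le[OF finB, of "pt s v"] by (simp add: card_class)
  qed
  have Kset: "card {u'. u' < ?n \<and> x u' = x (u s) \<and> x (step s g u') = \<xi> (j, g # w)} = K" if "s \<in> A" for s
    using card_step_class[OF A(1)[OF that] gr] A(4)[OF that] by (simp add: K_def)
  have Fle: "card {u' \<in> C s. E s u'} \<le> K" if "s \<in> A" for s
    unfolding Kset[OF that, symmetric] by (intro card_mono) (auto simp: C_def E_def)
  have Fge: "real (card {u' \<in> C s. E s u'}) \<ge> real K - 2 * card B" if "s \<in> A" for s
  proof -
    let ?Y = "{u'. u' < ?n \<and> x u' = x (u s) \<and> x (step s g u') = \<xi> (j, g # w)}"
    \<comment> \<open>A vertex of the right spins is lost if it is explored or if its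
      \<open>g\<close>-neighbour is; each kind accounts for at most \<open>card B\<close> vertices,
      whence the factor 2.\<close>
    let ?I = "?im s \<union> {u'. step s g u' \<in> ?im s}"
    have inj: "inj (step s g)" using step_permutes[OF A(2)[OF that] gr] by (rule permutes_inj)
    have fin1: "finite {u'. step s g u' \<in> ?im s}"
      using finite_vimageI[OF finite_imageI[OF finB] inj, of "pt s v"] by (simp add: vimage_def)
    have "card {u'. step s g u' \<in> ?im s} \<le> card (?im s)"
      using inj finB by (intro card_inj_on_le[of "step s g"]) (auto simp: inj_on_def dest: injD)
    then have I: "card ?I \<le> 2 * card B"
      using card_Un_le[of "?im s" "{u'. step s g u' \<in> ?im s}"] card_image_le[OF finB, of "pt s v"] by linarith
    have "card ?Y - card ?I \<le> card (?Y - ?I)"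
      using finB fin1 by (intro diff_card_le_card_Diff) auto
    also have "\<dots> \<le> card {u' \<in> C s. E s u'}"
      using finC by (intro card_mono) (auto simp: C_def E_def)
    finally show ?thesis using I Kset[OF that] by linarith
  qed
  have A'A: "A' \<subseteq> A" by (auto simp: A'_eq)
  then have cA': "card A' \<le> card A" using finA by (intro card_mono)
  have up: "(\<Sum>s\<in>A'. card (C s)) \<le> card A' * N"
    using Cle A'A sum_bounded_above[of A' "\<lambda>s. card (C s)" N] by auto
  have lo: "real (\<Sum>s\<in>A'. card (C s)) \<ge> card A' * (real N - card B)"
    using Cge A'A sum_bounded_below[of A' "real N - card B" "\<lambda>s. real (card (C s))"] by auto
  have Fup: "(\<Sum>s\<in>A. card {u' \<in> C s. E s u'}) \<le> card A * K"
    using Fle sum_bounded_above[of A "\<lambda>s. card {u' \<in> C s. E s u'}" K] by auto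
  have Flo: "real (\<Sum>s\<in>A. card {u' \<in> C s. E s u'}) \<ge> card A * (real K - 2 * card B)"
    using Fge sum_bounded_below[of A "real K - 2 * card B" "\<lambda>s. real (card {u' \<in> C s. E s u'})"] by auto
  have "real (card A) * (real K - 2 * card B) \<le> card A' * N"
    using Flo of_nat_mono[OF up, where 'a = real] unfolding eq by simp
  moreover have "card A' * (real N - card B) \<le> card A * K"
    using lo of_nat_mono[OF Fup, where 'a = real] unfolding eq by simp
  moreover have "real (card A') * card B \<le> real (card A) * card B"
    using cA' by (intro mult_right_mono) auto
  ultimately show ?thesis by (simp add: algebra_simps abs_le_iff)
qed

end

section \<open>Frequencies of patterns around two random roots\<close>

context planted
begin

text \<open>The probability of an injective occurrence of the pattern for a uniform element of
  \<open>S\<close> and two independent uniform roots. Both roots are drawn even if \<open>B\<close>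
  involves only one of them.\<close>

definition freq :: "(bool \<times> word) set \<Rightarrow> (bool \<times> word \<Rightarrow> bool) \<Rightarrow> real" where
  "freq B \<xi> = (\<Sum>v\<in>{..<2 * N} \<times> {..<2 * N}. real (card {s \<in> S. good x B \<xi> s v})) / (card S * (2 * N)\<^sup>2)"

lemma freq_le_1: "freq B \<xi> \<le> 1"
proof -
  have "(\<Sum>v\<in>{..<2 * N} \<times> {..<2 * N}. real (card {s \<in> S. good x B \<xi> s v}))
      \<le> (\<Sum>v\<in>{..<2 * N} \<times> {..<2 * N}. real (card S))"
    by (intro sum_mono) (auto intro!: card_mono finite_S)
  also have "\<dots> = card S * (2 * N)\<^sup>2" by (simp add: power2_eq_square)
  finally show ?thesis unfolding freq_def by (intro divide_le_eq_1[THEN iffD2]) (auto simp: not_less)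
qed

text \<open>Averaging \<open>extension_count\<close> over the roots: one more vertex costs its
  transition probability \<open>K / N\<close>, with an error of order 1/N that does not depend on
  the labeling.\<close>

lemma freq_extend:
  fixes \<xi> :: "bool \<times> word \<Rightarrow> bool"
  assumes S: "S \<noteq> {}" and B: "forest r B" and w: "(j, w) \<in> B" "(j, g # w) \<notin> B" "g # w \<in> FG r"
  defines "K \<equiv> if \<xi> (j, w) = \<xi> (j, g # w) then N - m else m"
  shows "\<bar>freq (insert (j, g # w) B) \<xi> - real K / N * freq B \<xi>\<bar> \<le> 2 * card B / N"
proof -
  let ?V = "{..<2 * N} \<times> {..<2 * N}" and ?B' = "insert (j, g # w) B"
  let ?c = "\<lambda>B. \<Sum>v\<in>?V. real (card {s \<in> S. good x B \<xi> s v})"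
  let ?d = "real (card S) * (2 * real N)\<^sup>2"
  have cS: "card S > 0" using S finite_S by (simp add: card_gt_0_iff)
  then have d: "?d > 0" using N by simp
  have "\<bar>?c ?B' * N - ?c B * K\<bar>
      = \<bar>\<Sum>v\<in>?V. real (card {s \<in> S. good x ?B' \<xi> s v}) * N - real (card {s \<in> S. good x B \<xi> s v}) * K\<bar>"
    by (simp add: sum_distrib_right sum_subtractf)
  also have "\<dots> \<le> (\<Sum>v\<in>?V. \<bar>real (card {s \<in> S. good x ?B' \<xi> s v}) * N - real (card {s \<in> S. good x B \<xi> s v}) * K\<bar>)"
    by (rule sum_abs)
  also have "\<dots> \<le> (\<Sum>v\<in>?V. 2 * card B * real (card {s \<in> S. good x B \<xi> s v}))"
    unfolding K_def by (intro sum_mono order_trans[OF extension_count[OF B w]]) auto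
  also have "\<dots> = 2 * card B * (freq B \<xi> * ?d)"
    using cS N by (simp add: freq_def sum_distrib_left)
  also have "\<dots> \<le> 2 * card B * ?d"
    using mult_right_mono[OF freq_le_1[of B \<xi>], of ?d] d by (intro mult_left_mono) auto
  finally have "\<bar>?c ?B' * N - ?c B * K\<bar> \<le> 2 * card B * ?d" .
  moreover have "freq ?B' \<xi> - real K / N * freq B \<xi> = (?c ?B' * N - ?c B * K) / (?d * N)"
  proof -
    have "a / d - k / n * (b / d) = (a * n - b * k) / (d * n)" if "d > 0" "n > 0" for a b d k n :: real
      using that by (simp add: field_simps)
    then show ?thesis unfolding freq_def using d N by simp
  qed
  ultimately show ?thesis
    using d N by (simp add: abs_divide abs_mult divide_le_eq)
qed

lemma freq_empty: "S \<noteq> {} \<Longrightarrow> freq {} \<xi> = 1"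
  using N finite_S by (simp add: freq_def good_def power2_eq_square card_gt_0_iff)

text \<open>A new root is a uniform vertex independent of the rest. It has the prescribed spin with
  probability exactly 1/2, and hits the explored part with probability of order 1/N.\<close>

lemma freq_root:
  assumes S: "S \<noteq> {}" and B: "forest r B" and j: "(j, []) \<notin> B"
  shows "\<bar>freq (insert (j, []) B) \<xi> - 1 / 2 * freq B \<xi>\<bar> \<le> card B / N"
proof -
  let ?n = "2 * N" and ?B' = "insert (j, []) B"
  \<comment> \<open>\<open>vv y z\<close> puts the new root \<open>z\<close> in the component named
    by \<open>j\<close>. Since nothing in \<open>B\<close> has index \<open>j\<close>, the patterns
    on \<open>B\<close> do not see \<open>z\<close>, and \<open>v0\<close> replaces it by the dummy
    vertex 0.\<close>
  define vv where "vv y z = (if j then (y, z) else (z, y))" for y z :: nat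
  define v0 where "v0 y = vv y 0" for y
  have finB: "finite B" using B by (simp add: forest_def)
  have noj: "(j, w) \<notin> B" for w
  proof (induction w)
    case (Cons g w)
    then show ?case using B by (force simp: forest_def)
  qed (rule j)
  have pt_z: "pt s (vv y z) b = pt s (v0 y) b" if "b \<in> B" for s y z b
    using that noj by (cases b) (auto simp: pt_def vv_def v0_def)
  have pt_j: "pt s (vv y z) (j, []) = z" for s y z by (auto simp: pt_def vv_def)
  have good_z: "good x B \<xi> s (vv y z) \<longleftrightarrow> good x B \<xi> s (v0 y)" for s y z
  proof -
    have "inj_on (pt s (vv y z)) B = inj_on (pt s (v0 y)) B"
      by (rule inj_on_cong) (rule pt_z)
    then show ?thesis unfolding good_def using pt_z[of _ s y z] by simp
  qed
  have im_z: "pt s (vv y z) ` B = pt s (v0 y) ` B" for s y z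
    by (rule image_cong[OF refl]) (rule pt_z)
  have good_B': "good x ?B' \<xi> s (vv y z) \<longleftrightarrow> good x B \<xi> s (v0 y) \<and> z \<notin> pt s (v0 y) ` B \<and> x z = \<xi> (j, [])" for s y z
  proof -
    have "good x ?B' \<xi> s (vv y z) \<longleftrightarrow> good x B \<xi> s (vv y z) \<and> z \<notin> pt s (vv y z) ` B \<and> x z = \<xi> (j, [])"
      unfolding good_def using j by (auto simp: pt_j inj_on_insert)
    then show ?thesis unfolding good_z im_z .
  qed
  have reidx: "(\<Sum>v\<in>{..<?n} \<times> {..<?n}. h v) = (\<Sum>y<?n. \<Sum>z<?n. h (vv y z))" for h :: "nat \<times> nat \<Rightarrow> real"
  proof (cases j)
    case True
    then show ?thesis by (simp add: vv_def sum.cartesian_product')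
  next
    case False
    have "(\<Sum>v\<in>{..<?n} \<times> {..<?n}. h v) = (\<Sum>y<?n. \<Sum>z<?n. h (y, z))" by (simp add: sum.cartesian_product')
    also have "\<dots> = (\<Sum>z<?n. \<Sum>y<?n. h (y, z))" by (rule sum.swap)
    finally show ?thesis using False by (simp add: vv_def)
  qed
  have card_sum: "(\<Sum>z<?n. real (card {s \<in> S. Q s z})) = (\<Sum>s\<in>S. real (card {z. z < ?n \<and> Q s z}))" for Q
  proof -
    have "(\<Sum>z<?n. real (card {s \<in> S. Q s z})) = (\<Sum>z<?n. \<Sum>s\<in>S. if Q s z then 1 else 0)"
      using finite_S by (simp add: sum.If_cases Int_def)
    also have "\<dots> = (\<Sum>s\<in>S. \<Sum>z<?n. if Q s z then 1 else 0)" by (rule sum.swap)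
    also have "\<dots> = (\<Sum>s\<in>S. real (card {z. z < ?n \<and> Q s z}))"
      by (simp add: sum.If_cases Int_def lessThan_def)
    finally show ?thesis .
  qed
  let ?G = "\<lambda>y s. if good x B \<xi> s (v0 y) then 1 else 0 :: real"
  have cB: "(\<Sum>z<?n. real (card {s \<in> S. good x B \<xi> s (vv y z)})) = (\<Sum>s\<in>S. ?n * ?G y s)" for y
    unfolding card_sum good_z by (intro sum.cong) auto
  have cB': "\<bar>real (card {z. z < ?n \<and> good x ?B' \<xi> s (vv y z)}) - 1 / 2 * (?n * ?G y s)\<bar> \<le> card B" for y s
  proof (cases "good x B \<xi> s (v0 y)")
    case True
    let ?Y = "{z. z < ?n \<and> x z = \<xi> (j, [])}" and ?I = "pt s (v0 y) ` B"
    have eq: "{z. z < ?n \<and> good x ?B' \<xi> s (vv y z)} = ?Y - ?I" using True by (auto simp: good_B')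
    have "card ?Y - card ?I \<le> card (?Y - ?I)" using finB by (intro diff_card_le_card_Diff) auto
    moreover have "card (?Y - ?I) \<le> card ?Y" by (intro card_mono) auto
    ultimately show ?thesis
      unfolding eq using True card_image_le[OF finB, of "pt s (v0 y)"] by (simp add: card_class)
  qed (simp add: good_B')
  let ?c = "\<lambda>B. \<Sum>v\<in>{..<?n} \<times> {..<?n}. real (card {s \<in> S. good x B \<xi> s v})"
  have "?c ?B' - 1 / 2 * ?c B = (\<Sum>y<?n. \<Sum>s\<in>S. real (card {z. z < ?n \<and> good x ?B' \<xi> s (vv y z)}) - 1 / 2 * (?n * ?G y s))"
    unfolding reidx cB unfolding card_sum by (simp add: sum_subtractf sum_distrib_left)
  moreover define D where
    "D y s = real (card {z. z < ?n \<and> good x ?B' \<xi> s (vv y z)}) - 1 / 2 * (?n * ?G y s)" for y s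
  ultimately have eq: "?c ?B' - 1 / 2 * ?c B = (\<Sum>y<?n. \<Sum>s\<in>S. D y s)" by simp
  have "\<bar>\<Sum>s\<in>S. D y s\<bar> \<le> (\<Sum>s\<in>S. real (card B))" for y
    by (rule order_trans[OF sum_abs], rule sum_mono) (simp only: D_def cB')
  then have "(\<Sum>y<?n. \<bar>\<Sum>s\<in>S. D y s\<bar>) \<le> (\<Sum>y<?n. \<Sum>s\<in>S. real (card B))"
    by (intro sum_mono)
  then have "\<bar>?c ?B' - 1 / 2 * ?c B\<bar> \<le> (\<Sum>y<?n. \<Sum>s\<in>S. real (card B))"
    unfolding eq by (rule order_trans[OF sum_abs])
  then have le: "\<bar>?c ?B' - 1 / 2 * ?c B\<bar> \<le> ?n * card S * card B" by simp
  let ?d = "real (card S) * (2 * real N)\<^sup>2"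
  have cS: "card S > 0" using S finite_S by (simp add: card_gt_0_iff)
  then have d: "?d > 0" using N by simp
  have fr: "freq ?B' \<xi> - 1 / 2 * freq B \<xi> = (?c ?B' - 1 / 2 * ?c B) / ?d"
    unfolding freq_def by (simp add: diff_divide_distrib)
  have "\<bar>a / d\<bar> \<le> b / d" if "\<bar>a\<bar> \<le> b" "d > 0" for a b d :: real
    using that by (simp add: abs_divide divide_right_mono)
  from this[OF le d] have "\<bar>freq ?B' \<xi> - 1 / 2 * freq B \<xi>\<bar> \<le> ?n * card S * card B / ?d"
    unfolding fr .
  also have "\<dots> = card B / (2 * N)" using cS N by (simp add: power2_eq_square field_simps)
  also have "\<dots> \<le> card B / N" using N by (simp add: field_simps)
  finally show ?thesis .
qed

end

text \<open>A longest word of a forest is a leaf, so removing it leaves a forest.\<close>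

lemma forest_induct [consumes 1, case_names empty insert]:
  assumes "forest r B"
    and empty: "P {}"
    and insert: "\<And>B j w. forest r B \<Longrightarrow> w \<in> FG r \<Longrightarrow> (j, w) \<notin> B \<Longrightarrow> (w \<noteq> [] \<Longrightarrow> (j, tl w) \<in> B) \<Longrightarrow>
      P B \<Longrightarrow> P (insert (j, w) B)"
  shows "P B"
  using assms(1)
proof (induction "card B" arbitrary: B)
  case 0
  then show ?case using empty by (auto simp: forest_def)
next
  case (Suc k)
  then have fin: "finite B" and ne: "B \<noteq> {}" by (auto simp: forest_def)
  define M where "M = Max ((\<lambda>b. length (snd b)) ` B)"
  have "M \<in> (\<lambda>b. length (snd b)) ` B"
    unfolding M_def using fin ne by (intro Max_in) auto
  then obtain b0 where "b0 \<in> B" "M = length (snd b0)" by (elim imageE)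
  then obtain j w where b: "(j, w) \<in> B" "length w = M" by (cases b0) simp
  have mx: "length (snd b') \<le> length w" if "b' \<in> B" for b'
    unfolding b(2) unfolding M_def by (rule Max_ge) (use fin that in simp_all)
  let ?B = "B - {(j, w)}"
  have fo: "\<And>j' w'. (j', w') \<in> B \<Longrightarrow> w' \<in> FG r \<and> (w' \<noteq> [] \<longrightarrow> (j', tl w') \<in> B)"
    using Suc.prems by (force simp: forest_def)
  have B': "forest r ?B"
    unfolding forest_def
  proof (intro conjI ballI)
    show "finite ?B" using fin by simp
    fix b' assume b': "b' \<in> ?B"
    obtain j' w' where e: "b' = (j', w')" by (cases b')
    have "w' \<noteq> [] \<Longrightarrow> (j', tl w') \<noteq> (j, w)"
      using mx[of "(j', w')"] b' e by (cases w') auto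
    then show "case b' of (j, w') \<Rightarrow> w' \<in> FG r \<and> (w' \<noteq> [] \<longrightarrow> (j, tl w') \<in> ?B)"
      using fo[of j' w'] b' e by auto
  qed
  have "P (insert (j, w) ?B)"
  proof (rule insert[OF B'])
    show "w \<in> FG r" using fo b(1) by blast
    show "(j, w) \<notin> ?B" by simp
    show "(j, tl w) \<in> ?B" if "w \<noteq> []"
    proof -
      have "tl w \<noteq> w" using that by (cases w) auto
      then show ?thesis using fo[OF b(1)] that by auto
    qed
    show "P ?B" using Suc.hyps(2) b(1) fin B' by (intro Suc.hyps(1)) auto
  qed
  then show ?case using b(1) by (simp add: insert_absorb)
qed

text \<open>The factor contributed by one index to the probability of a pattern under two
  independent Ising chains, one per root.\<close>

definition fac :: "real \<Rightarrow> (bool \<times> word \<Rightarrow> bool) \<Rightarrow> bool \<times> word \<Rightarrow> real" where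
  "fac \<epsilon> \<xi> b = (if snd b = [] then 1/2 else if \<xi> b = \<xi> (fst b, tl (snd b)) then 1 - \<epsilon> else \<epsilon>)"

lemma prod_fac_cong:
  assumes "forest r B" "\<And>b. b \<in> B \<Longrightarrow> \<xi> b = \<eta> b"
  shows "(\<Prod>b\<in>B. fac \<epsilon> \<xi> b) = (\<Prod>b\<in>B. fac \<epsilon> \<eta> b)"
proof (rule prod.cong[OF refl])
  fix b assume b: "b \<in> B"
  then have "snd b \<noteq> [] \<Longrightarrow> (fst b, tl (snd b)) \<in> B" using assms(1) by (auto simp: forest_def)
  then show "fac \<epsilon> \<xi> b = fac \<epsilon> \<eta> b" using assms(2) b by (simp add: fac_def)
qed

text \<open>Summing over the spin of a leaf gives 1. The total mass later shows that non-injective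
  pairs of neighbourhoods have vanishing frequency, without estimating collisions directly.\<close>

lemma sum_prod_fac: "forest r B \<Longrightarrow> (\<Sum>\<eta>\<in>PiE B (\<lambda>_. UNIV). \<Prod>b\<in>B. fac \<epsilon> \<eta> b) = 1"
proof (induction rule: forest_induct)
  case empty
  then show ?case by simp
next
  case (insert B j w)
  let ?b = "(j, w)" and ?U = "PiE B (\<lambda>_. UNIV :: bool set)"
  have finB: "finite B" using insert(1) by (simp add: forest_def)
  have one: "(\<Sum>c\<in>UNIV. fac \<epsilon> (\<eta>(?b := c)) ?b) = 1" for \<eta> :: "bool \<times> word \<Rightarrow> bool"
  proof (cases "w = []")
    case False
    then have "(j, tl w) \<noteq> ?b" by (cases w) auto
    then show ?thesis using False by (cases "\<eta> (j, tl w)") (auto simp: fac_def UNIV_bool)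
  qed (auto simp: fac_def UNIV_bool)
  have "(\<Sum>\<eta>\<in>PiE (insert ?b B) (\<lambda>_. UNIV). \<Prod>b\<in>insert ?b B. fac \<epsilon> \<eta> b)
      = (\<Sum>(c, \<eta>)\<in>UNIV \<times> ?U. \<Prod>b\<in>insert ?b B. fac \<epsilon> (\<eta>(?b := c)) b)"
    unfolding PiE_insert_eq using inj_combinator[OF insert(3), of "\<lambda>_. UNIV"]
    by (subst sum.reindex) (auto simp: case_prod_unfold o_def intro!: sum.cong)
  also have "\<dots> = (\<Sum>(c, \<eta>)\<in>UNIV \<times> ?U. (\<Prod>b\<in>B. fac \<epsilon> \<eta> b) * fac \<epsilon> (\<eta>(?b := c)) ?b)"
  proof (rule sum.cong[OF refl], clarify)
    fix c \<eta> assume "\<eta> \<in> ?U"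
    have "(\<Prod>b\<in>B. fac \<epsilon> (\<eta>(?b := c)) b) = (\<Prod>b\<in>B. fac \<epsilon> \<eta> b)"
      using insert(3) by (intro prod_fac_cong[OF insert(1)]) auto
    then show "(\<Prod>b\<in>insert ?b B. fac \<epsilon> (\<eta>(?b := c)) b) = (\<Prod>b\<in>B. fac \<epsilon> \<eta> b) * fac \<epsilon> (\<eta>(?b := c)) ?b"
      using finB insert(3) by (simp add: mult.commute)
  qed
  also have "\<dots> = (\<Sum>c\<in>UNIV. \<Sum>\<eta>\<in>?U. (\<Prod>b\<in>B. fac \<epsilon> \<eta> b) * fac \<epsilon> (\<eta>(?b := c)) ?b)"
    by (rule sum.cartesian_product[symmetric])
  also have "\<dots> = (\<Sum>\<eta>\<in>?U. \<Sum>c\<in>UNIV. (\<Prod>b\<in>B. fac \<epsilon> \<eta> b) * fac \<epsilon> (\<eta>(?b := c)) ?b)"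
    by (rule sum.swap)
  also have "\<dots> = (\<Sum>\<eta>\<in>?U. \<Prod>b\<in>B. fac \<epsilon> \<eta> b)"
    unfolding sum_distrib_left[symmetric] one by simp
  finally show ?case using insert.IH by simp
qed

lemma prod_fac_Ising_cyl:
  assumes "finite B" "[] \<in> B"
  shows "(\<Prod>b\<in>{j} \<times> B. fac \<epsilon> (\<lambda>b. \<xi> (snd b)) b) = Ising_cyl \<epsilon> \<xi> B"
proof -
  have "(\<Prod>b\<in>{j} \<times> B. fac \<epsilon> (\<lambda>b. \<xi> (snd b)) b)
      = (\<Prod>w\<in>B. if w = [] then 1/2 else if \<xi> w = \<xi> (tl w) then 1 - \<epsilon> else \<epsilon>)"
    by (rule prod.reindex_bij_witness[where i = "\<lambda>w. (j, w)" and j = snd]) (auto simp: fac_def)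
  also have "\<dots> = Ising_cyl \<epsilon> \<xi> B"
    unfolding Ising_cyl_def using assms by (subst prod.remove[of B "[]"]) (auto intro!: prod.cong)
  finally show ?thesis .
qed

text \<open>The labelings are an arbitrary sequence, so that an adversarial choice for each
  \<open>N\<close> can be inserted later.\<close>

locale planted_seq =
  fixes r :: nat and \<epsilon> :: real and m :: "nat \<Rightarrow> nat" and x :: "nat \<Rightarrow> nat \<Rightarrow> bool"
  assumes pl: "\<And>N. N > 0 \<Longrightarrow> planted N (m N) (x N)"
    and S_ne: "\<And>N. N > 0 \<Longrightarrow> planted.S r N (m N) (x N) \<noteq> {}"
    and m_lim: "(\<lambda>N. real (m N) / real N) \<longlonglongrightarrow> \<epsilon>"
begin

abbreviation "F N \<equiv> planted.freq r N (m N) (x N)"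
abbreviation "SN N \<equiv> planted.S r N (m N) (x N)"

lemma tendsto_of_product_approx:
  fixes a b c :: "nat \<Rightarrow> real"
  assumes ap: "\<And>N. N > 0 \<Longrightarrow> \<bar>a N - c N * b N\<bar> \<le> C / real N" and c: "c \<longlonglongrightarrow> \<gamma>" and b: "b \<longlonglongrightarrow> \<beta>"
  shows "a \<longlonglongrightarrow> \<gamma> * \<beta>"
proof -
  have "(\<lambda>N. a N - c N * b N) \<longlonglongrightarrow> 0"
  proof (rule Lim_null_comparison)
    show "\<forall>\<^sub>F N in sequentially. norm (a N - c N * b N) \<le> C / real N"
      using eventually_gt_at_top[of 0] by eventually_elim (use ap in auto)
    show "(\<lambda>N. C / real N) \<longlonglongrightarrow> 0" by (rule lim_const_over_n)
  qed
  from tendsto_add[OF this tendsto_mult[OF c b]] show ?thesis by simp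
qed

lemma freq_tendsto: "forest r B \<Longrightarrow> (\<lambda>N. F N B \<xi>) \<longlonglongrightarrow> (\<Prod>b\<in>B. fac \<epsilon> \<xi> b)"
proof (induction rule: forest_induct)
  case empty
  have "\<forall>\<^sub>F N in sequentially. F N {} \<xi> = 1"
    using eventually_gt_at_top[of 0] by eventually_elim (rule planted.freq_empty[OF pl S_ne])
  then show ?case by (simp add: tendsto_eventually)
next
  case (insert B j w)
  have finB: "finite B" using insert(1) by (simp add: forest_def)
  have "(\<lambda>N. F N (insert (j, w) B) \<xi>) \<longlonglongrightarrow> fac \<epsilon> \<xi> (j, w) * (\<Prod>b\<in>B. fac \<epsilon> \<xi> b)"
  proof (cases w)
    case Nil
    have "(\<lambda>N. F N (insert (j, []) B) \<xi>) \<longlonglongrightarrow> 1 / 2 * (\<Prod>b\<in>B. fac \<epsilon> \<xi> b)"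
    proof (rule tendsto_of_product_approx[OF _ tendsto_const insert.IH])
      fix N :: nat assume N: "N > 0"
      show "\<bar>F N (insert (j, []) B) \<xi> - 1 / 2 * F N B \<xi>\<bar> \<le> real (card B) / real N"
        using planted.freq_root[OF pl[OF N] S_ne[OF N] insert(1)] insert(3) Nil by simp
    qed
    then show ?thesis using Nil by (simp add: fac_def)
  next
    case (Cons g w')
    let ?K = "\<lambda>N. if \<xi> (j, w') = \<xi> (j, g # w') then N - m N else m N"
    have K: "(\<lambda>N. real (?K N) / real N) \<longlonglongrightarrow> fac \<epsilon> \<xi> (j, w)"
    proof (cases "\<xi> (j, w') = \<xi> (j, g # w')")
      case True
      have "\<forall>\<^sub>F N in sequentially. 1 - real (m N) / real N = real (N - m N) / real N"
        using eventually_gt_at_top[of 0]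
      proof eventually_elim
        case (elim N)
        then have "m N \<le> N" using planted.m[OF pl] by simp
        then show ?case using elim by (simp add: of_nat_diff diff_divide_distrib)
      qed
      moreover have "(\<lambda>N. 1 - real (m N) / real N) \<longlonglongrightarrow> 1 - \<epsilon>"
        by (intro tendsto_diff tendsto_const m_lim)
      ultimately have "(\<lambda>N. real (N - m N) / real N) \<longlonglongrightarrow> 1 - \<epsilon>"
        by (rule Lim_transform_eventually[rotated])
      then show ?thesis using True Cons by (simp add: fac_def)
    next
      case False
      then show ?thesis using m_lim Cons by (auto simp: fac_def)
    qed
    show ?thesis
    proof (rule tendsto_of_product_approx[OF _ K insert.IH])
      fix N :: nat assume N: "N > 0"
      show "\<bar>F N (insert (j, w) B) \<xi> - real (?K N) / real N * F N B \<xi>\<bar> \<le> (2 * real (card B)) / real N"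
        using planted.freq_extend[OF pl[OF N] S_ne[OF N] insert(1), of j w' g \<xi>] insert(2,3,4) Cons by simp
    qed
  qed
  then show ?case using finB insert(3) by simp
qed

end

section \<open>Variance of the local statistics\<close>

context planted
begin

definition occ :: "word set \<Rightarrow> (word \<Rightarrow> bool) \<Rightarrow> (nat \<Rightarrow> nat \<Rightarrow> nat) \<Rightarrow> real" where
  "occ B \<xi> s = card {v. v < 2 * N \<and> (\<forall>w\<in>B. x (act s w v) = \<xi> w)} / (2 * N)"

lemma sum_card_pairs:
  "(\<Sum>v\<in>{..<2 * N} \<times> {..<2 * N}. real (card {s \<in> S. Q s v}))
    = (\<Sum>s\<in>S. real (card {v \<in> {..<2 * N} \<times> {..<2 * N}. Q s v}))"
proof -
  have "(\<Sum>v\<in>{..<2 * N} \<times> {..<2 * N}. real (card {s \<in> S. Q s v}))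
      = (\<Sum>v\<in>{..<2 * N} \<times> {..<2 * N}. \<Sum>s\<in>S. if Q s v then 1 else 0)"
    using finite_S by (simp add: sum.If_cases Int_def)
  also have "\<dots> = (\<Sum>s\<in>S. \<Sum>v\<in>{..<2 * N} \<times> {..<2 * N}. if Q s v then 1 else 0)" by (rule sum.swap)
  also have "\<dots> = (\<Sum>s\<in>S. real (card {v \<in> {..<2 * N} \<times> {..<2 * N}. Q s v}))"
    by (simp add: sum.If_cases Int_def)
  finally show ?thesis .
qed

text \<open>Injective occurrences are among all occurrences. The variance estimate needs the mean
  only from below.\<close>

lemma freq_le_avg_occ:
  assumes S: "S \<noteq> {}"
  shows "freq ({False} \<times> B) (\<lambda>b. \<xi> (snd b)) \<le> avg S (occ B \<xi>)"
proof -
  let ?n = "2 * N" and ?V = "\<lambda>s. {v. v < 2 * N \<and> (\<forall>w\<in>B. x (act s w v) = \<xi> w)}"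
  have cS: "card S > 0" using S finite_S by (simp add: card_gt_0_iff)
  have "(\<Sum>v\<in>{..<?n} \<times> {..<?n}. real (card {s \<in> S. good x ({False} \<times> B) (\<lambda>b. \<xi> (snd b)) s v}))
      = (\<Sum>s\<in>S. real (card {v \<in> {..<?n} \<times> {..<?n}. good x ({False} \<times> B) (\<lambda>b. \<xi> (snd b)) s v}))"
    by (rule sum_card_pairs)
  also have "\<dots> \<le> (\<Sum>s\<in>S. real (card (?V s \<times> {..<?n})))"
  proof (rule sum_mono, rule of_nat_mono, rule card_mono)
    fix s
    show "finite (?V s \<times> {..<?n})" by simp
    show "{v \<in> {..<?n} \<times> {..<?n}. good x ({False} \<times> B) (\<lambda>b. \<xi> (snd b)) s v} \<subseteq> ?V s \<times> {..<?n}"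
    proof (rule subsetI)
      fix v assume v: "v \<in> {v \<in> {..<?n} \<times> {..<?n}. good x ({False} \<times> B) (\<lambda>b. \<xi> (snd b)) s v}"
      then have "x (pt s v (False, w)) = \<xi> w" if "w \<in> B" for w using that by (simp add: good_def)
      then show "v \<in> ?V s \<times> {..<?n}" using v by (cases v) (simp add: pt_def)
    qed
  qed
  also have "\<dots> = (\<Sum>s\<in>S. occ B \<xi> s) * (2 * real N)\<^sup>2"
    unfolding sum_distrib_right using N
    by (intro sum.cong) (simp_all add: occ_def card_cartesian_product power2_eq_square)
  finally show ?thesis unfolding freq_def avg_def using cS N by (simp add: field_simps)
qed

text \<open>The square counts pairs of roots that both see \<xi>. Such a pair is either injective,
  hence counted by \<open>freq\<close> for the doubled pattern, or non-injective; the share of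
  non-injective pairs is what the frequencies of all patterns leave of 1.\<close>

lemma avg_occ_square_le:
  assumes S: "S \<noteq> {}" and B: "finite B"
  shows "avg S (\<lambda>s. (occ B \<xi> s)\<^sup>2) \<le> freq (UNIV \<times> B) (\<lambda>b. \<xi> (snd b))
    + (1 - (\<Sum>\<eta>\<in>PiE (UNIV \<times> B) (\<lambda>_. UNIV). freq (UNIV \<times> B) \<eta>))"
proof -
  let ?n = "2 * N" and ?P = "{..<2 * N} \<times> {..<2 * N}" and ?V = "\<lambda>s. {v. v < 2 * N \<and> (\<forall>w\<in>B. x (act s w v) = \<xi> w)}"
  let ?D = "UNIV \<times> B :: (bool \<times> word) set"
  let ?d = "real (card S) * (2 * real N)\<^sup>2"
  have cS: "card S > 0" using S finite_S by (simp add: card_gt_0_iff)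
  have finD: "finite ?D" using B by simp
  have fr: "freq ?D \<eta> * ?d = (\<Sum>s\<in>S. real (card {v \<in> ?P. good x ?D \<eta> s v}))" for \<eta>
    unfolding freq_def sum_card_pairs using cS N by simp
  have inj: "(\<Sum>\<eta>\<in>PiE ?D (\<lambda>_. UNIV). real (card {v \<in> ?P. good x ?D \<eta> s v}))
      = real (card {v \<in> ?P. inj_on (pt s v) ?D})" for s
  proof -
    have "real (card {v \<in> ?P. inj_on (pt s v) ?D})
        = real (card (\<Union>\<eta>\<in>PiE ?D (\<lambda>_. UNIV). {v \<in> ?P. good x ?D \<eta> s v}))"
    proof (intro arg_cong[where f = "\<lambda>A. real (card A)"] set_eqI iffI)
      fix v assume v: "v \<in> {v \<in> ?P. inj_on (pt s v) ?D}"
      have "good x ?D (restrict (\<lambda>b. x (pt s v b)) ?D) s v" using v by (simp add: good_def)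
      then show "v \<in> (\<Union>\<eta>\<in>PiE ?D (\<lambda>_. UNIV). {v \<in> ?P. good x ?D \<eta> s v})"
        using v by (intro UN_I[of "restrict (\<lambda>b. x (pt s v b)) ?D"]) auto
    qed (auto simp: good_def)
    also have "\<dots> = (\<Sum>\<eta>\<in>PiE ?D (\<lambda>_. UNIV). real (card {v \<in> ?P. good x ?D \<eta> s v}))"
    proof (subst card_UN_disjoint)
      show "finite (PiE ?D (\<lambda>_. UNIV :: bool set))" using finD by (intro finite_PiE) auto
      show "\<forall>\<eta>\<in>PiE ?D (\<lambda>_. UNIV). \<forall>\<eta>'\<in>PiE ?D (\<lambda>_. UNIV). \<eta> \<noteq> \<eta>' \<longrightarrow>
          {v \<in> ?P. good x ?D \<eta> s v} \<inter> {v \<in> ?P. good x ?D \<eta>' s v} = {}"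
      proof (intro ballI impI)
        fix \<eta> \<eta>' :: "bool \<times> word \<Rightarrow> bool"
        assume e: "\<eta> \<in> PiE ?D (\<lambda>_. UNIV)" "\<eta>' \<in> PiE ?D (\<lambda>_. UNIV)" "\<eta> \<noteq> \<eta>'"
        have "\<exists>b\<in>?D. \<eta> b \<noteq> \<eta>' b" using PiE_ext[OF e(1,2)] e(3) by blast
        then show "{v \<in> ?P. good x ?D \<eta> s v} \<inter> {v \<in> ?P. good x ?D \<eta>' s v} = {}"
          by (auto simp: good_def)
      qed
    qed auto
    finally show ?thesis ..
  qed
  have key: "(real ?n * occ B \<xi> s)\<^sup>2 \<le> real (card {v \<in> ?P. good x ?D (\<lambda>b. \<xi> (snd b)) s v})
      + ((2 * real N)\<^sup>2 - real (card {v \<in> ?P. inj_on (pt s v) ?D}))" for s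
  proof -
    have "real ?n * occ B \<xi> s = real (card (?V s))" using N by (simp add: occ_def)
    then have sq: "(real ?n * occ B \<xi> s)\<^sup>2 = real (card (?V s \<times> ?V s))"
      by (simp add: card_cartesian_product power2_eq_square)
    have "card (?V s \<times> ?V s) \<le> card ({v \<in> ?P. good x ?D (\<lambda>b. \<xi> (snd b)) s v} \<union> (?P - {v \<in> ?P. inj_on (pt s v) ?D}))"
    proof (rule card_mono)
      show "?V s \<times> ?V s \<subseteq> {v \<in> ?P. good x ?D (\<lambda>b. \<xi> (snd b)) s v} \<union> (?P - {v \<in> ?P. inj_on (pt s v) ?D})"
      proof (rule subsetI)
        fix v assume v: "v \<in> ?V s \<times> ?V s"
        then have "x (pt s v b) = \<xi> (snd b)" if "b \<in> ?D" for b
          using that by (cases v; cases b) (simp add: pt_def)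
        moreover have "v \<in> ?P" using v by (cases v) simp
        ultimately show "v \<in> {v \<in> ?P. good x ?D (\<lambda>b. \<xi> (snd b)) s v} \<union> (?P - {v \<in> ?P. inj_on (pt s v) ?D})"
          by (simp add: good_def)
      qed
    qed simp
    then have le: "card (?V s \<times> ?V s) \<le> card {v \<in> ?P. good x ?D (\<lambda>b. \<xi> (snd b)) s v}
        + card (?P - {v \<in> ?P. inj_on (pt s v) ?D})"
      using card_Un_le order_trans by blast
    have sub: "card {v \<in> ?P. inj_on (pt s v) ?D} \<le> card ?P" by (rule card_mono) auto
    have "card (?P - {v \<in> ?P. inj_on (pt s v) ?D}) = card ?P - card {v \<in> ?P. inj_on (pt s v) ?D}"
      by (rule card_Diff_subset) auto
    then have "real (card (?P - {v \<in> ?P. inj_on (pt s v) ?D}))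
        = (2 * real N)\<^sup>2 - real (card {v \<in> ?P. inj_on (pt s v) ?D})"
      using sub by (simp add: of_nat_diff power2_eq_square card_cartesian_product)
    then show ?thesis unfolding sq using of_nat_mono[OF le, where 'a = real] by simp
  qed
  have "avg S (\<lambda>s. (occ B \<xi> s)\<^sup>2) * ?d = (\<Sum>s\<in>S. (real ?n * occ B \<xi> s)\<^sup>2)"
    using cS by (simp add: avg_def power_mult_distrib sum_distrib_left mult.commute)
  also have "\<dots> \<le> (\<Sum>s\<in>S. real (card {v \<in> ?P. good x ?D (\<lambda>b. \<xi> (snd b)) s v})
      + ((2 * real N)\<^sup>2 - real (card {v \<in> ?P. inj_on (pt s v) ?D})))"
    by (rule sum_mono) (rule key)
  also have "\<dots> = freq ?D (\<lambda>b. \<xi> (snd b)) * ?d + (?d - (\<Sum>\<eta>\<in>PiE ?D (\<lambda>_. UNIV). freq ?D \<eta>) * ?d)"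
    unfolding fr sum_distrib_right inj[symmetric]
    by (simp add: sum.distrib sum_subtractf sum.swap[of _ S "PiE ?D (\<lambda>_. UNIV)"])
  also have "\<dots> = (freq ?D (\<lambda>b. \<xi> (snd b)) + (1 - (\<Sum>\<eta>\<in>PiE ?D (\<lambda>_. UNIV). freq ?D \<eta>))) * ?d"
    by (simp add: algebra_simps)
  finally show ?thesis using cS N by (simp add: mult_le_cancel_right)
qed

end

context planted_seq
begin

text \<open>Expanding the square, an upper bound on the second moment and a lower bound on the first
  suffice, the latter because \<open>c\<close> is nonnegative. The limits combine to c^2 + (1 - 1) -
  2 c^2 + c^2 = 0.\<close>

lemma occ_variance_tendsto:
  fixes \<xi> :: "word \<Rightarrow> bool"
  assumes B: "finite B" "B \<subseteq> FG r" "tl_closed B"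
  defines "c \<equiv> Ising_cyl \<epsilon> \<xi> B"
  assumes c0: "c \<ge> 0"
  shows "(\<lambda>N. avg (SN N) (\<lambda>s. (planted.occ N (x N) B \<xi> s - c)\<^sup>2)) \<longlonglongrightarrow> 0"
proof -
  let ?D = "UNIV \<times> B :: (bool \<times> word) set" and ?\<xi> = "\<lambda>b :: bool \<times> word. \<xi> (snd b)"
  have f1: "forest r ({False} \<times> B)" and f2: "forest r ?D"
    using B by (auto simp: forest_def tl_closed_def)
  have nil: "[] \<in> B" using B(3) by (simp add: tl_closed_def)
  have D: "?D = {False} \<times> B \<union> {True} \<times> B" by (auto simp: UNIV_bool)
  have "(\<Prod>b\<in>?D. fac \<epsilon> ?\<xi> b) = (\<Prod>b\<in>{False} \<times> B. fac \<epsilon> ?\<xi> b) * (\<Prod>b\<in>{True} \<times> B. fac \<epsilon> ?\<xi> b)"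
    unfolding D using B(1) by (intro prod.union_disjoint) auto
  then have p2: "(\<Prod>b\<in>?D. fac \<epsilon> ?\<xi> b) = c\<^sup>2"
    unfolding prod_fac_Ising_cyl[OF B(1) nil] by (simp add: c_def power2_eq_square)
  define U where "U N = F N ?D ?\<xi> + (1 - (\<Sum>\<eta>\<in>PiE ?D (\<lambda>_. UNIV). F N ?D \<eta>)) - 2 * c * F N ({False} \<times> B) ?\<xi> + c\<^sup>2" for N
  have "(\<lambda>N. F N ?D ?\<xi>) \<longlonglongrightarrow> c\<^sup>2" using freq_tendsto[OF f2, of ?\<xi>] by (simp only: p2)
  moreover have "(\<lambda>N. \<Sum>\<eta>\<in>PiE ?D (\<lambda>_. UNIV). F N ?D \<eta>) \<longlonglongrightarrow> (\<Sum>\<eta>\<in>PiE ?D (\<lambda>_. UNIV). \<Prod>b\<in>?D. fac \<epsilon> \<eta> b)"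
    by (intro tendsto_sum freq_tendsto f2)
  moreover have "(\<lambda>N. F N ({False} \<times> B) ?\<xi>) \<longlonglongrightarrow> c"
    using freq_tendsto[OF f1, of ?\<xi>] by (simp only: prod_fac_Ising_cyl[OF B(1) nil] c_def)
  ultimately have "U \<longlonglongrightarrow> c\<^sup>2 + (1 - 1) - 2 * c * c + c\<^sup>2"
    unfolding U_def sum_prod_fac[OF f2] by (intro tendsto_intros)
  then have U: "U \<longlonglongrightarrow> 0" by (simp add: power2_eq_square)
  have "\<forall>\<^sub>F N in sequentially. norm (avg (SN N) (\<lambda>s. (planted.occ N (x N) B \<xi> s - c)\<^sup>2)) \<le> U N"
    using eventually_gt_at_top[of 0]
  proof eventually_elim
    case (elim N)
    interpret planted r N "m N" "x N" by (rule pl[OF elim])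
    have S: "S \<noteq> {}" by (rule S_ne[OF elim])
    have "avg S (\<lambda>s. (occ B \<xi> s - c)\<^sup>2) = avg S (\<lambda>s. (occ B \<xi> s)\<^sup>2 + c\<^sup>2 - 2 * c * occ B \<xi> s)"
      by (rule avg_cong) (simp add: power2_eq_square algebra_simps)
    also have "\<dots> = avg S (\<lambda>s. (occ B \<xi> s)\<^sup>2) + c\<^sup>2 - 2 * c * avg S (occ B \<xi>)"
      using finite_S S by (simp add: avg_diff avg_add avg_const avg_cmult)
    also have "\<dots> \<le> U N"
      using avg_occ_square_le[OF S B(1), of \<xi>] mult_left_mono[OF freq_le_avg_occ[OF S, of B \<xi>], of "2 * c"] c0
      unfolding U_def by simp
    finally have "avg S (\<lambda>s. (occ B \<xi> s - c)\<^sup>2) \<le> U N" .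
    moreover have "avg S (\<lambda>s. (occ B \<xi> s - c)\<^sup>2) \<ge> 0" by (simp add: avg_def sum_nonneg)
    ultimately show ?case by simp
  qed
  from Lim_null_comparison[OF this U] show ?thesis .
qed

text \<open>Chebyshev, summed over the finitely many patterns. Half of \<open>S\<close> is enough,
  as a constant factor does not affect exponential rates.\<close>

lemma typical_local_statistics:
  assumes \<epsilon>: "0 \<le> \<epsilon>" "\<epsilon> \<le> 1" and B: "finite B" "B \<subseteq> FG r" "tl_closed B" and \<delta>: "\<delta> > 0"
  shows "\<forall>\<^sub>F N in sequentially. real (card {s \<in> SN N. \<forall>\<xi>\<in>PiE B (\<lambda>_. UNIV).
      \<bar>planted.occ N (x N) B \<xi> s - Ising_cyl \<epsilon> \<xi> B\<bar> < \<delta>}) \<ge> card (SN N) / 2"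
proof -
  let ?U = "PiE B (\<lambda>_. UNIV :: bool set)"
  have finU: "finite ?U" using B(1) by (intro finite_PiE) auto
  have c0: "Ising_cyl \<epsilon> \<xi> B \<ge> 0" for \<xi>
    unfolding Ising_cyl_def using \<epsilon> by (intro mult_nonneg_nonneg prod_nonneg) auto
  define W where "W N = (\<Sum>\<xi>\<in>?U. avg (SN N) (\<lambda>s. (planted.occ N (x N) B \<xi> s - Ising_cyl \<epsilon> \<xi> B)\<^sup>2))" for N
  have "W \<longlonglongrightarrow> (\<Sum>\<xi>\<in>?U. 0)"
    unfolding W_def by (intro tendsto_sum occ_variance_tendsto B c0)
  then have "\<forall>\<^sub>F N in sequentially. W N < \<delta>\<^sup>2 / 2"
    using \<delta> by (intro order_tendstoD(2)) auto
  then show ?thesis using eventually_gt_at_top[of 0]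
  proof eventually_elim
    case (elim N)
    interpret planted r N "m N" "x N" by (rule pl[OF elim(2)])
    have S: "S \<noteq> {}" by (rule S_ne[OF elim(2)])
    have cS: "card S > 0" using S finite_S by (simp add: card_gt_0_iff)
    let ?G = "{s \<in> S. \<forall>\<xi>\<in>?U. \<bar>occ B \<xi> s - Ising_cyl \<epsilon> \<xi> B\<bar> < \<delta>}"
    let ?v = "\<lambda>s. \<Sum>\<xi>\<in>?U. (occ B \<xi> s - Ising_cyl \<epsilon> \<xi> B)\<^sup>2"
    have "W N = (\<Sum>s\<in>S. ?v s) / card S"
      unfolding W_def avg_def sum_divide_distrib[symmetric] by (subst sum.swap) simp
    then have "(\<Sum>s\<in>S. ?v s) \<le> \<delta>\<^sup>2 / 2 * card S"
      using elim(1) cS by (simp add: pos_divide_less_eq less_imp_le)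
    moreover have "(\<Sum>s\<in>S - ?G. \<delta>\<^sup>2) \<le> (\<Sum>s\<in>S - ?G. ?v s)"
    proof (rule sum_mono)
      fix s assume "s \<in> S - ?G"
      then obtain \<xi> where \<xi>: "\<xi> \<in> ?U" "\<bar>occ B \<xi> s - Ising_cyl \<epsilon> \<xi> B\<bar> \<ge> \<delta>" by (auto simp: not_less)
      have "\<delta>\<^sup>2 \<le> (occ B \<xi> s - Ising_cyl \<epsilon> \<xi> B)\<^sup>2" using power_mono[OF \<xi>(2), of 2] \<delta> by simp
      also have "\<dots> \<le> ?v s" by (rule member_le_sum[OF \<xi>(1)]) (use finU in auto)
      finally show "\<delta>\<^sup>2 \<le> ?v s" .
    qed
    moreover have "(\<Sum>s\<in>S - ?G. ?v s) \<le> (\<Sum>s\<in>S. ?v s)"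
      by (intro sum_mono2 finite_S) (auto intro!: sum_nonneg)
    moreover have "(\<Sum>s\<in>S - ?G. \<delta>\<^sup>2) = real (card (S - ?G)) * \<delta>\<^sup>2" by simp
    moreover have "\<delta>\<^sup>2 / 2 * card S = (card S / 2) * \<delta>\<^sup>2" by simp
    ultimately have "real (card (S - ?G)) * \<delta>\<^sup>2 \<le> (card S / 2) * \<delta>\<^sup>2"
      by (metis (no_types, lifting) order_trans)
    then have "real (card (S - ?G)) \<le> card S / 2"
      using \<delta> by (simp only: mult_le_cancel_right) auto
    moreover have "card (S - ?G) = card S - card ?G"
      using finite_S by (intro card_Diff_subset) auto
    moreover have "card ?G \<le> card S" by (intro card_mono finite_S) auto
    ultimately show ?case by (simp add: of_nat_diff)
  qed
qed

end

section \<open>Counting labelings\<close>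

text \<open>The type class of \<open>z\<close>: all labelings with the same letter counts.
  Restriction to functions on the vertex set makes it finite.\<close>

definition rearr :: "nat \<Rightarrow> (nat \<Rightarrow> 'b) \<Rightarrow> (nat \<Rightarrow> 'b) set" where
  "rearr n z = {y \<in> PiE {..<n} (\<lambda>_. UNIV). \<forall>a. card {v. v < n \<and> y v = a} = card {v. v < n \<and> z v = a}}"

lemma count_image_mset_lessThan: "count (image_mset y (mset_set {..<n :: nat})) a = card {v. v < n \<and> y v = a}"
proof -
  have "count (image_mset y (mset_set {..<n})) a = (\<Sum>v\<in>y -` {a} \<inter> {..<n}. count (mset_set {..<n}) v)"
    by (simp add: count_image_mset)
  also have "\<dots> = (\<Sum>v\<in>y -` {a} \<inter> {..<n}. 1)" by (rule sum.cong) auto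
  also have "\<dots> = card (y -` {a} \<inter> {..<n})" by simp
  also have "y -` {a} \<inter> {..<n} = {v. v < n \<and> y v = a}" by auto
  finally show ?thesis .
qed

lemma rearr_iff_mset:
  "y \<in> rearr n z \<longleftrightarrow> y \<in> PiE {..<n} (\<lambda>_. UNIV) \<and> image_mset y (mset_set {..<n}) = image_mset z (mset_set {..<n})"
  unfolding rearr_def multiset_eq_iff count_image_mset_lessThan by simp

lemma finite_PiE_lessThan: "finite (PiE {..<n :: nat} (\<lambda>_. UNIV :: 'b::finite set))"
  by (intro finite_PiE) auto

lemma finite_rearr: "finite (rearr n (z :: nat \<Rightarrow> 'b::finite))"
  by (rule finite_subset[OF _ finite_PiE_lessThan[of n]]) (auto simp: rearr_def)

lemma permute_in_rearr:
  assumes p: "p permutes {..<n}"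
  shows "restrict (\<lambda>v. z (p v)) {..<n} \<in> rearr n z"
proof -
  have "image_mset (restrict (\<lambda>v. z (p v)) {..<n}) (mset_set {..<n}) = image_mset (\<lambda>v. z (p v)) (mset_set {..<n})"
    by (rule image_mset_cong) simp
  also have "\<dots> = image_mset z (image_mset p (mset_set {..<n}))" by (simp add: multiset.map_comp o_def)
  also have "image_mset p (mset_set {..<n}) = mset_set {..<n}"
    using permutes_image[OF p] permutes_inj[OF p]
    by (subst image_mset_mset_set) (auto intro: inj_on_subset)
  finally have e: "image_mset (restrict (\<lambda>v. z (p v)) {..<n}) (mset_set {..<n}) = image_mset z (mset_set {..<n})" .
  show ?thesis unfolding rearr_iff_mset by (rule conjI, simp, rule e)
qed

lemma rearr_permute:
  assumes "y \<in> rearr n z"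
  obtains p where "p permutes {..<n}" "restrict (\<lambda>v. z (p v)) {..<n} = y"
proof -
  have m: "image_mset y (mset_set {..<n}) = image_mset z (mset_set {..<n})" and y: "y \<in> PiE {..<n} (\<lambda>_. UNIV)"
    using assms by (auto simp: rearr_iff_mset)
  obtain p where p: "p permutes {..<n}" "\<forall>v\<in>{..<n}. y v = z (p v)"
    using image_mset_eq_implies_permutes[OF finite_lessThan m] by metis
  have "restrict (\<lambda>v. z (p v)) {..<n} = y"
    using p(2) y by (intro ext) (auto simp: PiE_iff extensional_def)
  with p(1) show ?thesis by (rule that)
qed

text \<open>For a uniform permutation p the labeling z o p is uniform among the rearrangements of z.\<close>
lemma card_permutes_rearr:
  fixes z :: "nat \<Rightarrow> 'b::finite"
  shows "card {p. p permutes {..<n} \<and> restrict (\<lambda>v. z (p v)) {..<n} \<in> Y} * card (rearr n z)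
    = fact n * card (rearr n z \<inter> Y)"
proof -
  let ?P = "{p. p permutes {..<n}}" and ?\<phi> = "\<lambda>p. restrict (\<lambda>v. z (p v)) {..<n}"
  \<comment> \<open>The order of the stabilizer of \<open>z\<close> under permutation of the
    vertices. Every fibre of p \<mapsto> z o p is a translate of it by some \<open>p0\<close>, so
    all fibres have this size.\<close>
  define K where "K = card {q. q permutes {..<n} \<and> ?\<phi> q = ?\<phi> id}"
  have finP: "finite ?P" by (rule finite_permutations) simp
  have fiber: "card {p. p permutes {..<n} \<and> ?\<phi> p = y} = K" if y: "y \<in> rearr n z" for y
  proof -
    obtain p0 where p0: "p0 permutes {..<n}" "?\<phi> p0 = y" using rearr_permute[OF y] .
    have less: "p0 v < n \<longleftrightarrow> v < n" "inv p0 v < n \<longleftrightarrow> v < n" for v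
      using permutes_in_image[OF p0(1), of v] permutes_in_image[OF permutes_inv[OF p0(1)], of v] by simp_all
    have \<phi>_eq: "?\<phi> p = ?\<phi> q \<longleftrightarrow> (\<forall>v<n. z (p v) = z (q v))" for p q
      by (auto simp: restrict_def fun_eq_iff)
    have "bij_betw (\<lambda>q. q \<circ> p0) {q. q permutes {..<n} \<and> ?\<phi> q = ?\<phi> id} {p. p permutes {..<n} \<and> ?\<phi> p = y}"
    proof (rule bij_betw_byWitness[where f' = "\<lambda>p. p \<circ> inv p0"])
      have i1: "p0 \<circ> inv p0 = id" "inv p0 \<circ> p0 = id"
        using permutes_inv_o[OF p0(1)] by auto
      show "\<forall>q\<in>{q. q permutes {..<n} \<and> ?\<phi> q = ?\<phi> id}. (q \<circ> p0) \<circ> inv p0 = q"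
        by (simp only: comp_assoc i1 comp_id) simp
      show "\<forall>p\<in>{p. p permutes {..<n} \<and> ?\<phi> p = y}. (p \<circ> inv p0) \<circ> p0 = p"
        by (simp only: comp_assoc i1 comp_id) simp
      show "(\<lambda>q. q \<circ> p0) ` {q. q permutes {..<n} \<and> ?\<phi> q = ?\<phi> id} \<subseteq> {p. p permutes {..<n} \<and> ?\<phi> p = y}"
      proof (rule image_subsetI)
        fix q assume q: "q \<in> {q. q permutes {..<n} \<and> ?\<phi> q = ?\<phi> id}"
        then have zq: "\<And>v. v < n \<Longrightarrow> z (q v) = z v" unfolding \<phi>_eq by simp
        have "?\<phi> (q \<circ> p0) = ?\<phi> p0" unfolding \<phi>_eq using less(1) zq by simp
        then show "q \<circ> p0 \<in> {p. p permutes {..<n} \<and> ?\<phi> p = y}"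
          using q p0 permutes_compose[OF p0(1), of q] by simp
      qed
      show "(\<lambda>p. p \<circ> inv p0) ` {p. p permutes {..<n} \<and> ?\<phi> p = y} \<subseteq> {q. q permutes {..<n} \<and> ?\<phi> q = ?\<phi> id}"
      proof (rule image_subsetI)
        fix p assume p: "p \<in> {p. p permutes {..<n} \<and> ?\<phi> p = y}"
        then have zp: "\<And>v. v < n \<Longrightarrow> z (p v) = z (p0 v)" using \<phi>_eq[of p p0] p0(2) by simp
        have "?\<phi> (p \<circ> inv p0) = ?\<phi> id"
          unfolding \<phi>_eq using less(2) zp permutes_inverses(1)[OF p0(1)] by simp
        then show "p \<circ> inv p0 \<in> {q. q permutes {..<n} \<and> ?\<phi> q = ?\<phi> id}"
          using p permutes_compose[OF permutes_inv[OF p0(1)], of p] by simp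
      qed
    qed
    then show ?thesis unfolding K_def by (rule bij_betw_same_card[symmetric])
  qed
  have cnt: "card {p. p permutes {..<n} \<and> ?\<phi> p \<in> Y} = K * card (rearr n z \<inter> Y)" for Y
  proof -
    have "{p. p permutes {..<n} \<and> ?\<phi> p \<in> Y} = (\<Union>y\<in>rearr n z \<inter> Y. {p. p permutes {..<n} \<and> ?\<phi> p = y})"
      using permute_in_rearr by blast
    also have "card \<dots> = (\<Sum>y\<in>rearr n z \<inter> Y. card {p. p permutes {..<n} \<and> ?\<phi> p = y})"
    proof (rule card_UN_disjoint)
      show "finite (rearr n z \<inter> Y)" using finite_rearr by blast
      show "\<forall>y\<in>rearr n z \<inter> Y. finite {p. p permutes {..<n} \<and> ?\<phi> p = y}"
        using finP by simp
      show "\<forall>y\<in>rearr n z \<inter> Y. \<forall>y'\<in>rearr n z \<inter> Y. y \<noteq> y' \<longrightarrow>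
          {p. p permutes {..<n} \<and> ?\<phi> p = y} \<inter> {p. p permutes {..<n} \<and> ?\<phi> p = y'} = {}"
        by auto
    qed
    also have "\<dots> = K * card (rearr n z \<inter> Y)" using fiber by simp
    finally show ?thesis .
  qed
  have "fact n = K * card (rearr n z)"
    using cnt[of UNIV] card_permutations[OF refl finite_lessThan, of n] by simp
  then show ?thesis unfolding cnt by simp
qed

text \<open>The multinomial coefficient, obtained by listing a labeling as a permutation of its
  multiset of letters.\<close>

lemma card_rearr_fact:
  fixes z :: "nat \<Rightarrow> 'b::finite"
  shows "card (rearr n z) * (\<Prod>a\<in>UNIV. fact (card {v. v < n \<and> z v = a})) = fact n"
proof -
  let ?M = "image_mset z (mset_set {..<n})"
  have mset_map: "mset (map y [0..<n]) = image_mset y (mset_set {..<n})" for y :: "nat \<Rightarrow> 'b"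
    by (simp add: atLeast0LessThan)
  have "bij_betw (\<lambda>y. map y [0..<n]) (rearr n z) (permutations_of_multiset ?M)"
  proof (rule bij_betw_byWitness[where f' = "\<lambda>l. restrict (\<lambda>i. l ! i) {..<n}"])
    show "\<forall>y\<in>rearr n z. restrict (\<lambda>i. map y [0..<n] ! i) {..<n} = y"
      by (auto simp: rearr_def PiE_iff extensional_def restrict_def fun_eq_iff)
    have len: "length l = n" if "l \<in> permutations_of_multiset ?M" for l
    proof -
      have "size (mset l) = size ?M" using that by (simp only: permutations_of_multisetD)
      then show ?thesis by simp
    qed
    have map_nth: "map (restrict (\<lambda>i. l ! i) {..<n}) [0..<n] = l" if "length l = n" for l :: "'b list"
      using that by (intro nth_equalityI) auto
    show "\<forall>l\<in>permutations_of_multiset ?M. map (restrict (\<lambda>i. l ! i) {..<n}) [0..<n] = l"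
      using len map_nth by blast
    show "(\<lambda>y. map y [0..<n]) ` rearr n z \<subseteq> permutations_of_multiset ?M"
    proof (rule image_subsetI)
      fix y assume "y \<in> rearr n z"
      then have "mset (map y [0..<n]) = ?M" unfolding mset_map rearr_iff_mset by simp
      then show "map y [0..<n] \<in> permutations_of_multiset ?M" by (rule permutations_of_multisetI)
    qed
    show "(\<lambda>l. restrict (\<lambda>i. l ! i) {..<n}) ` permutations_of_multiset ?M \<subseteq> rearr n z"
    proof (rule image_subsetI)
      fix l assume l: "l \<in> permutations_of_multiset ?M"
      have "image_mset (restrict (\<lambda>i. l ! i) {..<n}) (mset_set {..<n}) = mset l"
        unfolding mset_map[symmetric] map_nth[OF len[OF l]] ..
      then show "restrict (\<lambda>i. l ! i) {..<n} \<in> rearr n z"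
        unfolding rearr_iff_mset using permutations_of_multisetD[OF l] by simp
    qed
  qed
  then have "card (rearr n z) = card (permutations_of_multiset ?M)" by (rule bij_betw_same_card)
  moreover have "(\<Prod>a\<in>set_mset ?M. fact (count ?M a)) = (\<Prod>a\<in>UNIV. fact (count ?M a) :: nat)"
  proof (rule prod.mono_neutral_left)
    show "\<forall>i\<in>UNIV - set_mset ?M. fact (count ?M i) = (1 :: nat)"
    proof
      fix i assume "i \<in> UNIV - set_mset ?M"
      then have "i \<notin># ?M" by simp
      then have "count ?M i = 0" by (rule iffD2[OF count_eq_zero_iff])
      then show "fact (count ?M i) = (1 :: nat)" by simp
    qed
  qed auto
  ultimately show ?thesis
    using card_permutations_of_multiset_aux[of ?M] unfolding count_image_mset_lessThan by simp
qed

lemma card_rearr_pos: "card (rearr n (z :: nat \<Rightarrow> 'b::finite)) > 0"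
proof (rule ccontr)
  assume "\<not> card (rearr n z) > 0"
  then have "fact n = (0 :: nat)" using card_rearr_fact[of n z] by simp
  then show False by simp
qed

text \<open>n^n / n! is a single term of the series of exp n.\<close>

lemma ln_fact_lower:
  assumes "n > 0"
  shows "ln (fact n) \<ge> n * ln n - (n :: nat)"
proof -
  have "real n ^ n / fact n \<le> exp (real n)"
  proof -
    have s: "(\<lambda>k. inverse (fact k) * real n ^ k) sums exp (real n)"
      using exp_converges[of "real n"] by (simp add: scaleR_conv_of_real divide_inverse mult.commute)
    have "(\<Sum>k\<in>{n}. inverse (fact k) * real n ^ k) \<le> (\<Sum>k. inverse (fact k) * real n ^ k)"
      by (rule sum_le_suminf[OF sums_summable[OF s]]) auto
    then show ?thesis using sums_unique[OF s] by (simp add: divide_inverse mult.commute)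
  qed
  then have "ln (real n ^ n / fact n) \<le> ln (exp (real n))" using assms by (intro ln_mono) auto
  then show ?thesis using assms by (simp add: ln_div ln_realpow)
qed

text \<open>The argument k + 1 in place of k makes the bound hold from k = 0 on, so empty classes
  need no separate treatment, at a cost that is only logarithmic.\<close>

lemma ln_fact_upper: "ln (fact k) \<le> (real k + 1) * ln (real k + 1) - real k"
proof (induction k)
  case (Suc k)
  define a where "a = real k + 1"
  have a: "a \<ge> 1" by (simp add: a_def)
  have "ln (fact (Suc k)) = ln a + ln (fact k)"
    using a by (simp add: a_def ln_mult add.commute)
  also have "\<dots> \<le> ln a + (a * ln a - (a - 1))" using Suc by (simp add: a_def)
  also have "\<dots> \<le> (a + 1) * ln (a + 1) - a"
  proof -
    have "ln (a / (a + 1)) \<le> a / (a + 1) - 1" using a by (intro ln_le_minus_one) auto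
    then have "ln a - ln (a + 1) \<le> - 1 / (a + 1)" using a by (simp add: ln_div field_simps)
    then have "(a + 1) * (ln a - ln (a + 1)) \<le> (a + 1) * (- 1 / (a + 1))" using a by (intro mult_left_mono) auto
    then show ?thesis using a by (simp add: algebra_simps)
  qed
  finally show ?case by (simp add: a_def add.commute)
qed simp

lemma sum_card_classes: "(\<Sum>a\<in>UNIV. card {v. v < n \<and> z v = (a :: 'b::finite)}) = n"
proof -
  have "(\<Sum>a\<in>UNIV. card {v. v < n \<and> z v = a}) = card (\<Union>a\<in>UNIV. {v. v < n \<and> z v = a})"
    by (rule card_UN_disjoint[symmetric]) auto
  also have "(\<Union>a\<in>UNIV. {v. v < n \<and> z v = a}) = {..<n}" by auto
  finally show ?thesis by simp
qed

text \<open>The linear terms of the factorial bounds cancel because the class sizes add up to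
  \<open>n\<close>; what remains is \<open>n\<close> times the entropy of the type, up to
  logarithms.\<close>

lemma ln_card_rearr_lower:
  fixes z :: "nat \<Rightarrow> 'b::finite"
  assumes n: "n > 0"
  defines "N \<equiv> \<lambda>a. real (card {v. v < n \<and> z v = a})"
  shows "ln (card (rearr n z)) \<ge> n * ln n - (\<Sum>a\<in>UNIV. (N a + 1) * ln (N a + 1))"
proof -
  let ?f = "\<Prod>a\<in>UNIV. fact (card {v. v < n \<and> z v = a}) :: real"
  have "real (card (rearr n z) * (\<Prod>a\<in>UNIV. fact (card {v. v < n \<and> z v = a}))) = real (fact n)"
    unfolding card_rearr_fact ..
  then have eq: "real (card (rearr n z)) * ?f = fact n" by simp
  have f: "?f > 0" by (rule prod_pos) simp
  have c: "real (card (rearr n z)) > 0"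
    using eq f by (metis fact_gt_zero zero_less_mult_pos2)
  have "ln (card (rearr n z)) + ln ?f = ln (fact n)"
    unfolding eq[symmetric] using c f by (simp add: ln_mult)
  moreover have "ln ?f = (\<Sum>a\<in>UNIV. ln (fact (card {v. v < n \<and> z v = a})))"
    by (rule ln_prod) auto
  moreover have "(\<Sum>a\<in>UNIV. ln (fact (card {v. v < n \<and> z v = a}))) \<le> (\<Sum>a\<in>UNIV. (N a + 1) * ln (N a + 1) - N a)"
    unfolding N_def by (rule sum_mono) (rule ln_fact_upper)
  moreover have "(\<Sum>a\<in>UNIV. (N a + 1) * ln (N a + 1) - N a) = (\<Sum>a\<in>UNIV. (N a + 1) * ln (N a + 1)) - n"
  proof -
    have "(\<Sum>a\<in>UNIV. N a) = n" unfolding N_def of_nat_sum[symmetric] sum_card_classes ..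
    then show ?thesis by (simp add: sum_subtractf)
  qed
  ultimately show ?thesis using ln_fact_lower[OF n] by linarith
qed

lemma ln_binomial_lower:
  assumes "m \<le> N" "N > 0"
  shows "ln (N choose m) \<ge> N * ln N - (real m + 1) * ln (real m + 1) - (real (N - m) + 1) * ln (real (N - m) + 1)"
proof -
  have "real (N choose m) = fact N / (fact m * fact (N - m))" by (rule binomial_fact[OF assms(1)])
  then have "ln (N choose m) = ln (fact N) - (ln (fact m) + ln (fact (N - m)))"
    by (simp add: ln_div ln_mult)
  then show ?thesis
    using ln_fact_lower[OF assms(2)] ln_fact_upper[of m] ln_fact_upper[of "N - m"] assms(1)
    by (simp add: of_nat_diff)
qed

text \<open>Change of measure: let the letters \<open>y v\<close> be independent with laws
  \<open>q (z v)\<close>. Each member of \<open>Y\<close> then has probability at least exp (- L),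
  and the total is at most 1.\<close>

lemma card_labelings_le_exp:
  fixes q :: "'b::finite \<Rightarrow> 'b \<Rightarrow> real" and n :: nat and z :: "nat \<Rightarrow> 'b"
  assumes q: "\<And>a b. q a b > 0" "\<And>a. (\<Sum>b\<in>UNIV. q a b) = 1"
    and Y: "\<And>y. y \<in> Y \<Longrightarrow> y \<in> PiE {..<n} (\<lambda>_. UNIV)"
      "\<And>y. y \<in> Y \<Longrightarrow> (\<Sum>v<n. ln (q (z v) (y v))) \<ge> - L"
  shows "card Y \<le> exp L"
proof -
  have fin: "finite Y" using finite_subset[OF _ finite_PiE_lessThan[of n]] Y(1) by blast
  have "card Y * exp (- L) = (\<Sum>y\<in>Y. exp (- L))" by simp
  also have "\<dots> \<le> (\<Sum>y\<in>Y. \<Prod>v<n. q (z v) (y v))"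
  proof (rule sum_mono)
    fix y assume "y \<in> Y"
    then have "exp (- L) \<le> exp (\<Sum>v<n. ln (q (z v) (y v)))" using Y(2) by simp
    also have "\<dots> = (\<Prod>v<n. q (z v) (y v))" by (subst exp_sum) (simp_all add: q(1))
    finally show "exp (- L) \<le> (\<Prod>v<n. q (z v) (y v))" .
  qed
  also have "\<dots> \<le> (\<Sum>y\<in>PiE {..<n} (\<lambda>_. UNIV). \<Prod>v<n. q (z v) (y v))"
  proof (rule sum_mono2[OF finite_PiE_lessThan])
    show "Y \<subseteq> PiE {..<n} (\<lambda>_. UNIV)" using Y(1) by auto
    show "0 \<le> (\<Prod>v<n. q (z v) (y v))" for y
      by (rule prod_nonneg) (simp add: q(1)[THEN less_imp_le])
  qed
  also have "\<dots> = (\<Prod>v<n. \<Sum>b\<in>UNIV. q (z v) b)"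
    by (rule prod_sum_PiE[symmetric]) auto
  also have "\<dots> = 1" by (simp add: q(2))
  finally show ?thesis by (simp add: exp_minus field_simps)
qed

lemma card_tuples_power:
  fixes Q :: "(nat \<Rightarrow> nat) \<Rightarrow> bool"
  shows "card {s \<in> perm_tuples r n. \<forall>i<r. Q (s i)} = card {p. p permutes {..<n} \<and> Q p} ^ r"
proof -
  have "{s \<in> perm_tuples r n. \<forall>i<r. Q (s i)} = PiE {..<r} (\<lambda>_. {p. p permutes {..<n} \<and> Q p})"
    unfolding perm_tuples_def by (intro set_eqI) (simp add: PiE_iff Ball_def, metis)
  then show ?thesis by (simp add: card_PiE)
qed

lemma card_perm_tuples: "card (perm_tuples r n) = fact n ^ r"
  unfolding perm_tuples_def by (simp add: card_PiE card_permutations[OF refl])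

text \<open>The generators are independent, and for each of them the pulled-back labeling is uniform
  on the type class of \<open>z\<close>; hence an \<open>r\<close>-th power of a ratio of
  counts.\<close>

lemma tuples_fraction:
  fixes z :: "nat \<Rightarrow> 'b::finite"
  shows "real (card {s \<in> perm_tuples r n. \<forall>i<r. restrict (\<lambda>v. z (s i v)) {..<n} \<in> Y}) / card (perm_tuples r n)
    = (card (rearr n z \<inter> Y) / card (rearr n z)) ^ r"
proof -
  have ne: "card (rearr n z) > 0" by (rule card_rearr_pos)
  have "real (card {p. p permutes {..<n} \<and> restrict (\<lambda>v. z (p v)) {..<n} \<in> Y} * card (rearr n z))
      = real (fact n * card (rearr n z \<inter> Y))"
    by (simp only: card_permutes_rearr)
  then have "real (card {p. p permutes {..<n} \<and> restrict (\<lambda>v. z (p v)) {..<n} \<in> Y}) / fact n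
      = card (rearr n z \<inter> Y) / card (rearr n z)"
    using ne by (simp add: field_simps)
  then show ?thesis
    unfolding card_tuples_power[of r n "\<lambda>p. restrict (\<lambda>v. z (p v)) {..<n} \<in> Y"] card_perm_tuples
    by (simp only: of_nat_power of_nat_fact power_divide[symmetric])
qed

text \<open>Flipping \<open>m\<close> vertices of each class keeps the labeling balanced and moves
  exactly \<open>m\<close> vertices out of the class True; the two choices are independent.\<close>

lemma balanced_extension_count:
  assumes x: "card {v. v < 2 * N \<and> x v} = N"
  shows "card (rearr (2 * N) x \<inter> {y. card {v. v < 2 * N \<and> x v \<and> \<not> y v} = m}) \<ge> (N choose m)\<^sup>2"
proof -
  let ?T = "{v. v < 2 * N \<and> x v}" and ?F = "{v. v < 2 * N \<and> \<not> x v}"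
  have TF: "?T \<inter> ?F = {}" "?T \<union> ?F = {..<2 * N}" by auto
  have F: "card ?F = N"
  proof -
    have "card (?T \<union> ?F) = card ?T + card ?F" by (rule card_Un_disjoint) auto
    then show ?thesis unfolding TF(2) x by simp
  qed
  let ?A = "{S. S \<subseteq> ?T \<and> card S = m}" and ?B = "{S. S \<subseteq> ?F \<and> card S = m}"
  let ?f = "\<lambda>(S, S'). restrict (\<lambda>v. v \<in> (?T - S) \<union> S') {..<2 * N}"
  have cA: "card ?A = N choose m" "card ?B = N choose m"
    using n_subsets[of ?T m] n_subsets[of ?F m] x F by simp_all
  have inj: "inj_on ?f (?A \<times> ?B)"
  proof (rule inj_onI, clarify)
    fix S1 S1' S2 S2' :: "nat set"
    assume h: "S1 \<subseteq> ?T" "S1' \<subseteq> ?F" "S2 \<subseteq> ?T" "S2' \<subseteq> ?F"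
      "restrict (\<lambda>v. v \<in> (?T - S1) \<union> S1') {..<2 * N} = restrict (\<lambda>v. v \<in> (?T - S2) \<union> S2') {..<2 * N}"
    have e: "v \<in> (?T - S1) \<union> S1' \<longleftrightarrow> v \<in> (?T - S2) \<union> S2'" if "v < 2 * N" for v
      using fun_cong[OF h(5), of v] that by simp
    have "v \<in> S1 \<longleftrightarrow> v \<in> S2" for v using e[of v] h(1-4) by blast
    moreover have "v \<in> S1' \<longleftrightarrow> v \<in> S2'" for v using e[of v] h(1-4) by blast
    ultimately show "S1 = S2 \<and> S1' = S2'" by blast
  qed
  have img: "?f ` (?A \<times> ?B) \<subseteq> rearr (2 * N) x \<inter> {y. card {v. v < 2 * N \<and> x v \<and> \<not> y v} = m}"
  proof (rule image_subsetI)
    fix z assume "z \<in> ?A \<times> ?B"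
    then obtain S S' where z: "z = (S, S')" and S: "S \<subseteq> ?T" "card S = m" "S' \<subseteq> ?F" "card S' = m" by auto
    let ?y = "restrict (\<lambda>v. v \<in> (?T - S) \<union> S') {..<2 * N}"
    have finS: "finite S" "finite S'" using S by (auto intro: finite_subset)
    have mN: "m \<le> N" using card_mono[of ?T S] S x by simp
    have y1: "{v. v < 2 * N \<and> ?y v = True} = (?T - S) \<union> S'" using S by auto
    have cT: "card ((?T - S) \<union> S') = N"
    proof -
      have "card ((?T - S) \<union> S') = card (?T - S) + card S'"
        using S finS by (intro card_Un_disjoint) auto
      also have "card (?T - S) = N - m" using S finS x by (subst card_Diff_subset) auto
      finally show ?thesis using S mN by simp
    qed
    have y2: "{v. v < 2 * N \<and> ?y v = False} = {..<2 * N} - ((?T - S) \<union> S')" by auto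
    have "(?T - S) \<union> S' \<subseteq> {..<2 * N}" using S by auto
    then have cF: "card ({..<2 * N} - ((?T - S) \<union> S')) = N"
      using finS cT by (subst card_Diff_subset) auto
    have "card {v. v < 2 * N \<and> ?y v = a} = card {v. v < 2 * N \<and> x v = a}" for a
    proof (cases a)
      case True
      then show ?thesis using y1 cT x by simp
    next
      case False
      then show ?thesis using y2 cF F by simp
    qed
    then have "?y \<in> rearr (2 * N) x" by (simp add: rearr_def)
    moreover have "{v. v < 2 * N \<and> x v \<and> \<not> ?y v} = S" using S by auto
    ultimately show "?f z \<in> rearr (2 * N) x \<inter> {y. card {v. v < 2 * N \<and> x v \<and> \<not> y v} = m}"
      using S(2) z by simp
  qed
  have "(N choose m)\<^sup>2 = card (?f ` (?A \<times> ?B))"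
    using card_image[OF inj] cA by (simp add: card_cartesian_product power2_eq_square)
  also have "\<dots> \<le> card (rearr (2 * N) x \<inter> {y. card {v. v < 2 * N \<and> x v \<and> \<not> y v} = m})"
    using img finite_rearr by (intro card_mono) auto
  finally show ?thesis .
qed

lemma card_balanced_labelings:
  fixes n :: nat
  shows "card {y \<in> PiE {..<n} (\<lambda>_. UNIV). card {v. v < n \<and> y v} = k} = n choose k"
proof -
  have "bij_betw (\<lambda>y. {v. v < n \<and> y v}) {y \<in> PiE {..<n} (\<lambda>_. UNIV). card {v. v < n \<and> y v} = k}
      {S. S \<subseteq> {..<n} \<and> card S = k}"
  proof (rule bij_betw_byWitness[where f' = "\<lambda>S. restrict (\<lambda>v. v \<in> S) {..<n}"])
    show "\<forall>y\<in>{y \<in> PiE {..<n} (\<lambda>_. UNIV). card {v. v < n \<and> y v} = k}.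
        restrict (\<lambda>v. v \<in> {v. v < n \<and> y v}) {..<n} = y"
      by (auto simp: PiE_iff extensional_def restrict_def fun_eq_iff)
    have e: "{v. v < n \<and> restrict (\<lambda>v. v \<in> S) {..<n} v} = S" if "S \<subseteq> {..<n}" for S using that by auto
    show "\<forall>S\<in>{S. S \<subseteq> {..<n} \<and> card S = k}. {v. v < n \<and> restrict (\<lambda>v. v \<in> S) {..<n} v} = S"
      using e by blast
    show "(\<lambda>y. {v. v < n \<and> y v}) ` {y \<in> PiE {..<n} (\<lambda>_. UNIV). card {v. v < n \<and> y v} = k}
        \<subseteq> {S. S \<subseteq> {..<n} \<and> card S = k}" by auto
    show "(\<lambda>S. restrict (\<lambda>v. v \<in> S) {..<n}) ` {S. S \<subseteq> {..<n} \<and> card S = k}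
        \<subseteq> {y \<in> PiE {..<n} (\<lambda>_. UNIV). card {v. v < n \<and> y v} = k}"
    proof (rule image_subsetI)
      fix S assume S: "S \<in> {S. S \<subseteq> {..<n} \<and> card S = k}"
      show "restrict (\<lambda>v. v \<in> S) {..<n} \<in> {y \<in> PiE {..<n} (\<lambda>_. UNIV). card {v. v < n \<and> y v} = k}"
        using S e[of S] by simp
    qed
  qed
  then show ?thesis using n_subsets[of "{..<n}" k] by (simp add: bij_betw_same_card)
qed

lemma card_rearr_balanced:
  assumes x: "card {v. v < 2 * N \<and> x v} = N"
  shows "card (rearr (2 * N) x) \<le> 4 ^ N"
proof -
  have "rearr (2 * N) x \<subseteq> {y \<in> PiE {..<2 * N} (\<lambda>_. UNIV). card {v. v < 2 * N \<and> y v} = N}"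
  proof
    fix y assume y: "y \<in> rearr (2 * N) x"
    then have "card {v. v < 2 * N \<and> y v = True} = card {v. v < 2 * N \<and> x v = True}" unfolding rearr_def by blast
    then show "y \<in> {y \<in> PiE {..<2 * N} (\<lambda>_. UNIV). card {v. v < 2 * N \<and> y v} = N}"
      using y x by (simp add: rearr_def)
  qed
  then have "card (rearr (2 * N) x) \<le> card {y \<in> PiE {..<2 * N} (\<lambda>_. UNIV :: bool set). card {v. v < 2 * N \<and> y v} = N}"
    by (intro card_mono finite_subset[OF _ finite_PiE_lessThan[of "2 * N"]]) auto
  also have "\<dots> = (2 * N) choose N" by (rule card_balanced_labelings)
  also have "\<dots> \<le> 2 ^ (2 * N)" by (rule binomial_le_pow2)
  finally show ?thesis by (simp add: power_mult)
qed

section \<open>Upper bound for the product joining\<close>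

definition hent :: "real \<Rightarrow> real" where
  "hent \<epsilon> = - (\<epsilon> * ln \<epsilon> + (1 - \<epsilon>) * ln (1 - \<epsilon>))"

text \<open>The constant F of the overview, in Bowen's form (1 - 2r) H(vertex) + r H(edge) with
  H(vertex) = ln 2 and H(edge) = ln 2 + \<open>hent \<epsilon>\<close>.\<close>

definition rate :: "nat \<Rightarrow> real \<Rightarrow> real" where
  "rate r \<epsilon> = (1 - real r) * ln 2 + real r * hent \<epsilon>"

definition trans1 :: "real \<Rightarrow> bool \<Rightarrow> bool \<Rightarrow> real" where
  "trans1 \<epsilon> a b = (if a = b then 1 - \<epsilon> else \<epsilon>)"

definition trans2 :: "real \<Rightarrow> bool \<times> bool \<Rightarrow> bool \<times> bool \<Rightarrow> real" where
  "trans2 \<epsilon> a b = trans1 \<epsilon> (fst a) (fst b) * trans1 \<epsilon> (snd a) (snd b)"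

lemma sum_bool_pair: "(\<Sum>a\<in>UNIV. f a) = f (True, True) + f (True, False) + f (False, True) + (f (False, False) :: real)"
proof -
  have U: "(UNIV :: (bool \<times> bool) set) = {(True, True), (True, False), (False, True), (False, False)}" by auto
  show ?thesis unfolding U by simp
qed

lemma trans2_pos: "0 < \<epsilon> \<Longrightarrow> \<epsilon> < 1 \<Longrightarrow> trans2 \<epsilon> a b > 0"
  by (simp add: trans2_def trans1_def)

lemma trans2_le_1: "0 < \<epsilon> \<Longrightarrow> \<epsilon> < 1 \<Longrightarrow> trans2 \<epsilon> a b \<le> 1"
  unfolding trans2_def by (intro mult_le_one) (auto simp: trans1_def)

lemma sum_trans2: "(\<Sum>b\<in>UNIV. trans2 \<epsilon> a b) = 1"
  unfolding sum_bool_pair by (cases "fst a"; cases "snd a") (simp_all add: trans2_def trans1_def algebra_simps)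

lemma sum_trans2_ln:
  assumes "0 < \<epsilon>" "\<epsilon> < 1"
  shows "(\<Sum>b\<in>UNIV. trans2 \<epsilon> a b * ln (trans2 \<epsilon> a b)) = - 2 * hent \<epsilon>"
proof -
  have ln2: "ln (trans2 \<epsilon> a b) = ln (trans1 \<epsilon> (fst a) (fst b)) + ln (trans1 \<epsilon> (snd a) (snd b))" for b
  proof -
    have "trans1 \<epsilon> c d \<noteq> 0" for c d using assms by (simp add: trans1_def)
    then show ?thesis unfolding trans2_def by (simp add: ln_mult)
  qed
  show ?thesis
    unfolding sum_bool_pair ln2 unfolding trans2_def
    by (cases "fst a"; cases "snd a"; simp add: trans1_def hent_def; simp add: algebra_simps)
qed

lemma
  fixes \<mu> :: "(word \<Rightarrow> 'a::finite) measure" and \<nu> :: "(word \<Rightarrow> 'b::finite) measure"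
  assumes \<mu>: "\<mu> \<in> prob_measures r" and \<nu>: "\<nu> \<in> prob_measures r"
  shows prod_join_prob_measures: "prod_join r \<mu> \<nu> \<in> prob_measures r"
    and measure_prod_join: "\<And>B \<xi> \<eta>. finite B \<Longrightarrow> B \<subseteq> FG r \<Longrightarrow>
      measure (prod_join r \<mu> \<nu>) (fdev r B {restrict (\<lambda>\<gamma>. (\<xi> \<gamma>, \<eta> \<gamma>)) B})
      = measure \<mu> (fdev r B {restrict \<xi> B}) * measure \<nu> (fdev r B {restrict \<eta> B})"
proof -
  interpret M: prob_space \<mu> using \<mu> by (simp add: prob_measures_def)
  interpret N: prob_space \<nu> using \<nu> by (simp add: prob_measures_def)
  interpret MN: pair_prob_space \<mu> \<nu> ..
  have s: "sets \<mu> = sets (CS r)" "sets \<nu> = sets (CS r)" using \<mu> \<nu> by (auto simp: prob_measures_def)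
  have sp: "space \<mu> = space (CS r)" "space \<nu> = space (CS r)" using s by (auto dest: sets_eq_imp_space_eq)
  let ?f = "\<lambda>(x :: word \<Rightarrow> 'a, y :: word \<Rightarrow> 'b). restrict (\<lambda>\<gamma>. (x \<gamma>, y \<gamma>)) (FG r)"
  have "(\<lambda>z. restrict (\<lambda>\<gamma>. (fst z \<gamma>, snd z \<gamma>)) (FG r)) \<in> measurable (\<mu> \<Otimes>\<^sub>M \<nu>) (PiM (FG r) (\<lambda>_. count_space UNIV))"
  proof (rule measurable_restrict)
    fix \<gamma> assume g: "\<gamma> \<in> FG r"
    have c1: "(\<lambda>x. x \<gamma>) \<in> measurable \<mu> (count_space UNIV)"
      using measurable_component_singleton[OF g, of "\<lambda>_. count_space UNIV"]
      by (simp add: measurable_cong_sets[OF s(1) refl] CS_def)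
    have c2: "(\<lambda>x. x \<gamma>) \<in> measurable \<nu> (count_space UNIV)"
      using measurable_component_singleton[OF g, of "\<lambda>_. count_space UNIV"]
      by (simp add: measurable_cong_sets[OF s(2) refl] CS_def)
    have "(\<lambda>z. (fst z \<gamma>, snd z \<gamma>)) \<in> measurable (\<mu> \<Otimes>\<^sub>M \<nu>) (count_space UNIV \<Otimes>\<^sub>M count_space UNIV)"
      by (intro measurable_Pair measurable_compose[OF measurable_fst c1] measurable_compose[OF measurable_snd c2])
    then show "(\<lambda>z. (fst z \<gamma>, snd z \<gamma>)) \<in> measurable (\<mu> \<Otimes>\<^sub>M \<nu>) (count_space UNIV)"
      by (simp add: pair_measure_countable uncountable_infinite)
  qed
  then have m: "?f \<in> measurable (\<mu> \<Otimes>\<^sub>M \<nu>) (CS r)" by (simp add: CS_def case_prod_unfold)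
  then show "prod_join r \<mu> \<nu> \<in> prob_measures r"
    unfolding prob_measures_def prod_join_def by (simp add: MN.P.prob_space_distr)
  fix B \<xi> \<eta> assume B: "finite B" "B \<subseteq> FG r"
  let ?A = "fdev r B {restrict \<xi> B} :: (word \<Rightarrow> 'a) set" and ?C = "fdev r B {restrict \<eta> B} :: (word \<Rightarrow> 'b) set"
  let ?E = "fdev r B {restrict (\<lambda>\<gamma>. (\<xi> \<gamma>, \<eta> \<gamma>)) B} :: (word \<Rightarrow> 'a \<times> 'b) set"
  have vi: "?f -` ?E \<inter> space (\<mu> \<Otimes>\<^sub>M \<nu>) = ?A \<times> ?C"
  proof -
    have h: "(\<forall>\<gamma>\<in>B. restrict h (FG r) \<gamma> = (\<xi> \<gamma>, \<eta> \<gamma>)) \<longleftrightarrow> (\<forall>\<gamma>\<in>B. h \<gamma> = (\<xi> \<gamma>, \<eta> \<gamma>))" for h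
      by (rule ball_cong[OF refl]) (use B(2) in auto)
    show ?thesis
      unfolding fdev_singleton space_pair_measure sp
      by (intro set_eqI, simp only: vimage_eq mem_Collect_eq case_prod_unfold Int_iff mem_Times_iff h)
        (auto simp: space_CS)
  qed
  have "measure (prod_join r \<mu> \<nu>) ?E = measure (\<mu> \<Otimes>\<^sub>M \<nu>) (?A \<times> ?C)"
    unfolding prod_join_def vi[symmetric] by (rule measure_distr[OF m]) (rule fdev_sets[OF B])
  also have "\<dots> = measure \<mu> ?A * measure \<nu> ?C"
    using fdev_sets[OF B, of "{restrict \<xi> B}"] fdev_sets[OF B, of "{restrict \<eta> B}"]
    by (simp add: measure_def N.emeasure_pair_measure_Times s enn2real_mult)
  finally show "measure (prod_join r \<mu> \<nu>) ?E = measure \<mu> ?A * measure \<nu> ?C" .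
qed

section \<open>Single-edge statistics of pairs of labelings\<close>

definition edge :: "nat \<Rightarrow> word set" where
  "edge i = {[], [(i, True)]}"

lemma edge_FG: "i < r \<Longrightarrow> edge i \<subseteq> FG r" and finite_edge: "finite (edge i)" and edge_tl: "tl_closed (edge i)"
  by (auto simp: edge_def FG_def tl_closed_def)

definition pat :: "'a \<Rightarrow> 'a \<Rightarrow> word \<Rightarrow> 'a" where
  "pat a b w = (if w = [] then a else b)"

lemma measure_emp_edge:
  fixes z :: "nat \<Rightarrow> 'a::finite"
  assumes "n > 0" "i < r"
  shows "measure (emp r n s z) (fdev r (edge i) {restrict (pat a b) (edge i)})
    = card {v. v < n \<and> z v = a \<and> z (s i v) = b} / n"
proof -
  have "restrict (\<lambda>\<gamma>. z (act s \<gamma> v)) (edge i) = restrict (pat a b) (edge i) \<longleftrightarrow> z v = a \<and> z (s i v) = b" for v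
  proof
    assume h: "restrict (\<lambda>\<gamma>. z (act s \<gamma> v)) (edge i) = restrict (pat a b) (edge i)"
    show "z v = a \<and> z (s i v) = b"
      using fun_cong[OF h, of "[]"] fun_cong[OF h, of "[(i, True)]"] by (simp add: edge_def pat_def)
  qed (auto simp: edge_def pat_def restrict_def)
  then show ?thesis
    using measure_emp[OF assms(1) finite_edge edge_FG[OF assms(2)], of s z "{restrict (pat a b) (edge i)}"] by simp
qed

lemma measure_prod_join_edge:
  assumes \<epsilon>: "0 \<le> \<epsilon>" "\<epsilon> \<le> 1" and i: "i < r"
  shows "measure (prod_join r (Ising r \<epsilon>) (Ising r \<epsilon>)) (fdev r (edge i) {restrict (pat a b) (edge i)})
    = trans2 \<epsilon> a b / 4"
proof -
  have I: "measure (Ising r \<epsilon>) (fdev r (edge i) {restrict (pat c d) (edge i)}) = trans1 \<epsilon> c d / 2" for c d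
    using measure_Ising[OF \<epsilon> finite_edge edge_FG[OF i] edge_tl, of "pat c d"]
    by (auto simp: Ising_cyl_def edge_def pat_def trans1_def insert_Diff_if)
  have p: "restrict (pat a b) (edge i) = restrict (\<lambda>\<gamma>. (pat (fst a) (fst b) \<gamma>, pat (snd a) (snd b) \<gamma>)) (edge i)"
    by (auto simp: pat_def restrict_def)
  show ?thesis
    unfolding p measure_prod_join[OF Ising_prob_measures[OF \<epsilon>] Ising_prob_measures[OF \<epsilon>] finite_edge edge_FG[OF i]] I
    by (simp add: trans2_def)
qed

text \<open>Here \<open>y\<close> stands for \<open>z\<close> read along one generator, and the
  condition says that the edge table of that generator is almost that of the product chain: uniform
  on four letters, then one transition.\<close>

definition near :: "real \<Rightarrow> real \<Rightarrow> nat \<Rightarrow> (nat \<Rightarrow> bool \<times> bool) \<Rightarrow> (nat \<Rightarrow> bool \<times> bool) set" where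
  "near \<epsilon> \<delta> n z = {y \<in> PiE {..<n} (\<lambda>_. UNIV). \<forall>a b.
     \<bar>card {v. v < n \<and> z v = a \<and> y v = b} / n - trans2 \<epsilon> a b / 4\<bar> < \<delta>}"

text \<open>The price per vertex and per unit of tolerance when each of the 16 table entries may
  exceed its target by \<delta>.\<close>

definition entropy_slack :: "real \<Rightarrow> real" where
  "entropy_slack \<epsilon> = - (\<Sum>a\<in>UNIV. \<Sum>b\<in>UNIV. ln (trans2 \<epsilon> a b))"

text \<open>Change of measure with the transition matrix itself as \<open>q\<close>. The
  log-likelihood of \<open>y\<close> given \<open>z\<close> is linear in the table, and at the
  target it is minus the conditional entropy: four rows of weight 1/4, each contributing
  \<open>2 * hent \<epsilon>\<close>.\<close>

lemma card_near_le:
  assumes \<epsilon>: "0 < \<epsilon>" "\<epsilon> < 1" and n: "n > 0"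
  shows "card (near \<epsilon> \<delta> n z) \<le> exp (n * (2 * hent \<epsilon> + \<delta> * entropy_slack \<epsilon>))"
proof (rule card_labelings_le_exp[where q = "trans2 \<epsilon>" and z = z and n = n])
  show "\<And>a b. 0 < trans2 \<epsilon> a b" using \<epsilon> by (rule trans2_pos)
  show "\<And>a. (\<Sum>b\<in>UNIV. trans2 \<epsilon> a b) = 1" by (rule sum_trans2)
  fix y assume y: "y \<in> near \<epsilon> \<delta> n z"
  then show "y \<in> PiE {..<n} (\<lambda>_. UNIV)" by (simp add: near_def)
  let ?c = "\<lambda>a b. card {v. v < n \<and> z v = a \<and> y v = b}"
  have "(\<Sum>v<n. ln (trans2 \<epsilon> (z v) (y v)))
      = (\<Sum>v<n. \<Sum>a\<in>UNIV. \<Sum>b\<in>UNIV. if z v = a \<and> y v = b then ln (trans2 \<epsilon> a b) else 0)"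
  proof (rule sum.cong[OF refl])
    fix v
    have "(\<Sum>a\<in>UNIV. \<Sum>b\<in>UNIV. if z v = a \<and> y v = b then ln (trans2 \<epsilon> a b) else 0)
        = (\<Sum>a\<in>UNIV. if z v = a then ln (trans2 \<epsilon> a (y v)) else 0)"
    proof (rule sum.cong[OF refl])
      fix a
      show "(\<Sum>b\<in>UNIV. if z v = a \<and> y v = b then ln (trans2 \<epsilon> a b) else 0)
          = (if z v = a then ln (trans2 \<epsilon> a (y v)) else 0)"
        by (cases "z v = a") simp_all
    qed
    also have "\<dots> = ln (trans2 \<epsilon> (z v) (y v))" by simp
    finally show "ln (trans2 \<epsilon> (z v) (y v))
        = (\<Sum>a\<in>UNIV. \<Sum>b\<in>UNIV. if z v = a \<and> y v = b then ln (trans2 \<epsilon> a b) else 0)" ..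
  qed
  also have "\<dots> = (\<Sum>a\<in>UNIV. \<Sum>v<n. \<Sum>b\<in>UNIV. if z v = a \<and> y v = b then ln (trans2 \<epsilon> a b) else 0)"
    by (rule sum.swap)
  also have "\<dots> = (\<Sum>a\<in>UNIV. \<Sum>b\<in>UNIV. \<Sum>v<n. if z v = a \<and> y v = b then ln (trans2 \<epsilon> a b) else 0)"
    by (rule sum.cong[OF refl]) (rule sum.swap)
  also have "\<dots> = (\<Sum>a\<in>UNIV. \<Sum>b\<in>UNIV. ?c a b * ln (trans2 \<epsilon> a b))"
  proof (intro sum.cong refl)
    fix a b
    have "{..<n} \<inter> {v. z v = a \<and> y v = b} = {v. v < n \<and> z v = a \<and> y v = b}" by auto
    then show "(\<Sum>v<n. if z v = a \<and> y v = b then ln (trans2 \<epsilon> a b) else 0) = ?c a b * ln (trans2 \<epsilon> a b)"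
      by (simp add: sum.If_cases)
  qed
  \<comment> \<open>Each logarithm is nonpositive, so replacing the counts by their upper bounds
    lowers the sum.\<close>
  also have "\<dots> \<ge> (\<Sum>a\<in>UNIV. \<Sum>b\<in>UNIV. (n * (trans2 \<epsilon> a b / 4 + \<delta>)) * ln (trans2 \<epsilon> a b))"
  proof (intro sum_mono mult_right_mono_neg)
    fix a b
    have "\<bar>?c a b / n - trans2 \<epsilon> a b / 4\<bar> < \<delta>" using y unfolding near_def by blast
    then have "?c a b / n - trans2 \<epsilon> a b / 4 \<le> \<delta>" by (simp only: abs_less_iff) linarith
    then have "?c a b / n \<le> trans2 \<epsilon> a b / 4 + \<delta>" by simp
    then show "real (?c a b) \<le> n * (trans2 \<epsilon> a b / 4 + \<delta>)"
      using n by (simp add: pos_divide_le_eq mult.commute)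
    show "ln (trans2 \<epsilon> a b) \<le> 0" using trans2_pos[OF \<epsilon>] trans2_le_1[OF \<epsilon>] by simp
  qed
  also have "(\<Sum>a\<in>UNIV. \<Sum>b\<in>UNIV. (n * (trans2 \<epsilon> a b / 4 + \<delta>)) * ln (trans2 \<epsilon> a b))
      = n * ((\<Sum>a\<in>UNIV. \<Sum>b\<in>UNIV. trans2 \<epsilon> a b * ln (trans2 \<epsilon> a b)) / 4 - \<delta> * entropy_slack \<epsilon>)"
    by (simp add: entropy_slack_def algebra_simps sum.distrib sum_distrib_left sum_divide_distrib)
  also have "(\<Sum>a\<in>UNIV. \<Sum>b\<in>UNIV. trans2 \<epsilon> a b * ln (trans2 \<epsilon> a b)) = - 8 * hent \<epsilon>"
    unfolding sum_trans2_ln[OF \<epsilon>] by (simp add: card_UNIV_bool flip: UNIV_Times_UNIV)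
  finally show "- (n * (2 * hent \<epsilon> + \<delta> * entropy_slack \<epsilon>)) \<le> (\<Sum>v<n. ln (trans2 \<epsilon> (z v) (y v)))"
    by (simp add: algebra_simps)
qed

lemma card_UNIV_bool_pair: "card (UNIV :: (bool \<times> bool) set) = 4"
  by (simp flip: UNIV_Times_UNIV)

definition Ubox :: "nat \<Rightarrow> real \<Rightarrow> real \<Rightarrow> (word \<Rightarrow> bool \<times> bool) measure set" where
  "Ubox r \<epsilon> \<delta> = {\<nu> \<in> prob_measures r. \<forall>(i, a, b)\<in>{..<r} \<times> UNIV \<times> UNIV.
     \<bar>measure \<nu> (fdev r (edge i) {restrict (pat a b) (edge i)}) - trans2 \<epsilon> a b / 4\<bar> < \<delta>}"

lemma weak_open_Ubox: "weak_open r (Ubox r \<epsilon> \<delta>)"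
proof -
  let ?I = "{..<r} \<times> (UNIV :: (bool \<times> bool) set) \<times> (UNIV :: (bool \<times> bool) set)"
  have "weak_open r {\<nu> \<in> prob_measures r. \<forall>j\<in>?I.
     \<bar>measure \<nu> (fdev r (edge (fst j)) {restrict (pat (fst (snd j)) (snd (snd j))) (edge (fst j))})
       - trans2 \<epsilon> (fst (snd j)) (snd (snd j)) / 4\<bar> < \<delta>}"
    by (rule weak_open_fdev_family) (auto simp: finite_edge edge_FG[THEN subsetD])
  then show ?thesis unfolding Ubox_def by (simp add: case_prod_unfold)
qed

text \<open>A union bound over at most 4^n labelings \<open>z\<close>. For each one, every generator
  independently has to send it from its type class, of size about 4^n, into \<open>near\<close>; the
  remaining terms are the cost of the tolerance \<delta>.\<close>

lemma expected_count_Ubox_le: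
  assumes \<epsilon>: "0 < \<epsilon>" "\<epsilon> < 1" and r: "r \<ge> 1" and n: "n > 0" and \<delta>: "\<delta> > 0"
  shows "expected_count r n (Ubox r \<epsilon> \<delta>) \<le> exp (n * ln 4 + r * (n * (2 * hent \<epsilon> + \<delta> * entropy_slack \<epsilon>)
    + ((n + 4) * ln (n * (1/4 + 4 * \<delta>) + 1) - n * ln n)))"
proof -
  let ?P = "perm_tuples r n" and ?PE = "PiE {..<n} (\<lambda>_. UNIV :: (bool \<times> bool) set)"
  \<comment> \<open>The largest frequency of a letter: the sum of the four edge frequencies leaving
    it, which add up to 1/4, each allowed an error \<delta>.\<close>
  define \<kappa> where "\<kappa> = 1/4 + 4 * \<delta>"
  define Z where "Z = {z \<in> ?PE. \<forall>a. real (card {v. v < n \<and> z v = a}) \<le> n * \<kappa>}"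
  \<comment> \<open>exp (- D) bounds the size of every type class in \<open>Z\<close> from below.
    The 4 counts the letters, each of which contributes the added 1 of the factorial bound.\<close>
  define D where "D = (real n + 4) * ln (n * \<kappa> + 1) - n * ln n"
  define H where "H = n * (2 * hent \<epsilon> + \<delta> * entropy_slack \<epsilon>)"
  have finP: "finite ?P" unfolding perm_tuples_def by (intro finite_PiE finite_permutations) auto
  have cP: "real (card ?P) > 0" by (simp add: card_perm_tuples)
  have sub: "z \<in> Z \<and> (\<forall>i<r. restrict (\<lambda>v. z (s i v)) {..<n} \<in> near \<epsilon> \<delta> n z)"
    if s: "s \<in> ?P" and z: "z \<in> Omega r n s (Ubox r \<epsilon> \<delta>)" for s z
  proof -
    have zPE: "z \<in> ?PE" and U: "\<And>i a b. i < r \<Longrightarrow>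
        \<bar>card {v. v < n \<and> z v = a \<and> z (s i v) = b} / n - trans2 \<epsilon> a b / 4\<bar> < \<delta>"
      using z measure_emp_edge[OF n, of _ r s z] unfolding Omega_def Ubox_def by auto
    have nr: "restrict (\<lambda>v. z (s i v)) {..<n} \<in> near \<epsilon> \<delta> n z" if i: "i < r" for i
    proof -
      have "{v. v < n \<and> z v = a \<and> restrict (\<lambda>v. z (s i v)) {..<n} v = b} = {v. v < n \<and> z v = a \<and> z (s i v) = b}" for a b
        by auto
      then show ?thesis using U[OF i] by (simp add: near_def)
    qed
    have "real (card {v. v < n \<and> z v = a}) \<le> n * \<kappa>" for a
    proof -
      have i: "0 < r" using r by simp
      have "card {v. v < n \<and> z v = a} = card (\<Union>b\<in>UNIV. {v. v < n \<and> z v = a \<and> z (s 0 v) = b})"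
        by (rule arg_cong[where f = card]) auto
      also have "\<dots> = (\<Sum>b\<in>UNIV. card {v. v < n \<and> z v = a \<and> z (s 0 v) = b})"
        by (rule card_UN_disjoint) auto
      finally have "real (card {v. v < n \<and> z v = a}) = (\<Sum>b\<in>UNIV. real (card {v. v < n \<and> z v = a \<and> z (s 0 v) = b}))"
        by simp
      also have "\<dots> \<le> (\<Sum>b\<in>UNIV. n * (trans2 \<epsilon> a b / 4 + \<delta>))"
      proof (rule sum_mono)
        fix b
        have "card {v. v < n \<and> z v = a \<and> z (s 0 v) = b} / n \<le> trans2 \<epsilon> a b / 4 + \<delta>"
          using U[OF i, of a b] by (simp only: abs_less_iff) linarith
        then show "real (card {v. v < n \<and> z v = a \<and> z (s 0 v) = b}) \<le> n * (trans2 \<epsilon> a b / 4 + \<delta>)"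
          using n by (simp add: pos_divide_le_eq mult.commute)
      qed
      also have "\<dots> = n * ((\<Sum>b\<in>UNIV. trans2 \<epsilon> a b) / 4 + 4 * \<delta>)"
        by (simp only: sum_distrib_left[symmetric] sum.distrib sum_divide_distrib[symmetric] sum_constant card_UNIV_bool_pair) simp
      also have "\<dots> = n * \<kappa>" by (simp add: sum_trans2 \<kappa>_def)
      finally show ?thesis .
    qed
    with zPE nr show ?thesis by (simp add: Z_def)
  qed
  have finZ: "finite Z" unfolding Z_def by (rule finite_subset[OF _ finite_PiE_lessThan[of n]]) auto
  have "(\<Sum>s\<in>?P. real (card (Omega r n s (Ubox r \<epsilon> \<delta>))))
      \<le> (\<Sum>s\<in>?P. \<Sum>z\<in>Z. if \<forall>i<r. restrict (\<lambda>v. z (s i v)) {..<n} \<in> near \<epsilon> \<delta> n z then 1 else 0)"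
  proof (rule sum_mono)
    fix s assume s: "s \<in> ?P"
    have "card (Omega r n s (Ubox r \<epsilon> \<delta>)) \<le> card {z \<in> Z. \<forall>i<r. restrict (\<lambda>v. z (s i v)) {..<n} \<in> near \<epsilon> \<delta> n z}"
      using sub[OF s] finZ by (intro card_mono) auto
    then show "real (card (Omega r n s (Ubox r \<epsilon> \<delta>)))
        \<le> (\<Sum>z\<in>Z. if \<forall>i<r. restrict (\<lambda>v. z (s i v)) {..<n} \<in> near \<epsilon> \<delta> n z then 1 else 0)"
      using finZ by (simp add: sum.If_cases Int_def)
  qed
  also have "\<dots> = (\<Sum>z\<in>Z. \<Sum>s\<in>?P. if \<forall>i<r. restrict (\<lambda>v. z (s i v)) {..<n} \<in> near \<epsilon> \<delta> n z then 1 else 0)"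
    by (rule sum.swap)
  also have "\<dots> = (\<Sum>z\<in>Z. real (card {s \<in> ?P. \<forall>i<r. restrict (\<lambda>v. z (s i v)) {..<n} \<in> near \<epsilon> \<delta> n z}))"
    using finP by (simp add: sum.If_cases Int_def)
  finally have "expected_count r n (Ubox r \<epsilon> \<delta>)
      \<le> (\<Sum>z\<in>Z. real (card {s \<in> ?P. \<forall>i<r. restrict (\<lambda>v. z (s i v)) {..<n} \<in> near \<epsilon> \<delta> n z})) / card ?P"
    unfolding expected_count_def using cP by (simp add: divide_right_mono)
  also have "\<dots> = (\<Sum>z\<in>Z. (card (rearr n z \<inter> near \<epsilon> \<delta> n z) / card (rearr n z)) ^ r)"
    unfolding sum_divide_distrib tuples_fraction ..
  also have "\<dots> \<le> (\<Sum>z\<in>Z. exp (r * (H + D)))"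
  proof (rule sum_mono)
    fix z assume z: "z \<in> Z"
    have ne: "real (card (rearr n z)) > 0" using card_rearr_pos[of n z] by simp
    have \<kappa>: "\<kappa> > 0" using \<delta> by (simp add: \<kappa>_def)
    let ?N = "\<lambda>a. real (card {v. v < n \<and> z v = a})"
    have "(\<Sum>a\<in>UNIV. (?N a + 1) * ln (?N a + 1)) \<le> (\<Sum>a\<in>UNIV. (?N a + 1) * ln (n * \<kappa> + 1))"
    proof (rule sum_mono)
      fix a
      have "?N a \<le> n * \<kappa>" using z unfolding Z_def by blast
      then have "?N a + 1 \<le> n * \<kappa> + 1" by simp
      then show "(?N a + 1) * ln (?N a + 1) \<le> (?N a + 1) * ln (n * \<kappa> + 1)"
        by (intro mult_left_mono ln_mono) auto
    qed
    also have "\<dots> = ((\<Sum>a\<in>UNIV. ?N a) + 4) * ln (n * \<kappa> + 1)"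
      by (simp only: sum_distrib_right[symmetric] sum.distrib sum_constant card_UNIV_bool_pair) simp
    also have "(\<Sum>a\<in>UNIV. ?N a) = n" unfolding of_nat_sum[symmetric] sum_card_classes ..
    finally have "ln (card (rearr n z)) \<ge> - D"
      using ln_card_rearr_lower[OF n, of z] unfolding D_def by linarith
    then have "exp (- D) \<le> card (rearr n z)" using ne by (simp add: ln_ge_iff)
    then have inv: "1 / card (rearr n z) \<le> exp D"
      using ne by (simp add: exp_minus divide_le_eq field_simps)
    have "card (rearr n z \<inter> near \<epsilon> \<delta> n z) \<le> card (near \<epsilon> \<delta> n z)"
      by (intro card_mono finite_subset[OF _ finite_PiE_lessThan[of n]]) (auto simp: near_def)
    then have "real (card (rearr n z \<inter> near \<epsilon> \<delta> n z)) \<le> exp H"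
      using card_near_le[OF \<epsilon> n, of \<delta> z] unfolding H_def by linarith
    then have "real (card (rearr n z \<inter> near \<epsilon> \<delta> n z)) * (1 / card (rearr n z)) \<le> exp H * exp D"
      using inv by (intro mult_mono) auto
    then have "card (rearr n z \<inter> near \<epsilon> \<delta> n z) / card (rearr n z) \<le> exp (H + D)"
      by (simp add: exp_add)
    then have "(card (rearr n z \<inter> near \<epsilon> \<delta> n z) / card (rearr n z)) ^ r \<le> exp (H + D) ^ r"
      by (intro power_mono) auto
    then show "(card (rearr n z \<inter> near \<epsilon> \<delta> n z) / card (rearr n z)) ^ r \<le> exp (r * (H + D))"
      by (simp add: exp_of_nat_mult)
  qed
  also have "\<dots> = card Z * exp (r * (H + D))" by simp
  also have "\<dots> \<le> 4 ^ n * exp (r * (H + D))"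
  proof (rule mult_right_mono)
    have "card Z \<le> card ?PE" unfolding Z_def using finite_PiE_lessThan by (intro card_mono) auto
    also have "\<dots> = 4 ^ n" by (simp add: card_PiE card_UNIV_bool_pair)
    finally show "real (card Z) \<le> 4 ^ n" by (metis of_nat_le_iff of_nat_numeral of_nat_power)
  qed simp
  also have "4 ^ n = exp (n * ln (4::real))" by (simp add: exp_of_nat_mult)
  finally show ?thesis unfolding H_def D_def \<kappa>_def by (simp add: exp_add[symmetric])
qed

text \<open>Since f is an infimum, one box suffices; its width \<delta> is chosen after
  \<open>e\<close>.\<close>

lemma f_inv_prod_join_le:
  assumes \<epsilon>: "0 < \<epsilon>" "\<epsilon> < 1" and r: "r \<ge> 1" and e: "e > 0"
  shows "f_inv r (prod_join r (Ising r \<epsilon>) (Ising r \<epsilon>)) \<le> ereal (2 * rate r \<epsilon> + e)"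
proof -
  have \<epsilon>': "0 \<le> \<epsilon>" "\<epsilon> \<le> 1" using \<epsilon> by auto
  \<comment> \<open>The exponential rate of the bound for the box of width \<delta>. At \<delta> = 0
    the term ln (1/4) cancels against ln 4 once per generator and leaves
    \<open>2 * rate r \<epsilon>\<close>.\<close>
  define G where "G \<delta> = ln 4 + r * (2 * hent \<epsilon> + \<delta> * entropy_slack \<epsilon> + ln (1/4 + 4 * \<delta>))" for \<delta>
  have "(G \<longlongrightarrow> ln 4 + r * (2 * hent \<epsilon> + 0 * entropy_slack \<epsilon> + ln (1/4 + 4 * 0))) (at_right 0)"
    unfolding G_def by (intro tendsto_intros) auto
  moreover have "ln 4 + r * (2 * hent \<epsilon> + 0 * entropy_slack \<epsilon> + ln (1/4 + 4 * 0)) = 2 * rate r \<epsilon>"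
  proof -
    have "ln (4::real) = 2 * ln 2" using ln_realpow[of 2 2] by simp
    moreover have "ln (1/4 :: real) = - ln 4" by (simp add: ln_div)
    ultimately show ?thesis by (simp add: rate_def algebra_simps)
  qed
  ultimately have "\<forall>\<^sub>F \<delta> in at_right 0. G \<delta> < 2 * rate r \<epsilon> + e"
    using e by (intro order_tendstoD(2)) auto
  then have "\<forall>\<^sub>F \<delta> in at_right 0. G \<delta> < 2 * rate r \<epsilon> + e \<and> \<delta> > 0"
    using eventually_at_right_less[of 0] by eventually_elim simp
  then obtain \<delta> where \<delta>: "G \<delta> < 2 * rate r \<epsilon> + e" "\<delta> > 0"
    using eventually_happens[of _ "at_right (0::real)"] by (auto simp: trivial_limit_at_right_real)
  let ?U = "Ubox r \<epsilon> \<delta>" and ?J = "prod_join r (Ising r \<epsilon>) (Ising r \<epsilon>)"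
  have J: "?J \<in> ?U"
    unfolding Ubox_def using \<delta>(2) prod_join_prob_measures[OF Ising_prob_measures[OF \<epsilon>'] Ising_prob_measures[OF \<epsilon>']]
    by (auto simp: measure_prod_join_edge[OF \<epsilon>'])
  define W where "W n = ln 4 + r * (2 * hent \<epsilon> + \<delta> * entropy_slack \<epsilon>
      + ((real n + 4) / n * ln (n * (1/4 + 4 * \<delta>) + 1) - ln n))" for n :: nat
  have W: "W \<longlonglongrightarrow> G \<delta>"
  proof -
    define \<kappa> where "\<kappa> = 1/4 + 4 * \<delta>"
    have \<kappa>: "\<kappa> > 0" using \<delta> by (simp add: \<kappa>_def)
    have "(\<lambda>n. (real n + 4) / n * ln (n * \<kappa> + 1) - ln n) \<longlonglongrightarrow> ln \<kappa>"
      using \<kappa> by real_asymp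
    then show ?thesis unfolding W_def G_def \<kappa>_def[symmetric] by (intro tendsto_intros)
  qed
  have "f_inv r ?J \<le> limsup (\<lambda>n. ereal (1 / real n) * elog (expected_count r n ?U))"
    unfolding f_inv_def using J weak_open_Ubox by (intro INF_lower) auto
  also have "\<dots> \<le> limsup (\<lambda>n. ereal (W n))"
  proof (rule Limsup_mono)
    show "\<forall>\<^sub>F n in sequentially. ereal (1 / real n) * elog (expected_count r n ?U) \<le> ereal (W n)"
      using eventually_gt_at_top[of 0]
    proof eventually_elim
      case (elim n)
      show ?case
      proof (cases "expected_count r n ?U \<le> 0")
        case True
        then show ?thesis using elim by (simp add: elog_def)
      next
        case False
        let ?X = "n * ln 4 + r * (n * (2 * hent \<epsilon> + \<delta> * entropy_slack \<epsilon>)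
            + ((n + 4) * ln (n * (1/4 + 4 * \<delta>) + 1) - n * ln n))"
        have "expected_count r n ?U \<le> exp ?X"
          using expected_count_Ubox_le[OF \<epsilon> r elim \<delta>(2)] by simp
        then have "ln (expected_count r n ?U) \<le> ?X" using False by (simp add: ln_le_cancel_iff[symmetric])
        then have "1 / real n * ln (expected_count r n ?U) \<le> 1 / real n * ?X" by (intro mult_left_mono) auto
        also have "1 / real n * ?X = W n" unfolding W_def using elim by (simp add: field_simps)
        finally show ?thesis using False by (simp add: elog_def)
      qed
    qed
  qed
  also have "limsup (\<lambda>n. ereal (W n)) = ereal (G \<delta>)"
    using W by (intro lim_imp_Limsup) auto
  also have "\<dots> \<le> ereal (2 * rate r \<epsilon> + e)" using \<delta>(1) by simp
  finally show ?thesis .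
qed

section \<open>Moments of the number of good labelings\<close>

text \<open>The cut edges of a generator are the two off-diagonal cells of its table, each of size
  \<open>m\<close>.\<close>

lemma cut_size_planted:
  assumes "planted N m x" and s: "s \<in> planted.S r N m x"
  shows "cut_size r (2 * N) s {v. v < 2 * N \<and> x v} = r * (2 * m)"
proof -
  interpret planted r N m x by fact
  let ?V = "{v. v < 2 * N \<and> x v}"
  have "card {v. v < 2 * N \<and> (v \<in> ?V) \<noteq> (s i v \<in> ?V)} = 2 * m" if i: "i < r" for i
  proof -
    have p: "s i permutes {..<2 * N}" using perm_tuples_permutes[OF S_perm_tuples[OF s] i] .
    have k: "card {v. v < 2 * N \<and> x v \<and> \<not> x (s i v)} = m" using s i by (simp add: S_def)
    have lt: "s i v < 2 * N \<longleftrightarrow> v < 2 * N" for v using permutes_in_image[OF p, of v] by simp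
    let ?A = "{v. v < 2 * N \<and> x v = True \<and> x (s i v) = False}"
    let ?B = "{v. v < 2 * N \<and> x v = False \<and> x (s i v) = True}"
    have eq: "{v. v < 2 * N \<and> (v \<in> ?V) \<noteq> (s i v \<in> ?V)} = ?A \<union> ?B" using lt by auto
    have "card (?A \<union> ?B) = card ?A + card ?B" by (rule card_Un_disjoint) auto
    moreover have "card ?A = m" using card_perm_class[OF p k, of True False] by (rule trans) simp
    moreover have "card ?B = m" using card_perm_class[OF p k, of False True] by (rule trans) simp
    ultimately show ?thesis unfolding eq by (simp only: mult_2)
  qed
  then have "(\<Sum>i<r. card {v. v < 2 * N \<and> (v \<in> ?V) \<noteq> (s i v \<in> ?V)}) = r * (2 * m)" by simp
  moreover have "bij_betw (\<lambda>(i, v). (v, i)) (SIGMA i:{..<r}. {v. v < 2 * N \<and> (v \<in> ?V) \<noteq> (s i v \<in> ?V)})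
      {(v, i). v < 2 * N \<and> i < r \<and> (v \<in> ?V) \<noteq> (s i v \<in> ?V)}"
    by (rule bij_betw_byWitness[where f' = "\<lambda>(v, i). (i, v)"]) auto
  then have "card (SIGMA i:{..<r}. {v. v < 2 * N \<and> (v \<in> ?V) \<noteq> (s i v \<in> ?V)}) = cut_size r (2 * N) s ?V"
    unfolding cut_size_def by (rule bij_betw_same_card)
  moreover have "card (SIGMA i:{..<r}. {v. v < 2 * N \<and> (v \<in> ?V) \<noteq> (s i v \<in> ?V)})
      = (\<Sum>i<r. card {v. v < 2 * N \<and> (v \<in> ?V) \<noteq> (s i v \<in> ?V)})"
    by (rule card_SigmaI) auto
  ultimately show ?thesis by simp
qed

lemma mcut_planted_le:
  assumes pl: "planted N m x" and s: "s \<in> planted.S r N m x"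
  shows "mcut r (2 * N) s \<le> r * (2 * m)"
proof -
  interpret planted r N m x by fact
  let ?V = "{v. v < 2 * N \<and> x v}"
  have "?V \<in> bisections (2 * N)" unfolding bisections_def using balanced by auto
  then have "mcut r (2 * N) s \<le> cut_size r (2 * N) s ?V"
    unfolding mcut_def using finite_bisections by (intro Min_le) auto
  then show ?thesis using cut_size_planted[OF pl s] by simp
qed

text \<open>Rounded down, so that the planted cut density never exceeds \<epsilon> and the lower
  tail of the minimal bisection applies at \<epsilon> itself.\<close>

definition mcount :: "real \<Rightarrow> nat \<Rightarrow> nat" where
  "mcount \<epsilon> N = nat \<lfloor>\<epsilon> * N\<rfloor>"

lemma mcount_le:
  assumes "0 \<le> \<epsilon>" "\<epsilon> \<le> 1"
  shows "real (mcount \<epsilon> N) \<le> \<epsilon> * N" and "\<epsilon> * N - 1 \<le> real (mcount \<epsilon> N)" and "mcount \<epsilon> N \<le> N"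
proof -
  have "\<epsilon> * N \<ge> 0" using assms by simp
  then have e: "real (mcount \<epsilon> N) = of_int \<lfloor>\<epsilon> * N\<rfloor>" by (simp add: mcount_def)
  show 1: "real (mcount \<epsilon> N) \<le> \<epsilon> * N" unfolding e by (rule of_int_floor_le)
  show "\<epsilon> * N - 1 \<le> real (mcount \<epsilon> N)" unfolding e by linarith
  have "\<epsilon> * N \<le> N" using assms by (simp add: mult_left_le_one_le)
  then show "mcount \<epsilon> N \<le> N" using 1 by linarith
qed

lemma mcount_lim:
  assumes "0 \<le> \<epsilon>" "\<epsilon> \<le> 1"
  shows "(\<lambda>N. real (mcount \<epsilon> N) / real N) \<longlonglongrightarrow> \<epsilon>"
proof (rule tendsto_sandwich)
  show "\<forall>\<^sub>F N in sequentially. \<epsilon> - 1 / real N \<le> real (mcount \<epsilon> N) / real N"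
    using eventually_gt_at_top[of 0]
  proof eventually_elim
    case (elim N)
    have "\<epsilon> - 1 / real N = (\<epsilon> * N - 1) / N" using elim by (simp add: field_simps)
    then show ?case using mcount_le(2)[OF assms, of N] by (simp add: divide_right_mono)
  qed
  show "\<forall>\<^sub>F N in sequentially. real (mcount \<epsilon> N) / real N \<le> \<epsilon>"
    using eventually_gt_at_top[of 0]
    by eventually_elim (use mcount_le(1)[OF assms] in \<open>simp add: pos_divide_le_eq\<close>)
  show "(\<lambda>N. \<epsilon> - 1 / real N) \<longlonglongrightarrow> \<epsilon>" by real_asymp
qed simp

lemma ln_binomial_mcount:
  assumes \<epsilon>: "0 < \<epsilon>" "\<epsilon> < 1" and \<eta>: "\<eta> > 0"
  shows "\<forall>\<^sub>F N in sequentially. ln (N choose mcount \<epsilon> N) \<ge> N * (hent \<epsilon> - \<eta>)"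
proof -
  have \<epsilon>': "0 \<le> \<epsilon>" "\<epsilon> \<le> 1" using \<epsilon> by auto
  \<comment> \<open>The fractions carry the added 1 of the factorial bound. Hence \<open>p\<close>
    and \<open>p'\<close> add up to 1 + 2/N, which is the source of the correction 2 ln N /
    N.\<close>
  define p where "p N = (real (mcount \<epsilon> N) + 1) / N" for N
  define p' where "p' N = (real (N - mcount \<epsilon> N) + 1) / N" for N
  have inv: "(\<lambda>N. 1 / real N) \<longlonglongrightarrow> 0" by real_asymp
  have p: "p \<longlonglongrightarrow> \<epsilon>"
    using tendsto_add[OF mcount_lim[OF \<epsilon>'] inv] unfolding p_def add_divide_distrib by simp
  have "\<forall>\<^sub>F N in sequentially. 1 - real (mcount \<epsilon> N) / N + 1 / N = p' N"
    using eventually_gt_at_top[of 0]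
    by eventually_elim (use mcount_le(3)[OF \<epsilon>'] in \<open>simp add: p'_def of_nat_diff add_divide_distrib diff_divide_distrib\<close>)
  moreover have "(\<lambda>N. 1 - real (mcount \<epsilon> N) / N + 1 / N) \<longlonglongrightarrow> 1 - \<epsilon> + 0"
    by (intro tendsto_intros mcount_lim[OF \<epsilon>'] inv)
  ultimately have "p' \<longlonglongrightarrow> 1 - \<epsilon> + 0" by (rule Lim_transform_eventually[rotated])
  then have p': "p' \<longlonglongrightarrow> 1 - \<epsilon>" by simp
  have "(\<lambda>N. - (2 * ln N / N) - p N * ln (p N) - p' N * ln (p' N)) \<longlonglongrightarrow> 0 - \<epsilon> * ln \<epsilon> - (1 - \<epsilon>) * ln (1 - \<epsilon>)"
  proof (intro tendsto_diff tendsto_mult tendsto_ln p p')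
    show "(\<lambda>N. - (2 * ln (real N) / real N)) \<longlonglongrightarrow> 0" by real_asymp
  qed (use \<epsilon> in auto)
  moreover have "0 - \<epsilon> * ln \<epsilon> - (1 - \<epsilon>) * ln (1 - \<epsilon>) > hent \<epsilon> - \<eta>" using \<eta> by (simp add: hent_def)
  ultimately have "\<forall>\<^sub>F N in sequentially. - (2 * ln N / N) - p N * ln (p N) - p' N * ln (p' N) > hent \<epsilon> - \<eta>"
    by (rule order_tendstoD(1))
  then show ?thesis using eventually_gt_at_top[of 0]
  proof eventually_elim
    case (elim N)
    let ?m = "mcount \<epsilon> N"
    have N: "real N > 0" using elim by simp
    have mp: "real ?m + 1 = N * p N" "real (N - ?m) + 1 = N * p' N" using N by (simp_all add: p_def p'_def)
    have pp: "p N > 0" "p' N > 0" using N by (simp_all add: p_def p'_def add_nonneg_pos)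
    have "real ?m + real (N - ?m) = N" using mcount_le(3)[OF \<epsilon>', of N] by simp
    then have sum: "N * p N + N * p' N = N + 2" unfolding mp[symmetric] by simp
    have "ln (N choose ?m) \<ge> N * ln N - (N * p N) * ln (N * p N) - (N * p' N) * ln (N * p' N)"
      using ln_binomial_lower[OF mcount_le(3)[OF \<epsilon>'], of N] elim unfolding mp by simp
    also have "N * ln N - (N * p N) * ln (N * p N) - (N * p' N) * ln (N * p' N)
        = N * ln N - (N * p N + N * p' N) * ln N - N * (p N * ln (p N) + p' N * ln (p' N))"
      using N pp by (simp add: ln_mult_pos algebra_simps)
    also have "\<dots> = N * (- (2 * ln N / N) - p N * ln (p N) - p' N * ln (p' N))"
      unfolding sum using N by (simp add: algebra_simps)
    also have "\<dots> \<ge> N * (hent \<epsilon> - \<eta>)" using elim(1) N by (intro mult_left_mono) auto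
    finally show ?case .
  qed
qed

section \<open>First moment of the number of good labelings\<close>

definition balanced_labelings :: "nat \<Rightarrow> (nat \<Rightarrow> bool) set" where
  "balanced_labelings N = {x \<in> PiE {..<2 * N} (\<lambda>_. UNIV). card {v. v < 2 * N \<and> x v} = N}"

lemma finite_balanced_labelings: "finite (balanced_labelings N)"
  unfolding balanced_labelings_def by (rule finite_subset[OF _ finite_PiE_lessThan[of "2 * N"]]) auto

lemma card_balanced_labelings': "card (balanced_labelings N) = (2 * N) choose N"
  unfolding balanced_labelings_def by (rule card_balanced_labelings)

lemma balanced_labelings_nonempty: "balanced_labelings N \<noteq> {}"
proof -
  have "(2 * N) choose N > 0" by (rule zero_less_binomial) simp
  then have "card (balanced_labelings N) \<noteq> 0" unfolding card_balanced_labelings' by simp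
  then show ?thesis by auto
qed

lemma planted_balanced:
  assumes "0 \<le> \<epsilon>" "\<epsilon> \<le> 1" "N > 0" "x \<in> balanced_labelings N"
  shows "planted N (mcount \<epsilon> N) x"
  using assms mcount_le(3)[OF assms(1,2)] by unfold_locales (auto simp: balanced_labelings_def)

text \<open>The probability that a fixed balanced labeling gets the prescribed edge table from all
  generators. The ratio of counts is bounded below by enlarging the type class to size 4^N, which
  costs a polynomial factor at most.\<close>

lemma card_planted_S:
  assumes "planted N m x"
  shows "real (card (planted.S r N m x)) / card (perm_tuples r (2 * N)) \<ge> (real ((N choose m)\<^sup>2) / 4 ^ N) ^ r"
proof -
  interpret planted r N m x by fact
  let ?Q = "{y. card {v. v < 2 * N \<and> x v \<and> \<not> y v} = m}"
  have "restrict (\<lambda>v. x (p v)) {..<2 * N} \<in> ?Q \<longleftrightarrow> card {v. v < 2 * N \<and> x v \<and> \<not> x (p v)} = m"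
    for p :: "nat \<Rightarrow> nat"
  proof -
    have "{v. v < 2 * N \<and> x v \<and> \<not> restrict (\<lambda>v. x (p v)) {..<2 * N} v} = {v. v < 2 * N \<and> x v \<and> \<not> x (p v)}"
      by auto
    then show ?thesis by simp
  qed
  then have "S = {s \<in> perm_tuples r (2 * N). \<forall>i<r. restrict (\<lambda>v. x (s i v)) {..<2 * N} \<in> ?Q}"
    unfolding S_def by (simp only:)
  then have "real (card S) / card (perm_tuples r (2 * N)) = (card (rearr (2 * N) x \<inter> ?Q) / card (rearr (2 * N) x)) ^ r"
    by (simp only: tuples_fraction)
  moreover have "real ((N choose m)\<^sup>2) / 4 ^ N \<le> card (rearr (2 * N) x \<inter> ?Q) / card (rearr (2 * N) x)"
  proof (rule frac_le)
    show "real ((N choose m)\<^sup>2) \<le> card (rearr (2 * N) x \<inter> ?Q)"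
      using balanced_extension_count[OF balanced, of m] by (simp only: of_nat_le_iff)
    show "0 < real (card (rearr (2 * N) x))" using card_rearr_pos[of "2 * N" x] by simp
    have "real (card (rearr (2 * N) x)) \<le> real (4 ^ N)" using card_rearr_balanced[OF balanced] by (simp only: of_nat_le_iff)
    then show "real (card (rearr (2 * N) x)) \<le> 4 ^ N" by simp
  qed simp
  ultimately show ?thesis by (simp add: power_mono)
qed

lemma planted_S_nonempty:
  assumes "planted N m x"
  shows "planted.S r N m x \<noteq> {}"
proof
  assume e: "planted.S r N m x = {}"
  interpret planted r N m x by fact
  have "N choose m > 0" using m by (rule zero_less_binomial)
  then have "(real ((N choose m)\<^sup>2) / 4 ^ N) ^ r > 0" by simp
  then show False using card_planted_S[OF assms, of r] e by simp
qed

text \<open>Uniformity in the labeling: apply the limit theorem to a worst labeling for each N.\<close>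
lemma uniform_typical_local_statistics:
  assumes \<epsilon>: "0 \<le> \<epsilon>" "\<epsilon> \<le> 1" and B: "finite B" "B \<subseteq> FG r" "tl_closed B" and \<delta>: "\<delta> > 0"
  shows "\<forall>\<^sub>F N in sequentially. \<forall>x\<in>balanced_labelings N.
    real (card {s \<in> planted.S r N (mcount \<epsilon> N) x. \<forall>\<xi>\<in>PiE B (\<lambda>_. UNIV).
      \<bar>planted.occ N x B \<xi> s - Ising_cyl \<epsilon> \<xi> B\<bar> < \<delta>}) \<ge> card (planted.S r N (mcount \<epsilon> N) x) / 2"
proof -
  define ok where "ok N x \<longleftrightarrow> real (card {s \<in> planted.S r N (mcount \<epsilon> N) x. \<forall>\<xi>\<in>PiE B (\<lambda>_. UNIV).
      \<bar>planted.occ N x B \<xi> s - Ising_cyl \<epsilon> \<xi> B\<bar> < \<delta>}) \<ge> card (planted.S r N (mcount \<epsilon> N) x) / 2" for N x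
  \<comment> \<open>The worst labeling is one that violates \<open>ok\<close> if there is one, and
    any labeling otherwise.\<close>
  have "\<exists>x\<in>balanced_labelings N. ok N x \<longrightarrow> (\<forall>y\<in>balanced_labelings N. ok N y)" for N
    using balanced_labelings_nonempty by blast
  then obtain x where x: "\<And>N. x N \<in> balanced_labelings N"
    "\<And>N. ok N (x N) \<Longrightarrow> \<forall>y\<in>balanced_labelings N. ok N y" by metis
  interpret planted_seq r \<epsilon> "mcount \<epsilon>" x
  proof (rule planted_seq.intro)
    show "planted N (mcount \<epsilon> N) (x N)" if "0 < N" for N using planted_balanced[OF \<epsilon> that x(1)] .
    then show "planted.S r N (mcount \<epsilon> N) (x N) \<noteq> {}" if "0 < N" for N using planted_S_nonempty that by blast
    show "(\<lambda>N. real (mcount \<epsilon> N) / real N) \<longlonglongrightarrow> \<epsilon>" by (rule mcount_lim[OF \<epsilon>])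
  qed
  have "\<forall>\<^sub>F N in sequentially. ok N (x N)"
    unfolding ok_def by (rule typical_local_statistics[OF \<epsilon> B \<delta>])
  then have "\<forall>\<^sub>F N in sequentially. \<forall>y\<in>balanced_labelings N. ok N y"
    by eventually_elim (rule x(2))
  then show ?thesis unfolding ok_def .
qed

lemma fdev_close_of_cylinders:
  fixes c \<delta> :: real and \<nu> \<nu>' :: "(word \<Rightarrow> 'a::finite) measure"
  assumes \<nu>: "\<nu> \<in> prob_measures r" "\<nu>' \<in> prob_measures r"
    and cyl: "\<And>\<xi>. \<xi> \<in> PiE (ball r k) (\<lambda>_. UNIV) \<Longrightarrow>
      \<bar>measure \<nu> (fdev r (ball r k) {\<xi>}) - measure \<nu>' (fdev r (ball r k) {\<xi>})\<bar> \<le> c"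
    and c: "c \<ge> 0" "card (PiE (ball r k) (\<lambda>_. UNIV :: 'a set)) * c < \<delta>"
  shows "fdev_close r k \<delta> \<nu> \<nu>'"
  unfolding fdev_close_def
proof
  fix T :: "(word \<Rightarrow> 'a) set"
  let ?U = "PiE (ball r k) (\<lambda>_. UNIV :: 'a set)" and ?B = "ball r k"
  have finU: "finite ?U" using finite_ball by (intro finite_PiE) auto
  have "\<bar>measure \<nu> (fdev r ?B T) - measure \<nu>' (fdev r ?B T)\<bar>
      = \<bar>\<Sum>\<xi>\<in>T \<inter> ?U. measure \<nu> (fdev r ?B {\<xi>}) - measure \<nu>' (fdev r ?B {\<xi>})\<bar>"
    unfolding measure_fdev_eq_sum[OF \<nu>(1) finite_ball ball_subset_FG, of k T]
      measure_fdev_eq_sum[OF \<nu>(2) finite_ball ball_subset_FG, of k T] by (simp add: sum_subtractf)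
  also have "\<dots> \<le> (\<Sum>\<xi>\<in>T \<inter> ?U. c)"
    by (rule order_trans[OF sum_abs], rule sum_mono) (use cyl in auto)
  also have "\<dots> \<le> card ?U * c"
    using c(1) card_mono[OF finU, of "T \<inter> ?U"] by (simp add: mult_right_mono)
  finally show "\<bar>measure \<nu> (fdev r ?B T) - measure \<nu>' (fdev r ?B T)\<bar> < \<delta>" using c(2) by linarith
qed

lemma measure_emp_occ:
  assumes "planted N m x" "finite B" "B \<subseteq> FG r"
  shows "measure (emp r (2 * N) s x) (fdev r B {restrict \<xi> B}) = planted.occ N x B \<xi> s"
proof -
  interpret planted r N m x by fact
  have "restrict (\<lambda>\<gamma>. x (act s \<gamma> v)) B \<in> {restrict \<xi> B} \<longleftrightarrow> (\<forall>w\<in>B. x (act s w v) = \<xi> w)" for v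
    by (auto simp: restrict_def fun_eq_iff)
  then show ?thesis
    using measure_emp[OF _ assms(2,3), of "2 * N" s x "{restrict \<xi> B}"] N by (simp add: occ_def)
qed

text \<open>The good labelings. Radius and tolerance are tied to the single parameter
  \<open>k\<close>, so that k \<longrightarrow> \<infinity> alone forces the marginals of the limit
  to be exactly Ising.\<close>

definition micro :: "nat \<Rightarrow> real \<Rightarrow> nat \<Rightarrow> nat \<Rightarrow> (nat \<Rightarrow> nat \<Rightarrow> nat) \<Rightarrow> (nat \<Rightarrow> bool) set" where
  "micro r \<epsilon> k N s = {x \<in> balanced_labelings N. s \<in> planted.S r N (mcount \<epsilon> N) x \<and>
     fdev_close r k (1 / (real k + 1)) (emp r (2 * N) s x) (Ising r \<epsilon>)}"

text \<open>Exchanging the sums over labelings and tuples: each of the roughly 4^N balanced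
  labelings contributes half its planted probability. The exponents N ln 4 + r (2N hent - N ln 4)
  add up to 2N times the rate.\<close>

lemma micro_first_moment:
  assumes \<epsilon>: "0 < \<epsilon>" "\<epsilon> < 1" and \<eta>: "\<eta> > 0"
  shows "\<forall>\<^sub>F N in sequentially. avg (perm_tuples r (2 * N)) (\<lambda>s. card (micro r \<epsilon> k N s))
    \<ge> exp (2 * N * (rate r \<epsilon> - \<eta>))"
proof -
  have \<epsilon>': "0 \<le> \<epsilon>" "\<epsilon> \<le> 1" using \<epsilon> by auto
  let ?B = "ball r k" and ?U = "PiE (ball r k) (\<lambda>_. UNIV :: bool set)"
  \<comment> \<open>Small enough that an error \<delta> for each pattern on the ball adds up to less
    than 1 / (k + 1) for every event.\<close>
  define \<delta> where "\<delta> = 1 / ((real k + 1) * (real (card ?U) + 1))"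
  have \<delta>: "\<delta> > 0" by (simp add: \<delta>_def add_nonneg_pos)
  have "real (card ?U) * \<delta> < 1 / (real k + 1)"
    unfolding \<delta>_def by (simp add: divide_simps add_nonneg_pos)
  note \<delta>' = this
  \<comment> \<open>The permitted loss is 2N\<eta>. One half goes to the binomial estimate, used
    twice per generator, the other half to the polynomial factor.\<close>
  define \<eta>1 where "\<eta>1 = \<eta> / (2 * real r + 1)"
  have \<eta>': "\<eta>1 > 0" using \<eta> by (simp add: \<eta>1_def add_nonneg_pos)
  have "(2 * real r + 1) * \<eta>1 = \<eta>" by (simp add: \<eta>1_def)
  then have \<eta>1: "2 * real r * \<eta>1 \<le> \<eta>" using \<eta>' by (simp add: distrib_right)
  \<comment> \<open>The factor 4N collects the loss 2N in the central binomial coefficient and the 2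
    from keeping only half of the planted tuples.\<close>
  have lnN: "\<forall>\<^sub>F N in sequentially. ln (4 * real N) \<le> \<eta> * N"
    using \<eta> by real_asymp
  have typical: "\<forall>\<^sub>F N in sequentially. \<forall>x\<in>balanced_labelings N.
    real (card {s \<in> planted.S r N (mcount \<epsilon> N) x. \<forall>\<xi>\<in>?U.
      \<bar>planted.occ N x ?B \<xi> s - Ising_cyl \<epsilon> \<xi> ?B\<bar> < \<delta>}) \<ge> card (planted.S r N (mcount \<epsilon> N) x) / 2"
    by (rule uniform_typical_local_statistics[OF \<epsilon>' finite_ball ball_subset_FG tl_closed_ball \<delta>])
  show ?thesis
    using typical ln_binomial_mcount[OF \<epsilon> \<eta>'] lnN eventually_gt_at_top[of 0]
  proof eventually_elim
    case (elim N)
    let ?P = "perm_tuples r (2 * N)" and ?X = "balanced_labelings N" and ?m = "mcount \<epsilon> N"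
    let ?C = "real (N choose ?m)"
    have cP: "real (card ?P) > 0" using perm_tuples_nonempty finite_perm_tuples by (simp add: card_gt_0_iff)
    have C: "?C > 0" using mcount_le(3)[OF \<epsilon>'] by simp
    have each: "real (card {s \<in> ?P. x \<in> micro r \<epsilon> k N s}) \<ge> card ?P * ((?C\<^sup>2 / 4 ^ N) ^ r / 2)" if x: "x \<in> ?X" for x
    proof -
      have pl: "planted N ?m x" by (rule planted_balanced[OF \<epsilon>' elim(4) x])
      interpret planted r N ?m x by (rule pl)
      let ?G = "{s \<in> S. \<forall>\<xi>\<in>?U. \<bar>occ ?B \<xi> s - Ising_cyl \<epsilon> \<xi> ?B\<bar> < \<delta>}"
      have "?G \<subseteq> {s \<in> ?P. x \<in> micro r \<epsilon> k N s}"
      proof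
        fix s assume s: "s \<in> ?G"
        have "fdev_close r k (1 / (real k + 1)) (emp r (2 * N) s x) (Ising r \<epsilon>)"
        proof (rule fdev_close_of_cylinders[OF _ Ising_prob_measures[OF \<epsilon>'] _ less_imp_le[OF \<delta>] \<delta>'])
          show "emp r (2 * N) s x \<in> prob_measures r" using elim(4) by (intro emp_prob_measures) simp
          fix \<xi> :: "word \<Rightarrow> bool" assume \<xi>: "\<xi> \<in> ?U"
          have r: "restrict \<xi> ?B = \<xi>" using \<xi> by (rule PiE_restrict)
          have "\<bar>occ ?B \<xi> s - Ising_cyl \<epsilon> \<xi> ?B\<bar> < \<delta>" using s \<xi> by blast
          moreover have "measure (emp r (2 * N) s x) (fdev r ?B {restrict \<xi> ?B}) = occ ?B \<xi> s"
            by (rule measure_emp_occ[OF pl finite_ball ball_subset_FG])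
          moreover have "measure (Ising r \<epsilon>) (fdev r ?B {restrict \<xi> ?B}) = Ising_cyl \<epsilon> \<xi> ?B"
            by (rule measure_Ising[OF \<epsilon>' finite_ball ball_subset_FG tl_closed_ball])
          ultimately show "\<bar>measure (emp r (2 * N) s x) (fdev r ?B {\<xi>}) - measure (Ising r \<epsilon>) (fdev r ?B {\<xi>})\<bar> \<le> \<delta>"
            unfolding r by simp
        qed
        then show "s \<in> {s \<in> ?P. x \<in> micro r \<epsilon> k N s}"
          using s x S_perm_tuples by (simp add: micro_def)
      qed
      then have "card ?G \<le> card {s \<in> ?P. x \<in> micro r \<epsilon> k N s}" using finite_perm_tuples by (intro card_mono) auto
      moreover have "real (card ?G) \<ge> card S / 2" using elim(1) x by blast
      moreover have "card S \<ge> card ?P * (?C\<^sup>2 / 4 ^ N) ^ r"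
        using card_planted_S[OF pl, of r] cP by (simp add: pos_le_divide_eq mult.commute)
      ultimately show ?thesis by (simp add: of_nat_le_iff[symmetric, where 'a = real] del: of_nat_le_iff)
    qed
    have "avg ?P (\<lambda>s. card (micro r \<epsilon> k N s)) * card ?P = (\<Sum>s\<in>?P. \<Sum>x\<in>?X. if x \<in> micro r \<epsilon> k N s then 1 else 0)"
    proof -
      have "?X \<inter> micro r \<epsilon> k N s = micro r \<epsilon> k N s" for s by (auto simp: micro_def)
      then have "(\<Sum>x\<in>?X. if x \<in> micro r \<epsilon> k N s then 1 else 0) = real (card (micro r \<epsilon> k N s))" for s
        using finite_balanced_labelings by (simp add: sum.If_cases)
      then show ?thesis using cP by (simp add: avg_def)
    qed
    also have "\<dots> = (\<Sum>x\<in>?X. \<Sum>s\<in>?P. if x \<in> micro r \<epsilon> k N s then 1 else 0)" by (rule sum.swap)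
    also have "\<dots> = (\<Sum>x\<in>?X. real (card {s \<in> ?P. x \<in> micro r \<epsilon> k N s}))"
      using finite_perm_tuples by (simp add: sum.If_cases Int_def)
    also have "\<dots> \<ge> (\<Sum>x\<in>?X. card ?P * ((?C\<^sup>2 / 4 ^ N) ^ r / 2))" by (rule sum_mono) (rule each)
    finally have "avg ?P (\<lambda>s. card (micro r \<epsilon> k N s)) * card ?P \<ge> card ?X * ((?C\<^sup>2 / 4 ^ N) ^ r / 2) * card ?P"
      by (simp add: mult_ac)
    then have lower: "avg ?P (\<lambda>s. card (micro r \<epsilon> k N s)) \<ge> card ?X * ((?C\<^sup>2 / 4 ^ N) ^ r / 2)"
      using cP by (simp add: mult_le_cancel_right)
    have cX: "real (card ?X) \<ge> 4 ^ N / (2 * real N)"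
      unfolding card_balanced_labelings' by (rule central_binomial_lower_bound[OF elim(4)])
    have "exp (2 * N * (rate r \<epsilon> - \<eta>)) \<le> 4 ^ N / (2 * real N) * ((?C\<^sup>2 / 4 ^ N) ^ r / 2)"
    proof -
      have N: "real N > 0" using elim(4) by simp
      have ln4: "ln (4::real) = 2 * ln 2" using ln_realpow[of 2 2] by simp
      have pos: "?C\<^sup>2 / 4 ^ N > 0" using C by simp
      have "ln (4 ^ N / (2 * real N) * ((?C\<^sup>2 / 4 ^ N) ^ r / 2))
          = ln (4 ^ N) - ln (4 * real N) + r * ln (?C\<^sup>2 / 4 ^ N)"
      proof -
        have "4 ^ N / (2 * real N) * ((?C\<^sup>2 / 4 ^ N) ^ r / 2) = 4 ^ N / (4 * real N) * (?C\<^sup>2 / 4 ^ N) ^ r"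
          by simp
        moreover have "ln (4 ^ N / (4 * real N) * (?C\<^sup>2 / 4 ^ N) ^ r) = ln (4 ^ N / (4 * real N)) + ln ((?C\<^sup>2 / 4 ^ N) ^ r)"
          using N by (intro ln_mult_pos zero_less_power pos) simp
        moreover have "ln (4 ^ N / (4 * real N)) = ln (4 ^ N) - ln (4 * real N)"
          using N by (simp add: ln_div)
        moreover have "ln ((?C\<^sup>2 / 4 ^ N) ^ r) = r * ln (?C\<^sup>2 / 4 ^ N)"
          by (rule ln_realpow)
        ultimately show ?thesis by (simp only:)
      qed
      also have "ln (?C\<^sup>2 / 4 ^ N) = 2 * ln ?C - N * ln 4"
        using C by (simp add: ln_div ln_realpow)
      also have "ln (4 ^ N :: real) = N * ln 4" by (simp add: ln_realpow)
      finally have eq: "ln (4 ^ N / (2 * real N) * ((?C\<^sup>2 / 4 ^ N) ^ r / 2))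
          = N * ln 4 - ln (4 * real N) + r * (2 * ln ?C - N * ln 4)" .
      have "2 * ln ?C - N * ln 4 \<ge> 2 * (N * (hent \<epsilon> - \<eta>1)) - N * ln 4" using elim(2) by simp
      then have "r * (2 * ln ?C - N * ln 4) \<ge> r * (2 * (N * (hent \<epsilon> - \<eta>1)) - N * ln 4)"
        by (intro mult_left_mono) auto
      moreover have "r * (2 * (N * (hent \<epsilon> - \<eta>1)) - N * ln 4) = r * (2 * N * hent \<epsilon> - N * ln 4) - N * (2 * r * \<eta>1)"
        by (simp add: algebra_simps)
      moreover have "N * (2 * r * \<eta>1) \<le> N * \<eta>"
        using N \<eta>1 by (intro mult_left_mono) auto
      ultimately have "2 * N * (rate r \<epsilon> - \<eta>) \<le> ln (4 ^ N / (2 * real N) * ((?C\<^sup>2 / 4 ^ N) ^ r / 2))"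
        unfolding eq using elim(3) unfolding ln4 rate_def by (simp add: algebra_simps)
      then show ?thesis using N pos by (simp add: ln_ge_iff)
    qed
    also have "\<dots> \<le> card ?X * ((?C\<^sup>2 / 4 ^ N) ^ r / 2)" using cX by (intro mult_right_mono) auto
    finally show ?case using lower by linarith
  qed
qed

lemma micro_mcut:
  fixes \<epsilon> :: real
  assumes \<epsilon>: "0 \<le> \<epsilon>" "\<epsilon> \<le> 1" and N: "N > 0" and ne: "micro r \<epsilon> k N s \<noteq> {}"
  shows "mcut r (2 * N) s \<le> \<epsilon> * (r * (2 * N))"
proof -
  obtain x where x: "x \<in> balanced_labelings N" "s \<in> planted.S r N (mcount \<epsilon> N) x"
    using ne by (auto simp: micro_def)
  have "mcut r (2 * N) s \<le> r * (2 * mcount \<epsilon> N)"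
    by (rule mcut_planted_le[OF planted_balanced[OF \<epsilon> N x(1)] x(2)])
  then have "real (mcut r (2 * N) s) \<le> r * (2 * real (mcount \<epsilon> N))"
    by (metis of_nat_le_iff of_nat_mult of_nat_numeral)
  also have "\<dots> \<le> r * (2 * (\<epsilon> * N))" using mcount_le(1)[OF \<epsilon>, of N] by (intro mult_left_mono) auto
  finally show ?thesis by (simp add: mult_ac)
qed

text \<open>Cauchy--Schwarz on the support of \<open>f\<close>: a mean carried by few points forces
  a large second moment.\<close>

lemma avg_square_ge:
  fixes f :: "'a \<Rightarrow> real"
  assumes A: "finite A" "A \<noteq> {}" and p: "real (card {s \<in> A. f s \<noteq> 0}) / card A \<le> p" "p > 0"
  shows "avg A (\<lambda>s. (f s)\<^sup>2) \<ge> (avg A f)\<^sup>2 / p"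
proof -
  let ?B = "{s \<in> A. f s \<noteq> 0}"
  have cA: "real (card A) > 0" using A by (simp add: card_gt_0_iff)
  have "(\<Sum>s\<in>A. f s)\<^sup>2 = (\<Sum>s\<in>?B. f s)\<^sup>2"
    by (rule arg_cong[where f = "\<lambda>t. t\<^sup>2"], rule sum.mono_neutral_right) (use A in auto)
  also have "\<dots> \<le> card ?B * (\<Sum>s\<in>?B. (f s)\<^sup>2)"
    using A sum_squared_le_sum_of_squares[of f ?B] by (simp add: mult.commute)
  also have "(\<Sum>s\<in>?B. (f s)\<^sup>2) = (\<Sum>s\<in>A. (f s)\<^sup>2)"
    by (rule sum.mono_neutral_left) (use A in auto)
  also have "card ?B * (\<Sum>s\<in>A. (f s)\<^sup>2) \<le> (p * card A) * (\<Sum>s\<in>A. (f s)\<^sup>2)"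
    using p cA by (intro mult_right_mono sum_nonneg) (auto simp: pos_divide_le_eq)
  finally have "(\<Sum>s\<in>A. f s)\<^sup>2 \<le> p * card A * (\<Sum>s\<in>A. (f s)\<^sup>2)" .
  then have "(avg A f)\<^sup>2 * (card A)\<^sup>2 \<le> p * (avg A (\<lambda>s. (f s)\<^sup>2)) * (card A)\<^sup>2"
    using cA by (simp add: avg_def power_divide power2_eq_square field_simps)
  then show ?thesis using cA p(2) by (simp add: pos_divide_le_eq mult.commute)
qed

text \<open>A tuple with a good labeling has a bisection of density at most \<epsilon> <
  \<epsilon>c, which has probability at most exp (- 2 C N). The order of the quantifiers matters:
  \<open>C\<close> is the rate of that tail and is chosen before \<open>k\<close> and
  \<eta>.\<close>

lemma micro_second_moment:
  assumes \<epsilon>: "0 < \<epsilon>" "\<epsilon> < 1" and r: "r \<ge> 1" and lim: "eps_c_limit r \<epsilon>c" and less: "\<epsilon> < \<epsilon>c"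
  shows "\<exists>C>0. \<forall>k. \<forall>\<eta>>0. \<forall>\<^sub>F N in sequentially.
    avg (perm_tuples r (2 * N)) (\<lambda>s. (real (card (micro r \<epsilon> k N s)))\<^sup>2)
      \<ge> exp (2 * N * (2 * rate r \<epsilon> - 2 * \<eta> + C))"
proof -
  have \<epsilon>': "0 \<le> \<epsilon>" "\<epsilon> \<le> 1" using \<epsilon> by auto
  obtain C :: real where C: "C > 0" "\<forall>\<^sub>F n in sequentially.
      card {s \<in> perm_tuples r n. mcut r n s \<le> \<epsilon> * (r * n)} / card (perm_tuples r n) \<le> exp (- C * n)"
    using mcut_exponential_lower_tail[OF lim r \<epsilon>'(1) less] .
  have "filterlim (\<lambda>N :: nat. 2 * N) sequentially sequentially"
    by (rule filterlim_subseq) (simp add: strict_mono_def)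
  from eventually_compose_filterlim[OF C(2) this]
  have tail: "\<forall>\<^sub>F N in sequentially. card {s \<in> perm_tuples r (2 * N). mcut r (2 * N) s \<le> \<epsilon> * (r * (2 * N))}
      / card (perm_tuples r (2 * N)) \<le> exp (- C * (2 * N))" by simp
  show ?thesis
  proof (intro exI[of _ C] conjI C(1) allI impI)
    fix k and \<eta> :: real assume \<eta>: "\<eta> > 0"
    show "\<forall>\<^sub>F N in sequentially. avg (perm_tuples r (2 * N)) (\<lambda>s. (real (card (micro r \<epsilon> k N s)))\<^sup>2)
      \<ge> exp (2 * N * (2 * rate r \<epsilon> - 2 * \<eta> + C))"
      using tail micro_first_moment[OF \<epsilon> \<eta>, of r k] eventually_gt_at_top[of 0]
    proof eventually_elim
      case (elim N)
      let ?P = "perm_tuples r (2 * N)" and ?f = "\<lambda>s. real (card (micro r \<epsilon> k N s))"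
      have "{s \<in> ?P. ?f s \<noteq> 0} \<subseteq> {s \<in> ?P. mcut r (2 * N) s \<le> \<epsilon> * (r * (2 * N))}"
        using micro_mcut[OF \<epsilon>' elim(3)] by (auto simp: card_gt_0_iff)
      then have "card {s \<in> ?P. ?f s \<noteq> 0} \<le> card {s \<in> ?P. mcut r (2 * N) s \<le> \<epsilon> * (r * (2 * N))}"
        using finite_perm_tuples by (intro card_mono) auto
      then have "real (card {s \<in> ?P. ?f s \<noteq> 0}) / card ?P \<le> exp (- C * (2 * N))"
        using elim(1) by (meson divide_right_mono of_nat_0_le_iff of_nat_mono order_trans)
      then have "avg ?P (\<lambda>s. (?f s)\<^sup>2) \<ge> (avg ?P ?f)\<^sup>2 / exp (- C * (2 * N))"
        by (intro avg_square_ge finite_perm_tuples perm_tuples_nonempty) auto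
      moreover have "(avg ?P ?f)\<^sup>2 / exp (- C * (2 * N)) \<ge> (exp (2 * N * (rate r \<epsilon> - \<eta>)))\<^sup>2 / exp (- C * (2 * N))"
        using elim(2) by (intro divide_right_mono power_mono) auto
      moreover have "(exp (2 * N * (rate r \<epsilon> - \<eta>)))\<^sup>2 / exp (- C * (2 * N)) = exp (2 * N * (2 * rate r \<epsilon> - 2 * \<eta> + C))"
        by (simp add: exp_diff[symmetric] exp_double[symmetric] algebra_simps)
      ultimately show ?case by linarith
    qed
  qed
qed

section \<open>A joining of large f-invariant\<close>

text \<open>Measures with equal labels differ by less than 1/(k+1) on every event depending on the k-ball.\<close>
definition label :: "nat \<Rightarrow> nat \<Rightarrow> (word \<Rightarrow> 'a::finite) measure \<Rightarrow> (word \<Rightarrow> 'a) set \<Rightarrow> nat" where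
  "label r k \<nu> = restrict (\<lambda>T. nat \<lfloor>(real k + 1) * measure \<nu> (fdev r (ball r k) T)\<rfloor>)
     (Pow (PiE (ball r k) (\<lambda>_. UNIV)))"

definition labels :: "nat \<Rightarrow> nat \<Rightarrow> ((word \<Rightarrow> 'a::finite) set \<Rightarrow> nat) set" where
  "labels r k = PiE (Pow (PiE (ball r k) (\<lambda>_. UNIV))) (\<lambda>_. {..k + 1})"

lemma finite_labels: "finite (labels r k :: ((word \<Rightarrow> 'a::finite) set \<Rightarrow> nat) set)"
proof -
  have "finite (PiE (ball r k) (\<lambda>_. UNIV :: 'a set))" using finite_ball by (intro finite_PiE) auto
  then show ?thesis unfolding labels_def by (intro finite_PiE) auto
qed

lemma label_in_labels:
  assumes "\<nu> \<in> prob_measures r"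
  shows "label r k \<nu> \<in> labels r k"
proof -
  interpret prob_space \<nu> using assms by (simp add: prob_measures_def)
  have "nat \<lfloor>(real k + 1) * measure \<nu> A\<rfloor> \<le> k + 1" for A
  proof -
    have "(real k + 1) * measure \<nu> A \<le> real k + 1" by (rule mult_left_le) auto
    then have "\<lfloor>(real k + 1) * measure \<nu> A\<rfloor> \<le> \<lfloor>real k + 1\<rfloor>" by (rule floor_mono)
    then show ?thesis by simp
  qed
  then show ?thesis by (simp add: label_def labels_def)
qed

lemma fdev_Int_PiE: "B \<subseteq> FG r \<Longrightarrow> fdev r B (T \<inter> PiE B (\<lambda>_. UNIV)) = fdev r B T"
  by (auto simp: fdev_def)

lemma label_eq_fdev_close:
  fixes \<nu> \<nu>' :: "(word \<Rightarrow> 'a::finite) measure"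
  assumes eq: "label r k \<nu> = label r k \<nu>'"
  shows "fdev_close r k (1 / (real k + 1)) \<nu> \<nu>'"
  unfolding fdev_close_def
proof
  fix T :: "(word \<Rightarrow> 'a) set"
  let ?T = "T \<inter> PiE (ball r k) (\<lambda>_. UNIV)"
  let ?a = "measure \<nu> (fdev r (ball r k) ?T)" and ?b = "measure \<nu>' (fdev r (ball r k) ?T)"
  have "nat \<lfloor>(real k + 1) * ?a\<rfloor> = nat \<lfloor>(real k + 1) * ?b\<rfloor>"
    using fun_cong[OF eq, of ?T] by (simp add: label_def)
  moreover have "\<lfloor>(real k + 1) * ?a\<rfloor> \<ge> 0" "\<lfloor>(real k + 1) * ?b\<rfloor> \<ge> 0" by simp_all
  ultimately have "\<lfloor>(real k + 1) * ?a\<rfloor> = \<lfloor>(real k + 1) * ?b\<rfloor>" by linarith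
  then have "\<bar>(real k + 1) * ?a - (real k + 1) * ?b\<bar> < 1" by linarith
  then have "(real k + 1) * \<bar>?a - ?b\<bar> < 1" by (simp add: right_diff_distrib[symmetric] abs_mult)
  then have "\<bar>?a - ?b\<bar> < 1 / (real k + 1)" by (simp add: pos_less_divide_eq mult.commute)
  then show "\<bar>measure \<nu> (fdev r (ball r k) T) - measure \<nu>' (fdev r (ball r k) T)\<bar> < 1 / (real k + 1)"
    by (simp only: fdev_Int_PiE[OF ball_subset_FG])
qed

text \<open>A pair of labelings is stored as one labeling by pairs, whose empirical measure is an
  approximate joining.\<close>

definition micro_pairs :: "nat \<Rightarrow> real \<Rightarrow> nat \<Rightarrow> nat \<Rightarrow> (nat \<Rightarrow> nat \<Rightarrow> nat) \<Rightarrow> (nat \<Rightarrow> bool \<times> bool) set" where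
  "micro_pairs r \<epsilon> k N s = {z \<in> PiE {..<2 * N} (\<lambda>_. UNIV).
     restrict (\<lambda>v. fst (z v)) {..<2 * N} \<in> micro r \<epsilon> k N s \<and> restrict (\<lambda>v. snd (z v)) {..<2 * N} \<in> micro r \<epsilon> k N s}"

lemma finite_micro_pairs: "finite (micro_pairs r \<epsilon> k N s)"
  unfolding micro_pairs_def by (rule finite_subset[OF _ finite_PiE_lessThan[of "2 * N"]]) auto

lemma card_micro_pairs: "(card (micro r \<epsilon> k N s))\<^sup>2 \<le> card (micro_pairs r \<epsilon> k N s)"
proof -
  let ?M = "micro r \<epsilon> k N s" and ?f = "\<lambda>(x, y). restrict (\<lambda>v. (x v, y v)) {..<2 * N}"
  have ext: "x \<in> extensional {..<2 * N}" if "x \<in> ?M" for x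
    using that by (simp add: micro_def balanced_labelings_def PiE_iff)
  have r1: "restrict (\<lambda>v. fst (?f (x, y) v)) {..<2 * N} = x" if "x \<in> ?M" for x y
  proof -
    have "restrict (\<lambda>v. fst (?f (x, y) v)) {..<2 * N} = restrict x {..<2 * N}"
      by (rule restrict_ext) simp
    then show ?thesis using extensional_restrict[OF ext[OF that]] by simp
  qed
  have r2: "restrict (\<lambda>v. snd (?f (x, y) v)) {..<2 * N} = y" if "y \<in> ?M" for x y
  proof -
    have "restrict (\<lambda>v. snd (?f (x, y) v)) {..<2 * N} = restrict y {..<2 * N}"
      by (rule restrict_ext) simp
    then show ?thesis using extensional_restrict[OF ext[OF that]] by simp
  qed
  have inj: "inj_on ?f (?M \<times> ?M)"
  proof (rule inj_onI)
    fix p q assume pq: "p \<in> ?M \<times> ?M" "q \<in> ?M \<times> ?M" "?f p = ?f q"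
    obtain x y x' y' where e: "p = (x, y)" "q = (x', y')" by (cases p, cases q)
    have m: "x \<in> ?M" "y \<in> ?M" "x' \<in> ?M" "y' \<in> ?M" using pq(1,2) e by auto
    have f: "?f (x, y) = ?f (x', y')" using pq(3) e by simp
    have "x = x'" using r1[OF m(1), of y] r1[OF m(3), of y'] unfolding f by simp
    moreover have "y = y'" using r2[OF m(2), of x] r2[OF m(4), of x'] unfolding f by simp
    ultimately show "p = q" using e by simp
  qed
  have "?f ` (?M \<times> ?M) \<subseteq> micro_pairs r \<epsilon> k N s"
  proof (rule image_subsetI)
    fix p assume p: "p \<in> ?M \<times> ?M"
    obtain x y where e: "p = (x, y)" by (cases p)
    have m: "x \<in> ?M" "y \<in> ?M" using p e by auto
    show "?f p \<in> micro_pairs r \<epsilon> k N s"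
      unfolding e micro_pairs_def mem_Collect_eq r1[OF m(1)] r2[OF m(2)] using m by simp
  qed
  then have "card (?f ` (?M \<times> ?M)) \<le> card (micro_pairs r \<epsilon> k N s)"
    by (intro card_mono finite_micro_pairs)
  then show ?thesis using card_image[OF inj] by (simp add: card_cartesian_product power2_eq_square)
qed

definition label_count :: "nat \<Rightarrow> real \<Rightarrow> nat \<Rightarrow> nat \<Rightarrow> ((word \<Rightarrow> bool \<times> bool) set \<Rightarrow> nat) \<Rightarrow> real" where
  "label_count r \<epsilon> k N l = avg (perm_tuples r (2 * N))
     (\<lambda>s. card {z \<in> micro_pairs r \<epsilon> k N s. label r k (emp r (2 * N) s z) = l})"

text \<open>Pigeonhole: the number of labels does not depend on \<open>N\<close>, so it is absorbed
  by exp (2N\<eta>). Finiteness also lets a single label be chosen for infinitely many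
  \<open>N\<close>.\<close>

lemma frequent_label:
  fixes \<theta> \<eta> :: real
  assumes mom: "\<forall>\<^sub>F N in sequentially. avg (perm_tuples r (2 * N)) (\<lambda>s. (real (card (micro r \<epsilon> k N s)))\<^sup>2)
      \<ge> exp (2 * N * (\<theta> + \<eta>))" and \<eta>: "\<eta> > 0"
  obtains l where "\<exists>\<^sub>F N in sequentially. label_count r \<epsilon> k N l \<ge> exp (2 * N * \<theta>)"
proof -
  let ?L = "labels r k :: ((word \<Rightarrow> bool \<times> bool) set \<Rightarrow> nat) set"
  have finL: "finite ?L" by (rule finite_labels)
  have "\<forall>\<^sub>F N in sequentially. real (card ?L) + 1 \<le> exp (2 * real N * \<eta>)"
    using \<eta> by real_asymp
  with mom have "\<forall>\<^sub>F N in sequentially. \<exists>l\<in>?L. label_count r \<epsilon> k N l \<ge> exp (2 * N * \<theta>)"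
    using eventually_gt_at_top[of 0]
  proof eventually_elim
    case (elim N)
    let ?P = "perm_tuples r (2 * N)"
    show ?case
    proof (rule ccontr)
      assume "\<not> ?case"
      then have lt: "label_count r \<epsilon> k N l \<le> exp (2 * N * \<theta>)" if "l \<in> ?L" for l
        using that by (simp add: not_le less_imp_le)
      have part: "real (card (micro_pairs r \<epsilon> k N s))
          = (\<Sum>l\<in>?L. real (card {z \<in> micro_pairs r \<epsilon> k N s. label r k (emp r (2 * N) s z) = l}))" for s
      proof -
        have "micro_pairs r \<epsilon> k N s = (\<Union>l\<in>?L. {z \<in> micro_pairs r \<epsilon> k N s. label r k (emp r (2 * N) s z) = l})"
          using elim(3) by (auto intro!: label_in_labels emp_prob_measures)
        then have "card (micro_pairs r \<epsilon> k N s)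
            = card (\<Union>l\<in>?L. {z \<in> micro_pairs r \<epsilon> k N s. label r k (emp r (2 * N) s z) = l})" by (rule arg_cong)
        also have "\<dots> = (\<Sum>l\<in>?L. card {z \<in> micro_pairs r \<epsilon> k N s. label r k (emp r (2 * N) s z) = l})"
        proof (rule card_UN_disjoint[OF finL])
          show "\<forall>l\<in>?L. finite {z \<in> micro_pairs r \<epsilon> k N s. label r k (emp r (2 * N) s z) = l}"
            using finite_micro_pairs by simp
          show "\<forall>l\<in>?L. \<forall>l'\<in>?L. l \<noteq> l' \<longrightarrow>
              {z \<in> micro_pairs r \<epsilon> k N s. label r k (emp r (2 * N) s z) = l}
              \<inter> {z \<in> micro_pairs r \<epsilon> k N s. label r k (emp r (2 * N) s z) = l'} = {}" by auto
        qed
        finally show ?thesis by simp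
      qed
      have "exp (2 * N * (\<theta> + \<eta>)) \<le> avg ?P (\<lambda>s. (real (card (micro r \<epsilon> k N s)))\<^sup>2)" by (rule elim(1))
      also have "\<dots> \<le> avg ?P (\<lambda>s. real (card (micro_pairs r \<epsilon> k N s)))"
      proof (rule avg_mono)
        fix s
        have "real ((card (micro r \<epsilon> k N s))\<^sup>2) \<le> real (card (micro_pairs r \<epsilon> k N s))"
          by (rule of_nat_mono) (rule card_micro_pairs)
        then show "(real (card (micro r \<epsilon> k N s)))\<^sup>2 \<le> real (card (micro_pairs r \<epsilon> k N s))" by simp
      qed
      also have "\<dots> = (\<Sum>l\<in>?L. label_count r \<epsilon> k N l)"
        unfolding label_count_def avg_def part sum_divide_distrib[symmetric] by (subst sum.swap) (rule refl)
      also have "\<dots> \<le> (\<Sum>l\<in>?L. exp (2 * N * \<theta>))" by (rule sum_mono) (rule lt)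
      also have "\<dots> = card ?L * exp (2 * N * \<theta>)" by simp
      also have "\<dots> < (card ?L + 1) * exp (2 * N * \<theta>)" by simp
      also have "\<dots> \<le> exp (2 * real N * \<eta>) * exp (2 * N * \<theta>)"
        using elim(2) by (intro mult_right_mono) auto
      also have "\<dots> = exp (2 * N * (\<theta> + \<eta>))" by (simp add: exp_add[symmetric] algebra_simps)
      finally show False by simp
    qed
  qed
  then have "\<exists>\<^sub>F N in sequentially. \<exists>l\<in>?L. label_count r \<epsilon> k N l \<ge> exp (2 * N * \<theta>)"
    by (rule eventually_frequently[rotated]) simp
  then have "\<exists>l\<in>?L. \<exists>\<^sub>F N in sequentially. label_count r \<epsilon> k N l \<ge> exp (2 * N * \<theta>)"
    by (simp only: frequently_bex_finite[OF finL])
  then show ?thesis using that by (elim bexE)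
qed

text \<open>A label is only rounded data, so it is replaced by a genuine empirical measure that
  carries it; these are the measures whose limit is taken.\<close>

lemma label_representative:
  fixes \<theta> :: real
  assumes freq: "\<exists>\<^sub>F N in sequentially. label_count r \<epsilon> k N l \<ge> exp (2 * N * \<theta>)"
  obtains N s z where "N > 0" "s \<in> perm_tuples r (2 * N)" "z \<in> micro_pairs r \<epsilon> k N s"
    "label r k (emp r (2 * N) s z) = l"
proof -
  obtain N where N: "N > 0" "label_count r \<epsilon> k N l \<ge> exp (2 * N * \<theta>)"
    using frequently_eventually_conj[OF freq eventually_gt_at_top[of 0]] by (auto dest!: frequently_ex)
  have "label_count r \<epsilon> k N l > 0" using N(2) by (rule less_le_trans[rotated]) simp
  then have "\<exists>s\<in>perm_tuples r (2 * N). {z \<in> micro_pairs r \<epsilon> k N s. label r k (emp r (2 * N) s z) = l} \<noteq> {}"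
  proof (rule contrapos_pp)
    assume "\<not> ?thesis"
    then have "{z \<in> micro_pairs r \<epsilon> k N s. label r k (emp r (2 * N) s z) = l} = {}" if "s \<in> perm_tuples r (2 * N)" for s
      using that by simp
    then have "label_count r \<epsilon> k N l = avg (perm_tuples r (2 * N)) (\<lambda>s. 0)"
      unfolding label_count_def by (intro avg_cong) (simp only: card.empty of_nat_0)
    then show "\<not> label_count r \<epsilon> k N l > 0" by (simp add: avg_def)
  qed
  then show ?thesis using that[OF N(1)] by blast
qed

lemma limsup_ge_of_frequently:
  fixes u :: "nat \<Rightarrow> ereal"
  assumes "\<exists>\<^sub>F n in sequentially. u n \<ge> c"
  shows "limsup u \<ge> c"
proof (rule ccontr)
  assume "\<not> limsup u \<ge> c"
  then have "limsup u < c" by simp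
  then have "\<forall>\<^sub>F n in sequentially. u n < c" by (rule Limsup_lessD)
  then have "\<forall>\<^sub>F n in sequentially. \<not> u n \<ge> c" by eventually_elim simp
  with assms show False by (simp add: frequently_def)
qed

lemma frequently_double:
  assumes "\<exists>\<^sub>F N in sequentially. P (2 * N)"
  shows "\<exists>\<^sub>F n in sequentially. P (n :: nat)"
proof -
  have "filterlim (\<lambda>N :: nat. 2 * N) sequentially sequentially"
    by (rule filterlim_subseq) (simp add: strict_mono_def)
  then have "eventually (\<lambda>n. \<not> P n) sequentially \<Longrightarrow> eventually (\<lambda>N. \<not> P (2 * N)) sequentially"
    by (rule eventually_compose_filterlim[rotated])
  then show ?thesis using assms by (auto simp: frequently_def)
qed

text \<open>For a neighbourhood of \<mu>, a sufficiently late label class lies entirely inside it,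
  because all its members are close to the representative and the representative is close to \<mu>.
  The frequent pairs are then counted by \<open>Omega\<close>.\<close>

lemma f_inv_ge_of_labels:
  fixes \<theta> :: real and \<mu> :: "(word \<Rightarrow> bool \<times> bool) measure"
  assumes \<phi>: "strict_mono \<phi>" and \<mu>: "\<mu> \<in> prob_measures r"
    and N: "\<And>k. N k > 0"
    and lim: "\<And>B T. finite B \<Longrightarrow> B \<subseteq> FG r \<Longrightarrow>
      (\<lambda>j. measure (emp r (2 * N (\<phi> j)) (s (\<phi> j)) (z (\<phi> j))) (fdev r B T)) \<longlonglongrightarrow> measure \<mu> (fdev r B T)"
    and freq: "\<And>k. \<exists>\<^sub>F M in sequentially.
      label_count r \<epsilon> k M (label r k (emp r (2 * N k) (s k) (z k))) \<ge> exp (real (2 * M) * \<theta>)"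
  shows "f_inv r \<mu> \<ge> ereal \<theta>"
  unfolding f_inv_def
proof (rule INF_greatest)
  fix U assume "U \<in> {U. weak_open r U \<and> \<mu> \<in> U}"
  then have U: "weak_open r U" "\<mu> \<in> U" by auto
  obtain k0 \<delta> where \<delta>: "\<delta> > 0" "\<And>\<nu>. \<nu> \<in> prob_measures r \<Longrightarrow> fdev_close r k0 \<delta> \<nu> \<mu> \<Longrightarrow> \<nu> \<in> U"
    using weak_open_fdev_close[OF U] by metis
  let ?W = "PiE (ball r k0) (\<lambda>_. UNIV :: (bool \<times> bool) set)"
  let ?\<nu> = "\<lambda>k. emp r (2 * N k) (s k) (z k)"
  have finW: "finite (Pow ?W)" using finite_ball by (simp add: finite_PiE)
  have "\<forall>\<^sub>F j in sequentially. \<forall>T\<in>Pow ?W. \<bar>measure (?\<nu> (\<phi> j)) (fdev r (ball r k0) T) - measure \<mu> (fdev r (ball r k0) T)\<bar> < \<delta> / 2"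
  proof (rule eventually_ball_finite[OF finW], rule ballI)
    fix T
    have "\<forall>\<^sub>F j in sequentially. dist (measure (?\<nu> (\<phi> j)) (fdev r (ball r k0) T)) (measure \<mu> (fdev r (ball r k0) T)) < \<delta> / 2"
      using lim[OF finite_ball ball_subset_FG, of k0 T] \<delta>(1) by (intro tendstoD) auto
    then show "\<forall>\<^sub>F j in sequentially. \<bar>measure (?\<nu> (\<phi> j)) (fdev r (ball r k0) T) - measure \<mu> (fdev r (ball r k0) T)\<bar> < \<delta> / 2"
      by (simp add: dist_real_def)
  qed
  moreover have "\<forall>\<^sub>F j in sequentially. 1 / (real j + 1) < \<delta> / 2"
    using \<delta>(1) by real_asymp
  ultimately have "\<forall>\<^sub>F j in sequentially. (\<forall>T\<in>Pow ?W. \<bar>measure (?\<nu> (\<phi> j)) (fdev r (ball r k0) T)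
      - measure \<mu> (fdev r (ball r k0) T)\<bar> < \<delta> / 2) \<and> 1 / (real j + 1) < \<delta> / 2 \<and> k0 \<le> j"
    using eventually_ge_at_top[of k0] by eventually_elim blast
  then obtain j where j: "\<And>T. T \<subseteq> ?W \<Longrightarrow> \<bar>measure (?\<nu> (\<phi> j)) (fdev r (ball r k0) T) - measure \<mu> (fdev r (ball r k0) T)\<bar> < \<delta> / 2"
    "1 / (real j + 1) < \<delta> / 2" "k0 \<le> j"
    by (auto dest!: eventually_happens)
  \<comment> \<open>Since \<open>\<phi> j\<close> is at least \<open>j\<close>, the tolerance 1 / (K
    + 1) is no larger and \<open>k0\<close> is still at most \<open>K\<close>.\<close>
  define K where "K = \<phi> j"
  have jK: "j \<le> K" unfolding K_def using \<phi> by (rule seq_suble)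
  have K: "1 / (real K + 1) \<le> \<delta> / 2" "k0 \<le> K"
  proof -
    have "1 / (real K + 1) \<le> 1 / (real j + 1)" using jK by (intro divide_left_mono) auto
    then show "1 / (real K + 1) \<le> \<delta> / 2" using j(2) by linarith
    show "k0 \<le> K" using j(3) jK by simp
  qed
  have inU: "\<nu> \<in> U" if \<nu>: "\<nu> \<in> prob_measures r" and l: "label r K \<nu> = label r K (?\<nu> K)" for \<nu>
  proof (rule \<delta>(2)[OF \<nu>])
    have c: "fdev_close r k0 (\<delta> / 2) \<nu> (?\<nu> K)"
      using fdev_close_mono[OF label_eq_fdev_close[OF l] K(2,1)] .
    show "fdev_close r k0 \<delta> \<nu> \<mu>"
      unfolding fdev_close_def
    proof
      fix T :: "(word \<Rightarrow> bool \<times> bool) set"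
      have "\<bar>measure \<nu> (fdev r (ball r k0) T) - measure (?\<nu> K) (fdev r (ball r k0) T)\<bar> < \<delta> / 2"
        using c unfolding fdev_close_def by blast
      moreover have "\<bar>measure (?\<nu> K) (fdev r (ball r k0) T) - measure \<mu> (fdev r (ball r k0) T)\<bar> < \<delta> / 2"
        using j(1)[of "T \<inter> ?W"] unfolding K_def by (simp only: fdev_Int_PiE[OF ball_subset_FG] Int_lower2)
      ultimately show "\<bar>measure \<nu> (fdev r (ball r k0) T) - measure \<mu> (fdev r (ball r k0) T)\<bar> < \<delta>" by linarith
    qed
  qed
  let ?l = "label r K (?\<nu> K)"
  have "\<exists>\<^sub>F M in sequentially. M > 0 \<and> label_count r \<epsilon> K M ?l \<ge> exp (real (2 * M) * \<theta>)"
    using frequently_eventually_conj[OF freq[of K] eventually_gt_at_top[of 0]] .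
  then have "\<exists>\<^sub>F M in sequentially. ereal \<theta> \<le> ereal (1 / real (2 * M)) * elog (expected_count r (2 * M) U)"
  proof (rule frequently_elim1)
    fix M assume M: "M > 0 \<and> label_count r \<epsilon> K M ?l \<ge> exp (real (2 * M) * \<theta>)"
    let ?P = "perm_tuples r (2 * M)"
    have "label_count r \<epsilon> K M ?l \<le> avg ?P (\<lambda>s. card (Omega r (2 * M) s U))"
      unfolding label_count_def
    proof (rule avg_mono, rule of_nat_mono, rule card_mono)
      fix s
      show "finite (Omega r (2 * M) s U)"
        unfolding Omega_def by (rule finite_subset[OF _ finite_PiE_lessThan[of "2 * M"]]) auto
      show "{z \<in> micro_pairs r \<epsilon> K M s. label r K (emp r (2 * M) s z) = ?l} \<subseteq> Omega r (2 * M) s U"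
        using inU[OF emp_prob_measures] M by (auto simp: micro_pairs_def Omega_def)
    qed
    also have "\<dots> = expected_count r (2 * M) U" by (simp add: avg_def expected_count_def)
    finally have E: "exp (real (2 * M) * \<theta>) \<le> expected_count r (2 * M) U" using M by linarith
    then have pos: "expected_count r (2 * M) U > 0" by (rule less_le_trans[rotated]) simp
    have "real (2 * M) * \<theta> \<le> ln (expected_count r (2 * M) U)" using E pos by (simp add: ln_ge_iff)
    then have "\<theta> \<le> 1 / real (2 * M) * ln (expected_count r (2 * M) U)"
      using M by (simp add: pos_le_divide_eq mult.commute)
    then show "ereal \<theta> \<le> ereal (1 / real (2 * M)) * elog (expected_count r (2 * M) U)"
      using pos by (simp add: elog_def)
  qed
  from frequently_double[OF this]
  show "ereal \<theta> \<le> limsup (\<lambda>n. ereal (1 / real n) * elog (expected_count r n U))"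
    by (rule limsup_ge_of_frequently)
qed

text \<open>Applying a letter map commutes with forming empirical measures, because the action keeps
  vertices below \<open>n\<close>, where the restricted labeling agrees with the original.\<close>

lemma emp_marginal_fdev:
  fixes z :: "nat \<Rightarrow> 'a::finite" and h :: "'a \<Rightarrow> 'b::finite"
  assumes s: "s \<in> perm_tuples r n" and n: "n > 0" and B: "finite B" "B \<subseteq> FG r"
  shows "measure (emp r n s z) (fdev r (id ` B) {y. restrict (\<lambda>\<gamma>. h (y (id \<gamma>))) B \<in> T})
    = measure (emp r n s (restrict (\<lambda>v. h (z v)) {..<n})) (fdev r B T)"
proof -
  have "restrict (\<lambda>\<gamma>. h (restrict (\<lambda>\<gamma>. z (act s \<gamma> v)) (id ` B) (id \<gamma>))) B
      = restrict (\<lambda>\<gamma>. restrict (\<lambda>v. h (z v)) {..<n} (act s \<gamma> v)) B" if "v < n" for v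
  proof (rule restrict_ext)
    fix \<gamma> assume "\<gamma> \<in> B"
    then have "act s \<gamma> v < n" using B(2) that by (intro act_in[OF s]) (auto simp: FG_def)
    then show "h (restrict (\<lambda>\<gamma>. z (act s \<gamma> v)) (id ` B) (id \<gamma>)) = restrict (\<lambda>v. h (z v)) {..<n} (act s \<gamma> v)"
      using \<open>\<gamma> \<in> B\<close> by simp
  qed
  then have "{v. v < n \<and> restrict (\<lambda>\<gamma>. z (act s \<gamma> v)) (id ` B) \<in> {y. restrict (\<lambda>\<gamma>. h (y (id \<gamma>))) B \<in> T}}
      = {v. v < n \<and> restrict (\<lambda>\<gamma>. restrict (\<lambda>v. h (z v)) {..<n} (act s \<gamma> v)) B \<in> T}"
    by (simp only: mem_Collect_eq cong: conj_cong)
  moreover have "id ` B \<subseteq> FG r" using B(2) by simp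
  ultimately show ?thesis
    using measure_emp[OF n finite_imageI[OF B(1)], of id r s z] measure_emp[OF n B, of s _ T] by simp
qed

text \<open>The marginal empirical measures have two limits: the marginal of \<mu> along the
  subsequence, and Ising because their tolerances tend to zero.\<close>

lemma marginal_limit_Ising:
  fixes \<mu> :: "(word \<Rightarrow> 'a::finite) measure" and h :: "'a \<Rightarrow> bool"
  assumes \<epsilon>: "0 \<le> \<epsilon>" "\<epsilon> \<le> 1" and \<phi>: "strict_mono \<phi>" and \<mu>: "\<mu> \<in> prob_measures r"
    and N: "\<And>k. N k > 0" and s: "\<And>k. s k \<in> perm_tuples r (2 * N k)"
    and lim: "\<And>B T. finite B \<Longrightarrow> B \<subseteq> FG r \<Longrightarrow>
      (\<lambda>j. measure (emp r (2 * N (\<phi> j)) (s (\<phi> j)) (z (\<phi> j))) (fdev r B T)) \<longlonglongrightarrow> measure \<mu> (fdev r B T)"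
    and close: "\<And>k. fdev_close r k (1 / (real k + 1))
      (emp r (2 * N k) (s k) (restrict (\<lambda>v. h (z k v)) {..<2 * N k})) (Ising r \<epsilon>)"
  shows "distr \<mu> (CS r) (\<lambda>x. restrict (\<lambda>\<gamma>. h (x (id \<gamma>))) (FG r)) = Ising r \<epsilon>"
proof (rule prob_measures_eqI[OF _ Ising_prob_measures[OF \<epsilon>]])
  show "distr \<mu> (CS r) (\<lambda>x. restrict (\<lambda>\<gamma>. h (x (id \<gamma>))) (FG r)) \<in> prob_measures r"
    by (intro distr_prob_measures \<mu> measurable_coordinatewise) simp
  fix k0 and \<xi> :: "word \<Rightarrow> bool"
  let ?B = "ball r k0"
  let ?\<alpha> = "\<lambda>k. emp r (2 * N k) (s k) (restrict (\<lambda>v. h (z k v)) {..<2 * N k})"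
  have eq: "measure (distr \<mu> (CS r) (\<lambda>x. restrict (\<lambda>\<gamma>. h (x (id \<gamma>))) (FG r))) (fdev r ?B {\<xi>})
      = measure \<mu> (fdev r (id ` ?B) {y. restrict (\<lambda>\<gamma>. h (y (id \<gamma>))) ?B \<in> {\<xi>}})"
    by (rule measure_distr_coordinatewise[OF \<mu> _ finite_ball ball_subset_FG]) simp
  have lim1: "(\<lambda>j. measure (?\<alpha> (\<phi> j)) (fdev r ?B {\<xi>}))
      \<longlonglongrightarrow> measure \<mu> (fdev r (id ` ?B) {y. restrict (\<lambda>\<gamma>. h (y (id \<gamma>))) ?B \<in> {\<xi>}})"
  proof -
    have "finite (id ` ?B)" "id ` ?B \<subseteq> FG r" using finite_ball ball_subset_FG by auto
    from lim[OF this, of "{y. restrict (\<lambda>\<gamma>. h (y (id \<gamma>))) ?B \<in> {\<xi>}}"]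
    show ?thesis
      using emp_marginal_fdev[OF s _ finite_ball ball_subset_FG, where h = h and T = "{\<xi>}"] N by simp
  qed
  have lim2: "(\<lambda>j. measure (?\<alpha> (\<phi> j)) (fdev r ?B {\<xi>})) \<longlonglongrightarrow> measure (Ising r \<epsilon>) (fdev r ?B {\<xi>})"
  proof -
    have "\<forall>\<^sub>F j in sequentially. norm (measure (?\<alpha> (\<phi> j)) (fdev r ?B {\<xi>}) - measure (Ising r \<epsilon>) (fdev r ?B {\<xi>})) \<le> 1 / (real j + 1)"
      using eventually_ge_at_top[of k0]
    proof eventually_elim
      case (elim j)
      have jK: "j \<le> \<phi> j" using \<phi> by (rule seq_suble)
      have "1 / (real (\<phi> j) + 1) \<le> 1 / (real j + 1)" using jK by (intro divide_left_mono) auto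
      then have "fdev_close r k0 (1 / (real j + 1)) (?\<alpha> (\<phi> j)) (Ising r \<epsilon>)"
        using elim jK by (intro fdev_close_mono[OF close]) auto
      then have "\<bar>measure (?\<alpha> (\<phi> j)) (fdev r ?B {\<xi>}) - measure (Ising r \<epsilon>) (fdev r ?B {\<xi>})\<bar> < 1 / (real j + 1)"
        unfolding fdev_close_def by blast
      then show ?case by simp
    qed
    moreover have "(\<lambda>j. 1 / (real j + 1)) \<longlonglongrightarrow> 0" by real_asymp
    ultimately have "(\<lambda>j. measure (?\<alpha> (\<phi> j)) (fdev r ?B {\<xi>}) - measure (Ising r \<epsilon>) (fdev r ?B {\<xi>})) \<longlonglongrightarrow> 0"
      by (rule Lim_null_comparison)
    then show ?thesis by (simp add: LIM_zero_iff)
  qed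
  show "measure (distr \<mu> (CS r) (\<lambda>x. restrict (\<lambda>\<gamma>. h (x (id \<gamma>))) (FG r))) (fdev r ?B {\<xi>})
      = measure (Ising r \<epsilon>) (fdev r ?B {\<xi>})"
    unfolding eq by (rule LIMSEQ_unique[OF lim1 lim2])
qed

lemma exists_joining_large_f_inv:
  assumes \<epsilon>: "0 < \<epsilon>" "\<epsilon> < 1" and r: "r \<ge> 1" and lim: "eps_c_limit r \<epsilon>c" and less: "\<epsilon> < \<epsilon>c"
  obtains c J where "c > 0" "J \<in> joinings r (Ising r \<epsilon>) (Ising r \<epsilon>)" "f_inv r J \<ge> ereal (2 * rate r \<epsilon> + c)"
proof -
  have \<epsilon>': "0 \<le> \<epsilon>" "\<epsilon> \<le> 1" using \<epsilon> by auto
  from micro_second_moment[OF \<epsilon> r lim less]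
  obtain C where C': "C > 0 \<and> (\<forall>k. \<forall>\<eta>>0. \<forall>\<^sub>F N in sequentially.
      avg (perm_tuples r (2 * N)) (\<lambda>s. (real (card (micro r \<epsilon> k N s)))\<^sup>2)
        \<ge> exp (2 * N * (2 * rate r \<epsilon> - 2 * \<eta> + C)))" by (elim exE)
  note C = conjunct1[OF C'] conjunct2[OF C', rule_format]
  \<comment> \<open>The gain \<open>C\<close> pays 2\<eta> for the squared first moment and \<eta>
    for the pigeonhole step; with \<eta> = C/6 half of it is left in \<theta>.\<close>
  define \<eta> where "\<eta> = C / 6"
  define \<theta> where "\<theta> = 2 * rate r \<epsilon> + C / 2"
  have \<eta>: "\<eta> > 0" using C(1) by (simp add: \<eta>_def)
  have \<theta>: "2 * rate r \<epsilon> - 2 * \<eta> + C = \<theta> + \<eta>" by (simp add: \<eta>_def \<theta>_def)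
  have "\<exists>l. \<exists>\<^sub>F N in sequentially. label_count r \<epsilon> k N l \<ge> exp (2 * N * \<theta>)" for k
  proof (rule frequent_label[OF C(2)[OF \<eta>, unfolded \<theta>] \<eta>])
    fix l assume fr: "\<exists>\<^sub>F N in sequentially. label_count r \<epsilon> k N l \<ge> exp (2 * N * \<theta>)"
    show ?thesis by (rule exI[of _ l]) (rule fr)
  qed
  then obtain l where l: "\<And>k. \<exists>\<^sub>F N in sequentially. label_count r \<epsilon> k N (l k) \<ge> exp (2 * N * \<theta>)" by metis
  define Q where "Q k N s z \<longleftrightarrow> N > 0 \<and> s \<in> perm_tuples r (2 * N) \<and> z \<in> micro_pairs r \<epsilon> k N s \<and>
    label r k (emp r (2 * N) s z) = l k" for k N s z
  have "\<exists>N s z. Q k N s z" for k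
  proof (rule label_representative[OF l[of k]])
    fix N s z assume "N > 0" "s \<in> perm_tuples r (2 * N)" "z \<in> micro_pairs r \<epsilon> k N s"
      "label r k (emp r (2 * N) s z) = l k"
    then have "Q k N s z" by (simp add: Q_def)
    then show ?thesis by (intro exI)
  qed
  then obtain N s z where "\<And>k. Q k (N k) (s k) (z k)" by metis
  then have Nsz: "\<And>k. N k > 0" "\<And>k. s k \<in> perm_tuples r (2 * N k)"
      "\<And>k. z k \<in> micro_pairs r \<epsilon> k (N k) (s k)" "\<And>k. label r k (emp r (2 * N k) (s k) (z k)) = l k"
    by (simp_all add: Q_def)
  have N2: "2 * N k > 0" for k using Nsz(1) by simp
  show ?thesis
  proof (rule prob_measures_sequentially_compact[of "\<lambda>k. emp r (2 * N k) (s k) (z k)" r, OF emp_prob_measures[OF N2]])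
    fix \<phi> \<mu> assume \<phi>: "strict_mono \<phi>" "\<mu> \<in> prob_measures r"
      and conv: "\<And>B T. finite B \<Longrightarrow> B \<subseteq> FG r \<Longrightarrow>
        (\<lambda>j. measure (emp r (2 * N (\<phi> j)) (s (\<phi> j)) (z (\<phi> j))) (fdev r B T)) \<longlonglongrightarrow> measure \<mu> (fdev r B T)"
    have inv: "shift_invariant r \<mu>"
      by (rule shift_invariant_emp_limit[OF \<phi>(2) Nsz(2) N2 conv])
    have c1: "fdev_close r k (1 / (real k + 1)) (emp r (2 * N k) (s k) (restrict (\<lambda>v. fst (z k v)) {..<2 * N k})) (Ising r \<epsilon>)"
      and c2: "fdev_close r k (1 / (real k + 1)) (emp r (2 * N k) (s k) (restrict (\<lambda>v. snd (z k v)) {..<2 * N k})) (Ising r \<epsilon>)" for k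
      using Nsz(3)[of k] by (simp_all add: micro_pairs_def micro_def)
    have "\<mu> \<in> joinings r (Ising r \<epsilon>) (Ising r \<epsilon>)"
      unfolding joinings_def marg1_eq marg2_eq
      using inv marginal_limit_Ising[OF \<epsilon>' \<phi> Nsz(1,2) conv c1] marginal_limit_Ising[OF \<epsilon>' \<phi> Nsz(1,2) conv c2] by simp
    moreover have "f_inv r \<mu> \<ge> ereal \<theta>"
    proof (rule f_inv_ge_of_labels[OF \<phi> Nsz(1) conv])
      show "\<exists>\<^sub>F M in sequentially. label_count r \<epsilon> k M (label r k (emp r (2 * N k) (s k) (z k)))
          \<ge> exp (real (2 * M) * \<theta>)" for k
        unfolding Nsz(4) by (rule l)
    qed
    ultimately show ?thesis using that[of "C / 2" \<mu>] C(1) by (simp add: \<theta>_def)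
  qed
qed

theorem theorem3:
  fixes r :: nat and \<epsilon> \<epsilon>c :: real
  assumes "eps_c_limit r \<epsilon>c"
    and "0 < \<epsilon>" and "\<epsilon> \<le> 1/2" and "\<epsilon> < \<epsilon>c"
  shows "\<exists>J\<in>joinings r (Ising r \<epsilon>) (Ising r \<epsilon>).
           f_inv r J > f_inv r (prod_join r (Ising r \<epsilon>) (Ising r \<epsilon>))"
proof -
  have r: "r \<ge> 1"
  proof (rule ccontr)
    assume "\<not> r \<ge> 1"
    then have "r = 0" by simp
    then have "\<epsilon>c = 0" using assms(1) eps_c_limit_zero by simp
    then show False using assms(2,4) by simp
  qed
  have \<epsilon>: "0 < \<epsilon>" "\<epsilon> < 1" using assms(2,3) by auto
  obtain c J where J: "c > 0" "J \<in> joinings r (Ising r \<epsilon>) (Ising r \<epsilon>)"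
    "f_inv r J \<ge> ereal (2 * rate r \<epsilon> + c)"
    by (rule exists_joining_large_f_inv[OF \<epsilon> r assms(1,4)])
  \<comment> \<open>Slack c/2 in the upper bound leaves a strict gap, and both bounds are finite, so
    the comparison in the extended reals is strict.\<close>
  have "f_inv r (prod_join r (Ising r \<epsilon>) (Ising r \<epsilon>)) \<le> ereal (2 * rate r \<epsilon> + c / 2)"
    using J(1) by (intro f_inv_prod_join_le \<epsilon> r) simp
  also have "\<dots> < ereal (2 * rate r \<epsilon> + c)" using J(1) by simp
  also have "\<dots> \<le> f_inv r J" by (rule J(3))
  finally show ?thesis using J(2) by blast
qed

end
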